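(* Let $A$ be a ring, $I$ and $J$ two ideals of $A$ and $N\subseteq M$ two $A$-modules. Then $$s_{J}(N,M;I)\le\mathrm{rt}_{J}(I;M/N)\le\max(\mathrm{rt}_{J}(I;M),\,s_{J}(N,M;I)).$$
   Context: All rings are commutative with identity. The quantities below may be $\infty$ (minimum of an empty set is $\infty$). Artin-Rees number modulo $J$: for $n\ge1$ let $$E_{J}(N,M;I)_{n}=\frac{I^{n}M\cap N}{I(I^{n-1}M\cap N)+(JI^{n}M)\cap N}$$ and $s_J(N,M;I)=\min\{s\ge0\mid E_J(N,M;I)_n=0\text{ for all }n\ge s+1\}$. Relation type: for a ring $R$, a standard $R$-algebra is a commutative graded algebra $U=\bigoplus_{n\ge0}U_n$ with $U_0=R$, generated by $U_1$; a standard $U$-module is a graded $U$-module $F=\bigoplus_{n\ge0}F_n$ with $F_n=U_nF_0$ for all $n$. Let $\gamma:\mathbf{S}(U_1)\otimes_R F_0\to U\otimes_R F_0\to F$ be the canonical surjection, $\mathbf{S}$ denoting the symmetric algebra. For $n\ge2$ put $E(F)_n=\ker\gamma_n/U_1\ker\gamma_{n-1}$, and $\mathrm{rt}(F)=\min\{r\ge1\mid E(F)_n=0\text{ for all }n\ge r+1\}$. For an $A$-module $L$, the Rees module of $I$ with respect to $L$ and modulo $J$ is $\mathcal{R}_J(I;L)=\bigoplus_{n\ge0}I^nL/JI^nL$, a standard module over the standard $A/J$-algebra $\mathcal{R}_J(I)=\bigoplus_{n\ge0}I^n/JI^n$, and $\mathrm{rt}_J(I;L)=\mathrm{rt}(\mathcal{R}_J(I;L))$.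 *)

theory Defs
  imports "HOL-Library.Extended_Nat" "HOL-Algebra.Module" "HOL-Algebra.QuotRing" "HOL-Algebra.Ideal_Product"
begin

section \<open>Submodules, quotients and free modules\<close>

definition submodule_gen :: "('r, 'd) ring_scheme \<Rightarrow> ('r, 'm, 'c) module_scheme \<Rightarrow> 'm set \<Rightarrow> 'm set"
  where "submodule_gen R M S = \<Inter>{H. submodule H R M \<and> S \<subseteq> H}"

definition ideal_smult ::
    "('r, 'd) ring_scheme \<Rightarrow> ('r, 'm, 'c) module_scheme \<Rightarrow> 'r set \<Rightarrow> 'm set \<Rightarrow> 'm set"
  where "ideal_smult R M I N = submodule_gen R M {a \<odot>\<^bsub>M\<^esub> x | a x. a \<in> I \<and> x \<in> N}"

definition ideal_power :: "('r, 'd) ring_scheme \<Rightarrow> 'r set \<Rightarrow> nat \<Rightarrow> 'r set"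
  where "ideal_power R I n = I [^]\<^bsub>ideals_set R\<^esub> n"

definition self_module :: "('r, 'd) ring_scheme \<Rightarrow> ('r, 'r) module"
  where "self_module R =
    \<lparr>carrier = carrier R, mult = mult R, one = one R, zero = zero R, add = add R, smult = mult R\<rparr>"

text \<open>The library's record type of modules extends that of rings; the ring multiplication and the
  unit play no role for modules and are left undefined in the modules built here.\<close>

text \<open>\<open>subquotient M P Q\<close> is the module \<open>P / Q\<close> of cosets, for submodules \<open>Q \<subseteq> P\<close> of \<open>M\<close>.\<close>
definition subquotient :: "('r, 'm, 'c) module_scheme \<Rightarrow> 'm set \<Rightarrow> 'm set \<Rightarrow> ('r, 'm set) module"
  where "subquotient M P Q =
    \<lparr>carrier = (\<lambda>x. Q +>\<^bsub>M\<^esub> x) ` P, mult = undefined, one = undefined,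
     zero = Q, add = set_add M, smult = (\<lambda>a X. \<Union>x\<in>X. Q +>\<^bsub>M\<^esub> (a \<odot>\<^bsub>M\<^esub> x))\<rparr>"

definition quotient_module :: "('r, 'm, 'c) module_scheme \<Rightarrow> 'm set \<Rightarrow> ('r, 'm set) module"
  where "quotient_module M N = subquotient M (carrier M) N"

definition zero_module :: "('r, 'm, 'c) module_scheme \<Rightarrow> bool"
  where "zero_module M \<longleftrightarrow> carrier M = {\<zero>\<^bsub>M\<^esub>}"

text \<open>The free \<open>R\<close>-module on a set \<open>X\<close>: finitely supported functions \<open>X \<rightarrow> R\<close>, extended by zero.\<close>
definition free_module :: "('r, 'd) ring_scheme \<Rightarrow> 'x set \<Rightarrow> ('r, 'x \<Rightarrow> 'r) module"
  where "free_module R X =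
    \<lparr>carrier = {p. (\<forall>x. p x \<in> carrier R) \<and> finite {x. p x \<noteq> \<zero>\<^bsub>R\<^esub>} \<and> {x. p x \<noteq> \<zero>\<^bsub>R\<^esub>} \<subseteq> X},
     mult = undefined, one = undefined,
     zero = (\<lambda>x. \<zero>\<^bsub>R\<^esub>), add = (\<lambda>p q x. p x \<oplus>\<^bsub>R\<^esub> q x), smult = (\<lambda>a p x. a \<otimes>\<^bsub>R\<^esub> p x)\<rparr>"

definition free_gen :: "('r, 'd) ring_scheme \<Rightarrow> 'x \<Rightarrow> 'x \<Rightarrow> 'r"
  where "free_gen R x = (\<lambda>y. if y = x then \<one>\<^bsub>R\<^esub> else \<zero>\<^bsub>R\<^esub>)"

definition free_lift ::
    "('r, 'd) ring_scheme \<Rightarrow> ('r, 'p, 'e) module_scheme \<Rightarrow> ('x \<Rightarrow> 'p) \<Rightarrow> ('x \<Rightarrow> 'r) \<Rightarrow> 'p"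
  where "free_lift R P b p = (\<Oplus>\<^bsub>P\<^esub> x \<in> {x. p x \<noteq> \<zero>\<^bsub>R\<^esub>}. p x \<odot>\<^bsub>P\<^esub> b x)"

text \<open>The linear map to \<open>P\<close> induced by \<open>b\<close> on a quotient of a free module, the argument \<open>Z\<close> being
  a coset. It is meaningful when the linear extension of \<open>b\<close> kills the relations, so that the image
  of \<open>Z\<close> is a singleton.\<close>
definition induced_map ::
    "('r, 'd) ring_scheme \<Rightarrow> ('r, 'p, 'e) module_scheme \<Rightarrow> ('x \<Rightarrow> 'p) \<Rightarrow> ('x \<Rightarrow> 'r) set \<Rightarrow> 'p"
  where "induced_map R P b Z = the_elem (free_lift R P b ` Z)"


section \<open>Tensor products\<close>

definition tensor_relations ::
    "('r, 'd) ring_scheme \<Rightarrow> ('r, 'm, 'c) module_scheme \<Rightarrow> ('r, 'n, 'e) module_scheme \<Rightarrow>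
     ('m \<times> 'n \<Rightarrow> 'r) set"
  where "tensor_relations R M N =
    (let F = free_module R (carrier M \<times> carrier N); g = free_gen R in
      {g (x \<oplus>\<^bsub>M\<^esub> x', y) \<ominus>\<^bsub>F\<^esub> (g (x, y) \<oplus>\<^bsub>F\<^esub> g (x', y)) | x x' y.
         x \<in> carrier M \<and> x' \<in> carrier M \<and> y \<in> carrier N} \<union>
      {g (x, y \<oplus>\<^bsub>N\<^esub> y') \<ominus>\<^bsub>F\<^esub> (g (x, y) \<oplus>\<^bsub>F\<^esub> g (x, y')) | x y y'.
         x \<in> carrier M \<and> y \<in> carrier N \<and> y' \<in> carrier N} \<union>
      {g (a \<odot>\<^bsub>M\<^esub> x, y) \<ominus>\<^bsub>F\<^esub> (a \<odot>\<^bsub>F\<^esub> g (x, y)) | a x y.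
         a \<in> carrier R \<and> x \<in> carrier M \<and> y \<in> carrier N} \<union>
      {g (x, a \<odot>\<^bsub>N\<^esub> y) \<ominus>\<^bsub>F\<^esub> (a \<odot>\<^bsub>F\<^esub> g (x, y)) | a x y.
         a \<in> carrier R \<and> x \<in> carrier M \<and> y \<in> carrier N})"

definition tensor_null ::
    "('r, 'd) ring_scheme \<Rightarrow> ('r, 'm, 'c) module_scheme \<Rightarrow> ('r, 'n, 'e) module_scheme \<Rightarrow>
     ('m \<times> 'n \<Rightarrow> 'r) set"
  where "tensor_null R M N =
    submodule_gen R (free_module R (carrier M \<times> carrier N)) (tensor_relations R M N)"

definition tensor_module ::
    "('r, 'd) ring_scheme \<Rightarrow> ('r, 'm, 'c) module_scheme \<Rightarrow> ('r, 'n, 'e) module_scheme \<Rightarrow>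
     ('r, ('m \<times> 'n \<Rightarrow> 'r) set) module"
  where "tensor_module R M N =
    quotient_module (free_module R (carrier M \<times> carrier N)) (tensor_null R M N)"

definition pure_tensor ::
    "('r, 'd) ring_scheme \<Rightarrow> ('r, 'm, 'c) module_scheme \<Rightarrow> ('r, 'n, 'e) module_scheme \<Rightarrow>
     'm \<Rightarrow> 'n \<Rightarrow> ('m \<times> 'n \<Rightarrow> 'r) set"
  where "pure_tensor R M N x y =
    tensor_null R M N +>\<^bsub>free_module R (carrier M \<times> carrier N)\<^esub> free_gen R (x, y)"


section \<open>Symmetric algebras\<close>

text \<open>The degree \<open>n\<close> component of the symmetric algebra of \<open>V\<close>, i.e. of the tensor algebra modulo
  the two-sided ideal generated by the \<open>v \<otimes> w - w \<otimes> v\<close>. The word \<open>[v\<^sub>1, \<dots>, v\<^sub>n]\<close> stands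
  for \<open>v\<^sub>1 \<otimes> \<dots> \<otimes> v\<^sub>n\<close>: the first two families of relations are multilinearity, the
  last one is the degree \<open>n\<close> part of that ideal.\<close>

definition words :: "('r, 'v, 'c) module_scheme \<Rightarrow> nat \<Rightarrow> 'v list set"
  where "words V n = {vs. set vs \<subseteq> carrier V \<and> length vs = n}"

definition sym_relations ::
    "('r, 'd) ring_scheme \<Rightarrow> ('r, 'v, 'c) module_scheme \<Rightarrow> nat \<Rightarrow> ('v list \<Rightarrow> 'r) set"
  where "sym_relations R V n =
    (let F = free_module R (words V n); g = free_gen R in
      {g (xs @ [v \<oplus>\<^bsub>V\<^esub> w] @ ys) \<ominus>\<^bsub>F\<^esub> (g (xs @ [v] @ ys) \<oplus>\<^bsub>F\<^esub> g (xs @ [w] @ ys)) | xs ys v w.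
         set xs \<union> set ys \<union> {v, w} \<subseteq> carrier V \<and> length xs + 1 + length ys = n} \<union>
      {g (xs @ [a \<odot>\<^bsub>V\<^esub> v] @ ys) \<ominus>\<^bsub>F\<^esub> (a \<odot>\<^bsub>F\<^esub> g (xs @ [v] @ ys)) | a xs ys v.
         a \<in> carrier R \<and> set xs \<union> set ys \<union> {v} \<subseteq> carrier V \<and> length xs + 1 + length ys = n} \<union>
      {g (xs @ [v, w] @ ys) \<ominus>\<^bsub>F\<^esub> g (xs @ [w, v] @ ys) | xs ys v w.
         set xs \<union> set ys \<union> {v, w} \<subseteq> carrier V \<and> length xs + 2 + length ys = n})"

definition sym_null ::
    "('r, 'd) ring_scheme \<Rightarrow> ('r, 'v, 'c) module_scheme \<Rightarrow> nat \<Rightarrow> ('v list \<Rightarrow> 'r) set"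
  where "sym_null R V n = submodule_gen R (free_module R (words V n)) (sym_relations R V n)"

definition sym_power ::
    "('r, 'd) ring_scheme \<Rightarrow> ('r, 'v, 'c) module_scheme \<Rightarrow> nat \<Rightarrow> ('r, ('v list \<Rightarrow> 'r) set) module"
  where "sym_power R V n = quotient_module (free_module R (words V n)) (sym_null R V n)"

definition sym_monomial ::
    "('r, 'd) ring_scheme \<Rightarrow> ('r, 'v, 'c) module_scheme \<Rightarrow> 'v list \<Rightarrow> ('v list \<Rightarrow> 'r) set"
  where "sym_monomial R V vs =
    sym_null R V (length vs) +>\<^bsub>free_module R (words V (length vs))\<^esub> free_gen R vs"

text \<open>Multiplication by \<open>v \<in> V\<close>, from degree \<open>n\<close> to degree \<open>n + 1\<close>.\<close>
definition sym_smult ::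
    "('r, 'd) ring_scheme \<Rightarrow> ('r, 'v, 'c) module_scheme \<Rightarrow> nat \<Rightarrow> 'v \<Rightarrow>
     ('v list \<Rightarrow> 'r) set \<Rightarrow> ('v list \<Rightarrow> 'r) set"
  where "sym_smult R V n v =
    induced_map R (sym_power R V (Suc n)) (\<lambda>vs. sym_monomial R V (v # vs))"


section \<open>Graded algebras and modules, relation type\<close>

text \<open>Graded objects are given by the family of their homogeneous components, \<open>R\<close>-modules, together
  with the products of homogeneous elements: \<open>gmult U i j\<close> is \<open>U\<^sub>i \<times> U\<^sub>j \<rightarrow> U\<^sub>i\<^sub>+\<^sub>j\<close> and
  \<open>gact F i j\<close> is \<open>U\<^sub>i \<times> F\<^sub>j \<rightarrow> F\<^sub>i\<^sub>+\<^sub>j\<close>. The records carry data only: the definitions up to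
  \<open>relation_type\<close> are meant for a standard \<open>R\<close>-algebra \<open>U\<close> and a standard \<open>U\<close>-module \<open>F\<close>, as are
  the Rees algebra and the Rees modules below.\<close>

record ('r, 'u) graded_algebra =
  gcomp :: "nat \<Rightarrow> ('r, 'u) module"
  gmult :: "nat \<Rightarrow> nat \<Rightarrow> 'u \<Rightarrow> 'u \<Rightarrow> 'u"
  gone :: 'u

record ('r, 'u, 'f) graded_module =
  mcomp :: "nat \<Rightarrow> ('r, 'f) module"
  gact :: "nat \<Rightarrow> nat \<Rightarrow> 'u \<Rightarrow> 'f \<Rightarrow> 'f"

primrec word_prod :: "('r, 'u) graded_algebra \<Rightarrow> 'u list \<Rightarrow> 'u"
  where
    "word_prod U [] = gone U"
  | "word_prod U (v # vs) = gmult U 1 (length vs) v (word_prod U vs)"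

text \<open>The degree \<open>n\<close> part of the canonical morphism \<open>\<^bold>S(U\<^sub>1) \<rightarrow> U\<close>.\<close>
definition sym_eval ::
    "('r, 'd) ring_scheme \<Rightarrow> ('r, 'u) graded_algebra \<Rightarrow> nat \<Rightarrow> ('u list \<Rightarrow> 'r) set \<Rightarrow> 'u"
  where "sym_eval R U n = induced_map R (gcomp U n) (word_prod U)"

definition sym_tensor ::
    "('r, 'd) ring_scheme \<Rightarrow> ('r, 'u) graded_algebra \<Rightarrow> ('r, 'u, 'f) graded_module \<Rightarrow> nat \<Rightarrow>
     ('r, (('u list \<Rightarrow> 'r) set \<times> 'f \<Rightarrow> 'r) set) module"
  where "sym_tensor R U F n = tensor_module R (sym_power R (gcomp U 1) n) (mcomp F 0)"

text \<open>The degree \<open>n\<close> part of \<open>\<^bold>S(U\<^sub>1) \<otimes> F\<^sub>0 \<rightarrow> U \<otimes> F\<^sub>0 \<rightarrow> F\<close>: the pure tensor of \<open>s\<close> and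
  \<open>f\<close> goes to the product of the image of \<open>s\<close> in \<open>U\<^sub>n\<close> with \<open>f\<close>.\<close>
definition canonical_map ::
    "('r, 'd) ring_scheme \<Rightarrow> ('r, 'u) graded_algebra \<Rightarrow> ('r, 'u, 'f) graded_module \<Rightarrow> nat \<Rightarrow>
     (('u list \<Rightarrow> 'r) set \<times> 'f \<Rightarrow> 'r) set \<Rightarrow> 'f"
  where "canonical_map R U F n =
    induced_map R (mcomp F n) (\<lambda>(s, f). gact F n 0 (sym_eval R U n s) f)"

definition canonical_kernel ::
    "('r, 'd) ring_scheme \<Rightarrow> ('r, 'u) graded_algebra \<Rightarrow> ('r, 'u, 'f) graded_module \<Rightarrow> nat \<Rightarrow>
     (('u list \<Rightarrow> 'r) set \<times> 'f \<Rightarrow> 'r) set set"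
  where "canonical_kernel R U F n =
    a_kernel (sym_tensor R U F n) (mcomp F n) (canonical_map R U F n)"

text \<open>The action of \<open>v \<in> U\<^sub>1\<close> on \<open>\<^bold>S(U\<^sub>1) \<otimes> F\<^sub>0\<close>, from degree \<open>n\<close> to degree \<open>n + 1\<close>.\<close>
definition sym_tensor_act ::
    "('r, 'd) ring_scheme \<Rightarrow> ('r, 'u) graded_algebra \<Rightarrow> ('r, 'u, 'f) graded_module \<Rightarrow> nat \<Rightarrow> 'u \<Rightarrow>
     (('u list \<Rightarrow> 'r) set \<times> 'f \<Rightarrow> 'r) set \<Rightarrow> (('u list \<Rightarrow> 'r) set \<times> 'f \<Rightarrow> 'r) set"
  where "sym_tensor_act R U F n v =
    induced_map R (sym_tensor R U F (Suc n))
      (\<lambda>(s, f). pure_tensor R (sym_power R (gcomp U 1) (Suc n)) (mcomp F 0)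
                  (sym_smult R (gcomp U 1) n v s) f)"

text \<open>The module \<open>E(F)\<^sub>n\<close> for \<open>n \<ge> 2\<close>; only these values are used. Similarly
  \<open>artin_rees_module\<close> below is used for \<open>n \<ge> 1\<close> only.\<close>
definition effective_relations ::
    "('r, 'd) ring_scheme \<Rightarrow> ('r, 'u) graded_algebra \<Rightarrow> ('r, 'u, 'f) graded_module \<Rightarrow> nat \<Rightarrow>
     ('r, (('u list \<Rightarrow> 'r) set \<times> 'f \<Rightarrow> 'r) set set) module"
  where "effective_relations R U F n =
    subquotient (sym_tensor R U F n) (canonical_kernel R U F n)
      (submodule_gen R (sym_tensor R U F n)
        {sym_tensor_act R U F (n - 1) v z | v z.
           v \<in> carrier (gcomp U 1) \<and> z \<in> canonical_kernel R U F (n - 1)})"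

text \<open>In \<^typ>\<open>enat\<close> the infimum of a nonempty set is its minimum and that of the empty set is
  \<open>\<infinity>\<close>.\<close>
definition relation_type ::
    "('r, 'd) ring_scheme \<Rightarrow> ('r, 'u) graded_algebra \<Rightarrow> ('r, 'u, 'f) graded_module \<Rightarrow> enat"
  where "relation_type R U F =
    Inf {enat r | r. r \<ge> 1 \<and> (\<forall>n\<ge>r + 1. zero_module (effective_relations R U F n))}"


section \<open>Rees modules modulo \<open>J\<close>\<close>

text \<open>The module \<open>P / JP\<close>, for a submodule \<open>P\<close> of \<open>L\<close>, over \<open>A / J\<close>.\<close>
definition mod_ideal ::
    "('a, 'd) ring_scheme \<Rightarrow> ('a, 'm, 'c) module_scheme \<Rightarrow> 'a set \<Rightarrow> 'm set \<Rightarrow> ('a set, 'm set) module"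
  where "mod_ideal A L J P =
    (let Q = ideal_smult A L J P; M = subquotient L P Q in
      \<lparr>carrier = carrier M, mult = undefined, one = undefined, zero = zero M, add = add M,
       smult = (\<lambda>C X. \<Union>a\<in>C. a \<odot>\<^bsub>M\<^esub> X)\<rparr>)"

definition rees_algebra ::
    "('a, 'd) ring_scheme \<Rightarrow> 'a set \<Rightarrow> 'a set \<Rightarrow> ('a set, 'a set) graded_algebra"
  where "rees_algebra A J I =
    \<lparr>gcomp = (\<lambda>n. mod_ideal A (self_module A) J (ideal_power A I n)),
     gmult = (\<lambda>i j X Y. \<Union>x\<in>X. \<Union>y\<in>Y. (J \<cdot>\<^bsub>A\<^esub> ideal_power A I (i + j)) +>\<^bsub>A\<^esub> (x \<otimes>\<^bsub>A\<^esub> y)),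
     gone = J +>\<^bsub>A\<^esub> \<one>\<^bsub>A\<^esub>\<rparr>"

definition rees_module ::
    "('a, 'd) ring_scheme \<Rightarrow> 'a set \<Rightarrow> 'a set \<Rightarrow> ('a, 'm, 'c) module_scheme \<Rightarrow>
     ('a set, 'a set, 'm set) graded_module"
  where "rees_module A J I L =
    (let P = (\<lambda>n. ideal_smult A L (ideal_power A I n) (carrier L)) in
      \<lparr>mcomp = (\<lambda>n. mod_ideal A L J (P n)),
       gact = (\<lambda>i j X Y. \<Union>x\<in>X. \<Union>y\<in>Y. ideal_smult A L J (P (i + j)) +>\<^bsub>L\<^esub> (x \<odot>\<^bsub>L\<^esub> y))\<rparr>)"

definition rt ::
    "('a, 'd) ring_scheme \<Rightarrow> 'a set \<Rightarrow> 'a set \<Rightarrow> ('a, 'm, 'c) module_scheme \<Rightarrow> enat"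
  where "rt A J I L = relation_type (A Quot J) (rees_algebra A J I) (rees_module A J I L)"


section \<open>Artin-Rees number modulo \<open>J\<close>\<close>

definition artin_rees_module ::
    "('a, 'd) ring_scheme \<Rightarrow> 'a set \<Rightarrow> 'm set \<Rightarrow> ('a, 'm, 'c) module_scheme \<Rightarrow> 'a set \<Rightarrow> nat \<Rightarrow>
     ('a, 'm set) module"
  where "artin_rees_module A J N M I n =
    (let P = (\<lambda>k. ideal_smult A M (ideal_power A I k) (carrier M)) in
      subquotient M (P n \<inter> N)
        (ideal_smult A M I (P (n - 1) \<inter> N) <+>\<^bsub>M\<^esub> (ideal_smult A M J (P n) \<inter> N)))"

definition artin_rees_number ::
    "('a, 'd) ring_scheme \<Rightarrow> 'a set \<Rightarrow> 'm set \<Rightarrow> ('a, 'm, 'c) module_scheme \<Rightarrow> 'a set \<Rightarrow> enat"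
  where "artin_rees_number A J N M I =
    Inf {enat s | s. \<forall>n\<ge>s + 1. zero_module (artin_rees_module A J N M I n)}"

end

theory Submission
  imports Defs
begin

text \<open>Let \<open>F \<rightarrow> G\<close> be a surjective morphism of standard \<open>U\<close>-modules with kernel \<open>H\<close>. Lifting elements
  of \<open>ker \<gamma>\<^sup>G\<^sub>n\<close> to \<open>\<^bold>S\<^sub>n(U\<^sub>1) \<otimes> F\<^sub>0\<close> and applying \<open>\<gamma>\<^sup>F\<^sub>n\<close> gives an exact sequence
  \<open>E(F)\<^sub>n \<rightarrow> E(G)\<^sub>n \<rightarrow> H\<^sub>n / U\<^sub>1H\<^sub>n\<^sub>-\<^sub>1 \<rightarrow> 0\<close>. The lift is determined up to the image of
  \<open>\<^bold>S\<^sub>n(U\<^sub>1) \<otimes> H\<^sub>0\<close>, which \<open>\<gamma>\<^sup>F\<^sub>n\<close> maps into \<open>U\<^sub>nH\<^sub>0 \<subseteq> U\<^sub>1H\<^sub>n\<^sub>-\<^sub>1\<close>. For the Rees modules of \<open>M\<close> and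
  \<open>M/N\<close> one has \<open>H\<^sub>n = (I\<^sup>nM \<inter> N) / (JI\<^sup>nM \<inter> N)\<close>, so the right-hand term is the module \<open>E\<^sub>J(N,M;I)\<^sub>n\<close>
  and both inequalities are read off the exact sequence.\<close>

text \<open>The obstacle is the kernel of S_n \<otimes> F_0 \<rightarrow> S_n \<otimes> G_0, which
  cannot be read off the generators and relations of the two tensor products. It is never computed:
  the universal property yields a map on S_n \<otimes> G_0 that recovers \<gamma> modulo U_1
  H_{n-1}, and this alone shows where \<gamma> sends the kernel. Nor is the exact sequence formed. A
  subquotient P/Q vanishes exactly when P lies in Q, so both inequalities reduce to inclusions of
  submodules in one degree, proved by chasing elements. That degree is \<open>Suc n\<close>: the
  chase compares two neighbouring degrees, and a word must have a first letter to be moved from U_n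
  H_0 into U_1 H_{n-1}. The other source of work is the coset encoding. Products of classes are
  unions over representatives and induced maps are \<open>the_elem\<close> of an image, so
  independence of representatives has to precede each algebraic law. The recurring device is
  transport along a surjection from an object whose laws are already known.\<close>

section \<open>Submodules, their sums and spans\<close>

lemma (in Module.module) minus_mem_submodule:
  assumes "submodule H R M" "x \<in> H" "y \<in> H"
  shows "x \<ominus>\<^bsub>M\<^esub> y \<in> H"
  using submoduleE[OF assms(1)] assms(2,3) by (simp add: a_minus_def)

lemma (in Module.module) zero_mem_submodule:
  assumes "submodule H R M"
  shows "\<zero>\<^bsub>M\<^esub> \<in> H"
  using assms subgroup.one_closed submodule.axioms(1) by fastforce

lemma (in Module.module) submodule_Int:
  assumes "submodule H R M" "submodule K R M"
  shows "submodule (H \<inter> K) R M"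
  by (rule submoduleI)
     (use submoduleE[OF assms(1)] submoduleE[OF assms(2)]
        zero_mem_submodule[OF assms(1)] zero_mem_submodule[OF assms(2)] in auto)

lemma (in Module.module) submodule_set_add:
  assumes "submodule H R M" "submodule K R M"
  shows "submodule (H <+>\<^bsub>M\<^esub> K) R M"
proof (rule submoduleI)
  note H = submoduleE[OF assms(1)] and K = submoduleE[OF assms(2)]
  have hc: "\<And>x. x \<in> H \<Longrightarrow> x \<in> carrier M" and kc: "\<And>x. x \<in> K \<Longrightarrow> x \<in> carrier M"
    using H(1) K(1) by auto
  show "H <+>\<^bsub>M\<^esub> K \<subseteq> carrier M"
    by (rule M.set_add_closed) (use H(1) K(1) in auto)
  show "\<zero>\<^bsub>M\<^esub> \<in> H <+>\<^bsub>M\<^esub> K"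
    using zero_mem_submodule[OF assms(1)] zero_mem_submodule[OF assms(2)] M.l_zero[OF M.zero_closed]
    unfolding set_add_def' by force
  show "\<ominus>\<^bsub>M\<^esub> a \<in> H <+>\<^bsub>M\<^esub> K" if "a \<in> H <+>\<^bsub>M\<^esub> K" for a
  proof -
    from that obtain h k where "h \<in> H" "k \<in> K" "a = h \<oplus>\<^bsub>M\<^esub> k"
      unfolding set_add_def' by auto
    then have "\<ominus>\<^bsub>M\<^esub> a = \<ominus>\<^bsub>M\<^esub> h \<oplus>\<^bsub>M\<^esub> \<ominus>\<^bsub>M\<^esub> k" "\<ominus>\<^bsub>M\<^esub> h \<in> H" "\<ominus>\<^bsub>M\<^esub> k \<in> K"
      using M.minus_add[OF hc kc] H(3) K(3) by simp_all
    then show ?thesis unfolding set_add_def' by blast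
  qed
  show "a \<oplus>\<^bsub>M\<^esub> b \<in> H <+>\<^bsub>M\<^esub> K" if "a \<in> H <+>\<^bsub>M\<^esub> K" "b \<in> H <+>\<^bsub>M\<^esub> K" for a b
  proof -
    from that obtain h k h' k' where e: "h \<in> H" "k \<in> K" "a = h \<oplus>\<^bsub>M\<^esub> k"
      "h' \<in> H" "k' \<in> K" "b = h' \<oplus>\<^bsub>M\<^esub> k'"
      unfolding set_add_def' by auto
    then have "a \<oplus>\<^bsub>M\<^esub> b = (h \<oplus>\<^bsub>M\<^esub> h') \<oplus>\<^bsub>M\<^esub> (k \<oplus>\<^bsub>M\<^esub> k')"
      by (simp add: hc kc M.a_ac)
    then show ?thesis
      unfolding set_add_def' using H(5)[OF e(1,4)] K(5)[OF e(2,5)] by blast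
  qed
  show "a \<odot>\<^bsub>M\<^esub> x \<in> H <+>\<^bsub>M\<^esub> K" if "a \<in> carrier R" "x \<in> H <+>\<^bsub>M\<^esub> K" for a x
  proof -
    from that(2) obtain h k where "h \<in> H" "k \<in> K" "x = h \<oplus>\<^bsub>M\<^esub> k"
      unfolding set_add_def' by auto
    then have "a \<odot>\<^bsub>M\<^esub> x = a \<odot>\<^bsub>M\<^esub> h \<oplus>\<^bsub>M\<^esub> a \<odot>\<^bsub>M\<^esub> k" "a \<odot>\<^bsub>M\<^esub> h \<in> H" "a \<odot>\<^bsub>M\<^esub> k \<in> K"
      using that(1) smult_r_distr[OF that(1) hc kc] H(4) K(4) by simp_all
    then show ?thesis unfolding set_add_def' by blast
  qed
qed

text \<open>The carrier is a submodule containing S, so the intersection runs over a nonempty family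
  and stays inside the carrier; over an empty family it would be the whole type.\<close>

lemma (in Module.module) submodule_gen_submodule:
  assumes "S \<subseteq> carrier M"
  shows "submodule (submodule_gen R M S) R M"
proof (rule submoduleI)
  let ?\<H> = "{H. submodule H R M \<and> S \<subseteq> H}"
  show "submodule_gen R M S \<subseteq> carrier M"
    unfolding submodule_gen_def using carrier_is_submodule assms by blast
  show "\<zero>\<^bsub>M\<^esub> \<in> submodule_gen R M S"
    unfolding submodule_gen_def using zero_mem_submodule by blast
  show "\<ominus>\<^bsub>M\<^esub> a \<in> submodule_gen R M S" if "a \<in> submodule_gen R M S" for a
    using that unfolding submodule_gen_def using submoduleE(3) by blast
  show "a \<oplus>\<^bsub>M\<^esub> b \<in> submodule_gen R M S"
    if "a \<in> submodule_gen R M S" "b \<in> submodule_gen R M S" for a b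
    using that unfolding submodule_gen_def using submoduleE(5) by blast
  show "a \<odot>\<^bsub>M\<^esub> x \<in> submodule_gen R M S"
    if "a \<in> carrier R" "x \<in> submodule_gen R M S" for a x
    using that unfolding submodule_gen_def using submoduleE(4) by blast
qed

lemma submodule_gen_superset: "S \<subseteq> submodule_gen R M S"
  unfolding submodule_gen_def by blast

lemma submodule_gen_least:
  "submodule H R M \<Longrightarrow> S \<subseteq> H \<Longrightarrow> submodule_gen R M S \<subseteq> H"
  unfolding submodule_gen_def by blast

section \<open>Linear maps\<close>

locale linear_map = dom: Module.module R M + cod: Module.module R N
  for R :: "('r, 'd) ring_scheme" and M :: "('r, 'm, 'c) module_scheme"
    and N :: "('r, 'n, 'e) module_scheme" and f +
  assumes map_closed: "x \<in> carrier M \<Longrightarrow> f x \<in> carrier N"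
    and map_add: "x \<in> carrier M \<Longrightarrow> y \<in> carrier M \<Longrightarrow> f (x \<oplus>\<^bsub>M\<^esub> y) = f x \<oplus>\<^bsub>N\<^esub> f y"
    and map_smult: "a \<in> carrier R \<Longrightarrow> x \<in> carrier M \<Longrightarrow> f (a \<odot>\<^bsub>M\<^esub> x) = a \<odot>\<^bsub>N\<^esub> f x"
begin

lemma map_zero: "f \<zero>\<^bsub>M\<^esub> = \<zero>\<^bsub>N\<^esub>"
proof -
  have "f \<zero>\<^bsub>M\<^esub> = f (\<zero>\<^bsub>R\<^esub> \<odot>\<^bsub>M\<^esub> \<zero>\<^bsub>M\<^esub>)" by simp
  also have "\<dots> = \<zero>\<^bsub>R\<^esub> \<odot>\<^bsub>N\<^esub> f \<zero>\<^bsub>M\<^esub>" by (rule map_smult) auto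
  also have "\<dots> = \<zero>\<^bsub>N\<^esub>" by (simp add: map_closed)
  finally show ?thesis .
qed

lemma map_uminus:
  assumes "x \<in> carrier M"
  shows "f (\<ominus>\<^bsub>M\<^esub> x) = \<ominus>\<^bsub>N\<^esub> f x"
proof -
  have "f (\<ominus>\<^bsub>M\<^esub> x) \<oplus>\<^bsub>N\<^esub> f x = f (\<ominus>\<^bsub>M\<^esub> x \<oplus>\<^bsub>M\<^esub> x)"
    using assms by (simp add: map_add)
  also have "\<dots> = \<zero>\<^bsub>N\<^esub>" using assms by (simp add: dom.M.l_neg map_zero)
  finally show ?thesis using assms cod.M.minus_equality map_closed by simp
qed

lemma map_minus:
  assumes "x \<in> carrier M" "y \<in> carrier M"
  shows "f (x \<ominus>\<^bsub>M\<^esub> y) = f x \<ominus>\<^bsub>N\<^esub> f y"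
  using assms by (simp add: a_minus_def map_add map_uminus)

lemma submodule_vimage:
  assumes "submodule H R N"
  shows "submodule {x \<in> carrier M. f x \<in> H} R M"
  by (rule dom.submoduleI)
     (use cod.submoduleE[OF assms] cod.zero_mem_submodule[OF assms]
       in \<open>auto simp: map_zero map_uminus map_add map_smult\<close>)

lemma submodule_image:
  assumes "submodule H R M"
  shows "submodule (f ` H) R N"
proof (rule cod.submoduleI)
  note H = dom.submoduleE[OF assms]
  have hc: "\<And>x. x \<in> H \<Longrightarrow> x \<in> carrier M" using H(1) by auto
  show "f ` H \<subseteq> carrier N" using H(1) map_closed by auto
  show "\<zero>\<^bsub>N\<^esub> \<in> f ` H"
    using dom.zero_mem_submodule[OF assms] map_zero by (metis imageI)
  show "\<ominus>\<^bsub>N\<^esub> a \<in> f ` H" if "a \<in> f ` H" for a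
  proof -
    from that obtain x where "x \<in> H" "a = f x" by auto
    then show ?thesis using H(3) map_uminus[OF hc, of x] by (metis imageI)
  qed
  show "a \<oplus>\<^bsub>N\<^esub> b \<in> f ` H" if "a \<in> f ` H" "b \<in> f ` H" for a b
  proof -
    from that obtain x y where "x \<in> H" "a = f x" "y \<in> H" "b = f y" by auto
    then show ?thesis using H(5) map_add[OF hc hc, of x y] by (metis imageI)
  qed
  show "a \<odot>\<^bsub>N\<^esub> x \<in> f ` H" if "a \<in> carrier R" "x \<in> f ` H" for a x
  proof -
    from that obtain y where "y \<in> H" "x = f y" by auto
    then show ?thesis using that(1) H(4) map_smult[OF _ hc, of a y] by (metis imageI)
  qed
qed

text \<open>The preimage of H is a submodule containing S. With H the zero submodule, a linear map
  that kills the relations of a presentation kills their whole span.\<close>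

lemma image_submodule_gen_subset:
  assumes "submodule H R N" "S \<subseteq> carrier M" "f ` S \<subseteq> H"
  shows "f ` submodule_gen R M S \<subseteq> H"
proof -
  have "submodule_gen R M S \<subseteq> {x \<in> carrier M. f x \<in> H}"
    by (rule submodule_gen_least[OF submodule_vimage[OF assms(1)]]) (use assms in auto)
  then show ?thesis by auto
qed

text \<open>Preimages of submodules give one inclusion, images the other. Spans can thus be pushed
  forward along \<gamma>, along \<pi> and along reduction modulo J by looking at generators
  only.\<close>

lemma image_submodule_gen:
  assumes "S \<subseteq> carrier M"
  shows "f ` submodule_gen R M S = submodule_gen R N (f ` S)"
proof
  have fS: "f ` S \<subseteq> carrier N" using assms map_closed by auto
  show "f ` submodule_gen R M S \<subseteq> submodule_gen R N (f ` S)"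
    by (rule image_submodule_gen_subset[OF cod.submodule_gen_submodule[OF fS] assms
          submodule_gen_superset])
  show "submodule_gen R N (f ` S) \<subseteq> f ` submodule_gen R M S"
    by (rule submodule_gen_least[OF submodule_image[OF dom.submodule_gen_submodule[OF assms]]])
       (rule image_mono[OF submodule_gen_superset])
qed

lemma linear_map_comp:
  assumes "linear_map R N P g"
  shows "linear_map R M P (\<lambda>x. g (f x))"
proof -
  interpret g: linear_map R N P g by fact
  show ?thesis
    by unfold_locales (auto simp: map_closed map_add map_smult g.map_closed g.map_add g.map_smult)
qed

text \<open>Serves to compare linear maps on generators: an equalizer that contains the generators
  is everything.\<close>

lemma submodule_equalizer:
  assumes "linear_map R M N g"
  shows "submodule {x \<in> carrier M. f x = g x} R M"
proof -
  interpret g: linear_map R M N g by fact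
  show ?thesis
    by (rule dom.submoduleI)
       (auto simp: map_zero map_uminus map_add map_smult g.map_zero g.map_uminus g.map_add
         g.map_smult)
qed

end

lemma (in Module.module) linear_map_inclusion:
  assumes "submodule H R M"
  shows "linear_map R (M\<lparr>carrier := H\<rparr>) M (\<lambda>x. x)"
proof -
  interpret H: Module.module R "M\<lparr>carrier := H\<rparr>"
    by (rule submodule.submodule_is_module[OF assms module_axioms])
  show ?thesis
    by unfold_locales (use submoduleE(1)[OF assms] in auto)
qed

text \<open>Each law of N is the image of the same law of M. The scalars may change along h: with h
  the identity this yields the module P/Q, with h the projection of R onto R/J it yields P/JP over
  R/J.\<close>

lemma (in Module.module) module_image:
  assumes "cring S" and h: "h \<in> ring_hom R S" "h ` carrier R = carrier S"
    and f: "f ` carrier M = carrier N" "f \<zero>\<^bsub>M\<^esub> = \<zero>\<^bsub>N\<^esub>"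
    and add: "\<And>x y. x \<in> carrier M \<Longrightarrow> y \<in> carrier M \<Longrightarrow> f (x \<oplus>\<^bsub>M\<^esub> y) = f x \<oplus>\<^bsub>N\<^esub> f y"
    and smult: "\<And>a x. a \<in> carrier R \<Longrightarrow> x \<in> carrier M \<Longrightarrow> f (a \<odot>\<^bsub>M\<^esub> x) = h a \<odot>\<^bsub>N\<^esub> f x"
  shows "Module.module S N"
proof -
  have fc: "\<And>x. x \<in> carrier M \<Longrightarrow> f x \<in> carrier N" using f(1) by auto
  have hc: "\<And>x. x \<in> carrier R \<Longrightarrow> h x \<in> carrier S" using h(2) by auto
  \<comment> \<open>Elements of \<open>carrier N\<close> are replaced by images \<open>f x\<close>;
    the compatibility equations, read from right to left, then move each law back to M.\<close>
  have f_ball: "\<And>P. (\<And>x. x \<in> carrier M \<Longrightarrow> P (f x)) \<Longrightarrow> \<forall>y\<in>carrier N. P y"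
    unfolding f(1)[symmetric] by (rule ballI, erule imageE, hypsubst)
  have h_ball: "\<And>P. (\<And>x. x \<in> carrier R \<Longrightarrow> P (h x)) \<Longrightarrow> \<forall>y\<in>carrier S. P y"
    unfolding h(2)[symmetric] by (rule ballI, erule imageE, hypsubst)
  note hs = ring_hom_add[OF h(1)] ring_hom_mult[OF h(1)] ring_hom_one[OF h(1)]
  show ?thesis
  proof (rule Module.moduleI[OF assms(1)])
    show "abelian_group N"
    proof (rule abelian_groupI)
      have "\<forall>x\<in>carrier N. \<forall>y\<in>carrier N. x \<oplus>\<^bsub>N\<^esub> y \<in> carrier N"
        by (intro f_ball) (simp add: fc flip: add)
      then show "x \<oplus>\<^bsub>N\<^esub> y \<in> carrier N" if "x \<in> carrier N" "y \<in> carrier N" for x y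
        using that by blast
      show "\<zero>\<^bsub>N\<^esub> \<in> carrier N" using f(2) fc M.zero_closed by metis
      have "\<forall>x\<in>carrier N. \<forall>y\<in>carrier N. \<forall>z\<in>carrier N.
          x \<oplus>\<^bsub>N\<^esub> y \<oplus>\<^bsub>N\<^esub> z = x \<oplus>\<^bsub>N\<^esub> (y \<oplus>\<^bsub>N\<^esub> z)"
        by (intro f_ball) (simp add: M.a_assoc flip: add)
      then show "x \<oplus>\<^bsub>N\<^esub> y \<oplus>\<^bsub>N\<^esub> z = x \<oplus>\<^bsub>N\<^esub> (y \<oplus>\<^bsub>N\<^esub> z)"
        if "x \<in> carrier N" "y \<in> carrier N" "z \<in> carrier N" for x y z
        using that by blast
      have "\<forall>x\<in>carrier N. \<forall>y\<in>carrier N. x \<oplus>\<^bsub>N\<^esub> y = y \<oplus>\<^bsub>N\<^esub> x"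
        by (intro f_ball) (simp add: M.a_comm flip: add)
      then show "x \<oplus>\<^bsub>N\<^esub> y = y \<oplus>\<^bsub>N\<^esub> x" if "x \<in> carrier N" "y \<in> carrier N" for x y
        using that by blast
      have "\<forall>x\<in>carrier N. \<zero>\<^bsub>N\<^esub> \<oplus>\<^bsub>N\<^esub> x = x"
        by (intro f_ball) (simp flip: f(2) add)
      then show "\<zero>\<^bsub>N\<^esub> \<oplus>\<^bsub>N\<^esub> x = x" if "x \<in> carrier N" for x using that by blast
      have "\<forall>x\<in>carrier N. \<exists>y\<in>carrier N. y \<oplus>\<^bsub>N\<^esub> x = \<zero>\<^bsub>N\<^esub>"
        by (intro f_ball) (metis M.l_neg M.a_inv_closed add f(2) fc)
      then show "\<exists>y\<in>carrier N. y \<oplus>\<^bsub>N\<^esub> x = \<zero>\<^bsub>N\<^esub>" if "x \<in> carrier N" for x using that by blast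
    qed
    have "\<forall>a\<in>carrier S. \<forall>x\<in>carrier N. a \<odot>\<^bsub>N\<^esub> x \<in> carrier N"
      by (intro f_ball h_ball) (simp add: fc flip: smult)
    then show "a \<odot>\<^bsub>N\<^esub> x \<in> carrier N" if "a \<in> carrier S" "x \<in> carrier N" for a x
      using that by blast
    have "\<forall>a\<in>carrier S. \<forall>b\<in>carrier S. \<forall>x\<in>carrier N.
        (a \<oplus>\<^bsub>S\<^esub> b) \<odot>\<^bsub>N\<^esub> x = a \<odot>\<^bsub>N\<^esub> x \<oplus>\<^bsub>N\<^esub> b \<odot>\<^bsub>N\<^esub> x"
      by (intro f_ball h_ball) (simp add: smult_l_distr flip: add smult hs)
    then show "(a \<oplus>\<^bsub>S\<^esub> b) \<odot>\<^bsub>N\<^esub> x = a \<odot>\<^bsub>N\<^esub> x \<oplus>\<^bsub>N\<^esub> b \<odot>\<^bsub>N\<^esub> x"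
      if "a \<in> carrier S" "b \<in> carrier S" "x \<in> carrier N" for a b x
      using that by blast
    have "\<forall>a\<in>carrier S. \<forall>x\<in>carrier N. \<forall>y\<in>carrier N.
        a \<odot>\<^bsub>N\<^esub> (x \<oplus>\<^bsub>N\<^esub> y) = a \<odot>\<^bsub>N\<^esub> x \<oplus>\<^bsub>N\<^esub> a \<odot>\<^bsub>N\<^esub> y"
      by (intro f_ball h_ball) (simp add: smult_r_distr flip: add smult)
    then show "a \<odot>\<^bsub>N\<^esub> (x \<oplus>\<^bsub>N\<^esub> y) = a \<odot>\<^bsub>N\<^esub> x \<oplus>\<^bsub>N\<^esub> a \<odot>\<^bsub>N\<^esub> y"
      if "a \<in> carrier S" "x \<in> carrier N" "y \<in> carrier N" for a x y
      using that by blast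
    have "\<forall>a\<in>carrier S. \<forall>b\<in>carrier S. \<forall>x\<in>carrier N.
        (a \<otimes>\<^bsub>S\<^esub> b) \<odot>\<^bsub>N\<^esub> x = a \<odot>\<^bsub>N\<^esub> (b \<odot>\<^bsub>N\<^esub> x)"
      by (intro f_ball h_ball) (simp add: smult_assoc1 flip: smult hs)
    then show "(a \<otimes>\<^bsub>S\<^esub> b) \<odot>\<^bsub>N\<^esub> x = a \<odot>\<^bsub>N\<^esub> (b \<odot>\<^bsub>N\<^esub> x)"
      if "a \<in> carrier S" "b \<in> carrier S" "x \<in> carrier N" for a b x
      using that by blast
    have "\<forall>x\<in>carrier N. \<one>\<^bsub>S\<^esub> \<odot>\<^bsub>N\<^esub> x = x"
      by (intro f_ball) (simp flip: smult hs)
    then show "\<one>\<^bsub>S\<^esub> \<odot>\<^bsub>N\<^esub> x = x" if "x \<in> carrier N" for x using that by blast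
  qed
qed


section \<open>Quotients\<close>

context Module.module
begin

lemma submodule_abelian_subgroup:
  assumes "submodule Q R M"
  shows "abelian_subgroup Q M"
  by (rule abelian_subgroupI3)
     (use submodule.axioms(1)[OF assms] M.abelian_group_axioms in \<open>auto simp: additive_subgroup_def\<close>)

lemma coset_eq_iff:
  assumes "submodule Q R M" "x \<in> carrier M" "y \<in> carrier M"
  shows "Q +>\<^bsub>M\<^esub> x = Q +>\<^bsub>M\<^esub> y \<longleftrightarrow> x \<ominus>\<^bsub>M\<^esub> y \<in> Q"
proof -
  interpret Q: abelian_subgroup Q M by (rule submodule_abelian_subgroup[OF assms(1)])
  show ?thesis
    using assms Q.a_rcos_module[of y x] Q.a_repr_independence'[of x y] Q.a_rcos_self[of x]
    by (metis a_minus_def)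
qed

lemma coset_eq_self_iff:
  assumes "submodule Q R M" "x \<in> carrier M"
  shows "Q +>\<^bsub>M\<^esub> x = Q \<longleftrightarrow> x \<in> Q"
proof -
  interpret Q: abelian_subgroup Q M by (rule submodule_abelian_subgroup[OF assms(1)])
  show ?thesis
    using assms Q.a_rcos_const[of x] Q.a_rcos_self[of x] by auto
qed

lemma coset_add:
  assumes "submodule Q R M" "x \<in> carrier M" "y \<in> carrier M"
  shows "Q +>\<^bsub>M\<^esub> (x \<oplus>\<^bsub>M\<^esub> y) = (Q +>\<^bsub>M\<^esub> x) <+>\<^bsub>M\<^esub> (Q +>\<^bsub>M\<^esub> y)"
  using abelian_subgroup.a_rcos_sum[OF submodule_abelian_subgroup] assms by metis

lemma mem_coset_self:
  assumes "submodule Q R M" "x \<in> carrier M"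
  shows "x \<in> Q +>\<^bsub>M\<^esub> x"
  using abelian_subgroup.a_rcos_self[OF submodule_abelian_subgroup] assms by metis

lemma mem_cosetD:
  assumes "submodule Q R M" "x \<in> carrier M" "y \<in> Q +>\<^bsub>M\<^esub> x"
  shows "y \<in> carrier M" "y \<ominus>\<^bsub>M\<^esub> x \<in> Q"
proof -
  interpret Q: abelian_subgroup Q M by (rule submodule_abelian_subgroup[OF assms(1)])
  show "y \<in> carrier M" using Q.a_elemrcos_carrier assms by auto
  then show "y \<ominus>\<^bsub>M\<^esub> x \<in> Q"
    using Q.a_rcos_module[of x y] assms by (auto simp: a_minus_def)
qed

text \<open>Scalar and graded products of classes are defined as unions over representatives. When
  the value does not depend on the representative, the union is that of a constant family over a
  nonempty coset.\<close>

lemma UN_coset_eq: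
  assumes "submodule Q R M" "x \<in> carrier M"
    and "\<And>y. y \<in> carrier M \<Longrightarrow> y \<ominus>\<^bsub>M\<^esub> x \<in> Q \<Longrightarrow> F y = F x"
  shows "(\<Union>y\<in>Q +>\<^bsub>M\<^esub> x. F y) = F x"
proof -
  have "(\<Union>y\<in>Q +>\<^bsub>M\<^esub> x. F y) = (\<Union>y\<in>Q +>\<^bsub>M\<^esub> x. F x)"
    using mem_cosetD[OF assms(1,2)] assms(3) by (intro SUP_cong) auto
  then show ?thesis using mem_coset_self[OF assms(1,2)] by auto
qed

lemma smult_minus_distr:
  assumes "a \<in> carrier R" "x \<in> carrier M" "y \<in> carrier M"
  shows "a \<odot>\<^bsub>M\<^esub> x \<ominus>\<^bsub>M\<^esub> a \<odot>\<^bsub>M\<^esub> y = a \<odot>\<^bsub>M\<^esub> (x \<ominus>\<^bsub>M\<^esub> y)"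
  using assms by (simp add: a_minus_def smult_r_distr smult_r_minus)

lemma subquotient_smult_coset:
  assumes "submodule Q R M" "a \<in> carrier R" "x \<in> carrier M"
  shows "a \<odot>\<^bsub>subquotient M P Q\<^esub> (Q +>\<^bsub>M\<^esub> x) = Q +>\<^bsub>M\<^esub> (a \<odot>\<^bsub>M\<^esub> x)"
  unfolding subquotient_def
  by (simp, rule UN_coset_eq)
     (use assms submoduleE(4)[OF assms(1)] in \<open>auto simp: coset_eq_iff smult_minus_distr\<close>)

text \<open>The target of a \<open>linear_map\<close> is a module by definition, so the module
  structure of P/Q comes with the projection. The submodule P appears as M with its carrier cut down
  to P.\<close>

lemma subquotient_linear_map:
  assumes P: "submodule P R M" and Q: "submodule Q R M"
  shows "linear_map R (M\<lparr>carrier := P\<rparr>) (subquotient M P Q) (\<lambda>x. Q +>\<^bsub>M\<^esub> x)"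
proof -
  interpret P: Module.module R "M\<lparr>carrier := P\<rparr>"
    by (rule submodule.submodule_is_module[OF P module_axioms])
  have Pc: "\<And>x. x \<in> P \<Longrightarrow> x \<in> carrier M" using submoduleE(1)[OF P] by auto
  have add: "Q +>\<^bsub>M\<^esub> (x \<oplus>\<^bsub>M\<^esub> y) = (Q +>\<^bsub>M\<^esub> x) \<oplus>\<^bsub>subquotient M P Q\<^esub> (Q +>\<^bsub>M\<^esub> y)"
    if "x \<in> P" "y \<in> P" for x y
    using coset_add[OF Q Pc Pc] that by (simp add: subquotient_def)
  have smult: "Q +>\<^bsub>M\<^esub> (a \<odot>\<^bsub>M\<^esub> x) = a \<odot>\<^bsub>subquotient M P Q\<^esub> (Q +>\<^bsub>M\<^esub> x)"
    if "a \<in> carrier R" "x \<in> P" for a x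
    using subquotient_smult_coset[OF Q _ Pc] that by simp
  have zero: "Q +>\<^bsub>M\<^esub> \<zero>\<^bsub>M\<^esub> = Q"
    using coset_eq_self_iff[OF Q M.zero_closed] zero_mem_submodule[OF Q] by simp
  interpret Module.module R "subquotient M P Q"
    by (rule P.module_image[where h = "\<lambda>x. x" and f = "\<lambda>x. Q +>\<^bsub>M\<^esub> x"])
       (use R.cring_axioms add smult zero in \<open>auto simp: ring_hom_def subquotient_def\<close>)
  show ?thesis
    by unfold_locales (use add smult in \<open>auto simp: subquotient_def\<close>)
qed

lemma quotient_module_linear_map:
  assumes "submodule Q R M"
  shows "linear_map R M (quotient_module M Q) (\<lambda>x. Q +>\<^bsub>M\<^esub> x)"
  using subquotient_linear_map[OF carrier_is_submodule assms] by (simp add: quotient_module_def)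

lemma carrier_quotient_module: "carrier (quotient_module M Q) = (\<lambda>x. Q +>\<^bsub>M\<^esub> x) ` carrier M"
  by (simp add: quotient_module_def subquotient_def)

lemma zero_quotient_module: "\<zero>\<^bsub>quotient_module M Q\<^esub> = Q"
  by (simp add: quotient_module_def subquotient_def)

text \<open>As P is nonempty, P/Q is zero exactly when every coset of an element of P is Q itself.
  Both kinds of modules E in the theorem enter the argument only through this inclusion.\<close>

lemma zero_module_subquotient_iff:
  assumes "submodule P R M" "submodule Q R M"
  shows "zero_module (subquotient M P Q) \<longleftrightarrow> P \<subseteq> Q"
proof -
  have "P \<noteq> {}" and c: "\<And>x. x \<in> P \<Longrightarrow> x \<in> carrier M" using submoduleE(1,2)[OF assms(1)] by auto
  then have "zero_module (subquotient M P Q) \<longleftrightarrow> (\<forall>x\<in>P. Q +>\<^bsub>M\<^esub> x = Q)"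
    unfolding zero_module_def subquotient_def by auto
  also have "\<dots> \<longleftrightarrow> P \<subseteq> Q" using coset_eq_self_iff[OF assms(2) c] by auto
  finally show ?thesis .
qed

end

text \<open>The universal property of a surjection c, with well-definedness contained in the
  hypothesis on g. It leaves free how g is produced: by \<open>the_elem\<close> on cosets, or by an
  arbitrary choice of preimages.\<close>

lemma linear_map_factor:
  assumes "linear_map R M L c" "linear_map R M P f" "c ` carrier M = carrier L"
    and g: "\<And>x. x \<in> carrier M \<Longrightarrow> g (c x) = f x"
  shows "linear_map R L P g"
proof -
  interpret c: linear_map R M L c by fact
  interpret f: linear_map R M P f by fact
  have ball: "\<And>P. (\<And>x. x \<in> carrier M \<Longrightarrow> P (c x)) \<Longrightarrow> \<forall>y\<in>carrier L. P y"
    unfolding assms(3)[symmetric] by (rule ballI, erule imageE, hypsubst)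
  show ?thesis
  proof unfold_locales
    have "\<forall>x\<in>carrier L. g x \<in> carrier P"
      by (intro ball) (simp add: g f.map_closed)
    then show "g x \<in> carrier P" if "x \<in> carrier L" for x using that by blast
    have "\<forall>x\<in>carrier L. \<forall>y\<in>carrier L. g (x \<oplus>\<^bsub>L\<^esub> y) = g x \<oplus>\<^bsub>P\<^esub> g y"
      by (intro ball) (simp add: g f.map_add flip: c.map_add)
    then show "g (x \<oplus>\<^bsub>L\<^esub> y) = g x \<oplus>\<^bsub>P\<^esub> g y" if "x \<in> carrier L" "y \<in> carrier L" for x y
      using that by blast
    have "\<forall>x\<in>carrier L. g (a \<odot>\<^bsub>L\<^esub> x) = a \<odot>\<^bsub>P\<^esub> g x" if "a \<in> carrier R" for a
      by (intro ball) (simp add: g f.map_smult that flip: c.map_smult)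
    then show "g (a \<odot>\<^bsub>L\<^esub> x) = a \<odot>\<^bsub>P\<^esub> g x" if "a \<in> carrier R" "x \<in> carrier L" for a x
      using that by blast
  qed
qed

lemma (in abelian_group) minus_eq_zero_iff:
  assumes "x \<in> carrier G" "y \<in> carrier G"
  shows "x \<ominus> y = \<zero> \<longleftrightarrow> x = y"
  using assms by (metis a_minus_def add.inv_closed minus_equality minus_minus r_neg)

lemma the_elem_image_eq:
  assumes "x \<in> Z" "\<And>y. y \<in> Z \<Longrightarrow> f y = f x"
  shows "the_elem (f ` Z) = f x"
proof -
  have "f ` Z = (\<lambda>_. f x) ` Z" by (rule image_cong) (use assms(2) in auto)
  also have "\<dots> = {f x}" using assms(1) by blast
  finally have "f ` Z = {f x}" .
  then show ?thesis by simp
qed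


section \<open>Free modules\<close>

context
  fixes R :: "('r, 'd) ring_scheme" (structure)
  assumes R: "cring R"
begin

interpretation R: cring R by (rule R)

lemma free_module_simps:
  "\<zero>\<^bsub>free_module R X\<^esub> = (\<lambda>x. \<zero>)"
  "p \<oplus>\<^bsub>free_module R X\<^esub> q = (\<lambda>x. p x \<oplus> q x)"
  "a \<odot>\<^bsub>free_module R X\<^esub> p = (\<lambda>x. a \<otimes> p x)"
  by (simp_all add: free_module_def)

lemma mem_free_module:
  "p \<in> carrier (free_module R X) \<longleftrightarrow>
    (\<forall>x. p x \<in> carrier R) \<and> finite {x. p x \<noteq> \<zero>} \<and> {x. p x \<noteq> \<zero>} \<subseteq> X"
  by (simp add: free_module_def)

lemma free_module_closedI:
  assumes "finite B" "B \<subseteq> X" "\<And>x. p x \<in> carrier R" "\<And>x. x \<notin> B \<Longrightarrow> p x = \<zero>"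
  shows "p \<in> carrier (free_module R X)"
proof -
  have "{x. p x \<noteq> \<zero>} \<subseteq> B" using assms(4) by blast
  then show ?thesis unfolding mem_free_module using assms finite_subset by blast
qed

lemma free_module_supports:
  assumes "p \<in> carrier (free_module R X)" "q \<in> carrier (free_module R X)"
  obtains B where "finite B" "B \<subseteq> X" "\<And>x. x \<notin> B \<Longrightarrow> p x = \<zero>" "\<And>x. x \<notin> B \<Longrightarrow> q x = \<zero>"
  by (rule that[of "{x. p x \<noteq> \<zero>} \<union> {x. q x \<noteq> \<zero>}"]) (use assms in \<open>auto simp: mem_free_module\<close>)

lemma free_module_module: "Module.module R (free_module R X)"
proof (rule Module.moduleI[OF R])
  let ?F = "free_module R X"
  have c: "\<And>p x. p \<in> carrier ?F \<Longrightarrow> p x \<in> carrier R" by (simp add: mem_free_module)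
  show "abelian_group ?F"
  proof (rule abelian_groupI)
    show "p \<oplus>\<^bsub>?F\<^esub> q \<in> carrier ?F" if pq: "p \<in> carrier ?F" "q \<in> carrier ?F" for p q
    proof -
      obtain B where "finite B" "B \<subseteq> X" "\<And>x. x \<notin> B \<Longrightarrow> p x = \<zero>" "\<And>x. x \<notin> B \<Longrightarrow> q x = \<zero>"
        by (rule free_module_supports[OF pq]) auto
      then show ?thesis
        unfolding free_module_simps using pq by (intro free_module_closedI[of B]) (auto simp: c)
    qed
    show "\<exists>q\<in>carrier ?F. q \<oplus>\<^bsub>?F\<^esub> p = \<zero>\<^bsub>?F\<^esub>" if p: "p \<in> carrier ?F" for p
    proof -
      obtain B where "finite B" "B \<subseteq> X" "\<And>x. x \<notin> B \<Longrightarrow> p x = \<zero>"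
        by (rule free_module_supports[OF p p]) auto
      then have "(\<lambda>x. \<ominus> p x) \<in> carrier ?F"
        using p by (intro free_module_closedI[of B]) (auto simp: c)
      then show ?thesis
        by (rule bexI[rotated]) (use p in \<open>simp add: free_module_simps c R.l_neg\<close>)
    qed
  qed (auto simp: free_module_simps mem_free_module R.a_ac)
  show "a \<odot>\<^bsub>?F\<^esub> p \<in> carrier ?F" if ap: "a \<in> carrier R" "p \<in> carrier ?F" for a p
  proof -
    obtain B where "finite B" "B \<subseteq> X" "\<And>x. x \<notin> B \<Longrightarrow> p x = \<zero>"
      by (rule free_module_supports[OF ap(2) ap(2)]) auto
    then show ?thesis
      unfolding free_module_simps using ap by (intro free_module_closedI[of B]) (auto simp: c)
  qed
qed (auto simp: free_module_simps mem_free_module R.l_distr R.r_distr R.m_assoc)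

lemma free_gen_closed: "x \<in> X \<Longrightarrow> free_gen R x \<in> carrier (free_module R X)"
  by (rule free_module_closedI[of "{x}"]) (auto simp: free_gen_def)

text \<open>Induction on a finite set that contains the support: splitting off the coefficient at
  one point leaves an element supported on the rest.\<close>

lemma free_module_generated:
  assumes H: "submodule H R (free_module R X)" and gen: "\<And>x. x \<in> X \<Longrightarrow> free_gen R x \<in> H"
  shows "carrier (free_module R X) \<subseteq> H"
proof -
  let ?F = "free_module R X"
  interpret F: Module.module R ?F by (rule free_module_module)
  note Hs = F.submoduleE[OF H]
  have "p \<in> H" if "finite B" "B \<subseteq> X" "\<And>x. p x \<in> carrier R" "\<And>x. x \<notin> B \<Longrightarrow> p x = \<zero>" for B p
    using that
  proof (induction B arbitrary: p)
    case empty
    then have "p = \<zero>\<^bsub>?F\<^esub>" by (auto simp: free_module_simps)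
    then show ?case using F.zero_mem_submodule[OF H] by simp
  next
    case (insert y B)
    have "p(y := \<zero>) \<in> H"
      using insert.prems insert.hyps by (intro insert.IH) auto
    moreover have "p y \<odot>\<^bsub>?F\<^esub> free_gen R y \<in> H"
      using insert.prems by (intro Hs(4) gen) auto
    moreover have "p = (p y \<odot>\<^bsub>?F\<^esub> free_gen R y) \<oplus>\<^bsub>?F\<^esub> p(y := \<zero>)"
      using insert.prems by (auto simp: free_module_simps free_gen_def)
    ultimately show ?case using Hs(5) by metis
  qed
  then show ?thesis unfolding mem_free_module subset_iff
    by (metis (mono_tags, lifting) mem_Collect_eq)
qed

end

context Module.module
begin

text \<open>The support of a sum or of a multiple may be smaller than those of its terms. Summing
  over any finite set containing the support gives both sides of a linearity equation the same index
  set.\<close>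

lemma free_lift_eq_finsum:
  assumes b: "b \<in> X \<rightarrow> carrier M" and p: "p \<in> carrier (free_module R X)"
    and B: "finite B" "B \<subseteq> X" "\<And>x. x \<notin> B \<Longrightarrow> p x = \<zero>"
  shows "free_lift R M b p = (\<Oplus>\<^bsub>M\<^esub>x\<in>B. p x \<odot>\<^bsub>M\<^esub> b x)"
  unfolding free_lift_def
proof (rule M.add.finprod_mono_neutral_cong_left)
  have p': "\<And>x. p x \<in> carrier R" using p by (simp add: mem_free_module[OF R.cring_axioms])
  show "{x. p x \<noteq> \<zero>} \<subseteq> B" using B(3) by blast
  show "p x \<odot>\<^bsub>M\<^esub> b x = \<zero>\<^bsub>M\<^esub>" if "x \<in> B - {x. p x \<noteq> \<zero>}" for x
    using that b B(2) by (auto simp: Pi_iff subset_iff)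
  show "(\<lambda>x. p x \<odot>\<^bsub>M\<^esub> b x) \<in> B \<rightarrow> carrier M"
    using b B(2) p' by (auto simp: Pi_iff subset_iff)
qed (use B in auto)

lemma free_lift_linear_map:
  assumes b: "b \<in> X \<rightarrow> carrier M"
  shows "linear_map R (free_module R X) M (free_lift R M b)"
proof -
  let ?F = "free_module R X"
  interpret F: Module.module R ?F by (rule free_module_module[OF R.cring_axioms])
  have c: "p x \<in> carrier R" if "p \<in> carrier ?F" for p x
    using that by (simp add: mem_free_module[OF R.cring_axioms])
  have bc: "\<And>x B. B \<subseteq> X \<Longrightarrow> x \<in> B \<Longrightarrow> b x \<in> carrier M" using b by (auto simp: Pi_iff subset_iff)
  note simps = free_module_simps[OF R.cring_axioms]
  show ?thesis
  proof unfold_locales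
    fix p q a
    assume p: "p \<in> carrier ?F"
    show "free_lift R M b p \<in> carrier M"
      unfolding free_lift_def
      by (rule M.finsum_closed)
         (use b p in \<open>auto simp: mem_free_module[OF R.cring_axioms] Pi_iff subset_iff\<close>)
    show "free_lift R M b (p \<oplus>\<^bsub>?F\<^esub> q) = free_lift R M b p \<oplus>\<^bsub>M\<^esub> free_lift R M b q"
      if q: "q \<in> carrier ?F"
    proof -
      obtain B where B: "finite B" "B \<subseteq> X" "\<And>x. x \<notin> B \<Longrightarrow> p x = \<zero>" "\<And>x. x \<notin> B \<Longrightarrow> q x = \<zero>"
        by (rule free_module_supports[OF R.cring_axioms p q]) auto
      have "free_lift R M b (p \<oplus>\<^bsub>?F\<^esub> q) = (\<Oplus>\<^bsub>M\<^esub>x\<in>B. (p \<oplus>\<^bsub>?F\<^esub> q) x \<odot>\<^bsub>M\<^esub> b x)"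
        using B F.M.a_closed[OF p q] by (intro free_lift_eq_finsum[OF b]) (auto simp: simps)
      also have "\<dots> = (\<Oplus>\<^bsub>M\<^esub>x\<in>B. p x \<odot>\<^bsub>M\<^esub> b x \<oplus>\<^bsub>M\<^esub> q x \<odot>\<^bsub>M\<^esub> b x)"
        using bc[OF B(2)] p q by (intro M.finsum_cong') (auto simp: simps c smult_l_distr)
      also have "\<dots> = free_lift R M b p \<oplus>\<^bsub>M\<^esub> free_lift R M b q"
        using bc[OF B(2)] p q
        by (simp add: M.finsum_addf Pi_iff c free_lift_eq_finsum[OF b _ B(1,2)] B)
      finally show ?thesis .
    qed
    show "free_lift R M b (a \<odot>\<^bsub>?F\<^esub> p) = a \<odot>\<^bsub>M\<^esub> free_lift R M b p"
      if a: "a \<in> carrier R"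
    proof -
      obtain B where B: "finite B" "B \<subseteq> X" "\<And>x. x \<notin> B \<Longrightarrow> p x = \<zero>"
        by (rule free_module_supports[OF R.cring_axioms p p]) auto
      have "free_lift R M b (a \<odot>\<^bsub>?F\<^esub> p) = (\<Oplus>\<^bsub>M\<^esub>x\<in>B. (a \<odot>\<^bsub>?F\<^esub> p) x \<odot>\<^bsub>M\<^esub> b x)"
        using B F.smult_closed[OF a p] a by (intro free_lift_eq_finsum[OF b]) (auto simp: simps)
      also have "\<dots> = (\<Oplus>\<^bsub>M\<^esub>x\<in>B. a \<odot>\<^bsub>M\<^esub> (p x \<odot>\<^bsub>M\<^esub> b x))"
        using bc[OF B(2)] p a by (intro M.finsum_cong') (auto simp: simps c smult_assoc1)
      also have "\<dots> = a \<odot>\<^bsub>M\<^esub> free_lift R M b p"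
        using bc[OF B(2)] p a
        by (simp add: finsum_smult_ldistr B(1) Pi_iff c free_lift_eq_finsum[OF b _ B])
      finally show ?thesis .
    qed
  qed
qed

lemma free_lift_free_gen:
  assumes b: "b \<in> X \<rightarrow> carrier M" and x: "x \<in> X"
  shows "free_lift R M b (free_gen R x) = b x"
proof -
  have bx: "b x \<in> carrier M" using b x by auto
  have "free_lift R M b (free_gen R x) = (\<Oplus>\<^bsub>M\<^esub>y\<in>{x}. free_gen R x y \<odot>\<^bsub>M\<^esub> b y)"
    by (rule free_lift_eq_finsum[OF b free_gen_closed[OF R.cring_axioms x]])
       (use x in \<open>auto simp: free_gen_def\<close>)
  also have "\<dots> = b x"
    using bx by (simp add: free_gen_def)
  finally show ?thesis .
qed

end


section \<open>Modules given by generators and relations\<close>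

text \<open>Tensor products and symmetric powers are both the free module on X modulo the span of S;
  their universal properties are proved here once for both.\<close>

locale presentation =
  fixes R :: "('r, 'd) ring_scheme" (structure) and X :: "'x set" and S :: "('x \<Rightarrow> 'r) set"
  assumes cring: "cring R" and relations: "S \<subseteq> carrier (free_module R X)"
begin

abbreviation F where "F \<equiv> free_module R X"
abbreviation K where "K \<equiv> submodule_gen R F S"
abbreviation Q where "Q \<equiv> quotient_module F K"
abbreviation cls where "cls x \<equiv> K +>\<^bsub>F\<^esub> free_gen R x"

sublocale F: Module.module R F by (rule free_module_module[OF cring])

lemma submodule_K: "submodule K R F"
  by (rule F.submodule_gen_submodule[OF relations])

sublocale quot: linear_map R F Q "\<lambda>p. K +>\<^bsub>F\<^esub> p"
  by (rule F.quotient_module_linear_map[OF submodule_K])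

lemma cls_closed: "x \<in> X \<Longrightarrow> cls x \<in> carrier Q"
  by (rule quot.map_closed[OF free_gen_closed[OF cring]])

lemma generated:
  assumes H: "submodule H R Q" and gen: "\<And>x. x \<in> X \<Longrightarrow> cls x \<in> H"
  shows "carrier Q \<subseteq> H"
proof -
  have "carrier F \<subseteq> {p \<in> carrier F. K +>\<^bsub>F\<^esub> p \<in> H}"
    by (rule free_module_generated[OF cring quot.submodule_vimage[OF H]])
       (use gen free_gen_closed[OF cring] in auto)
  then show ?thesis by (auto simp: F.carrier_quotient_module)
qed

lemma linear_map_eqI:
  assumes f: "linear_map R Q P f" and g: "linear_map R Q P g"
    and "\<And>x. x \<in> X \<Longrightarrow> f (cls x) = g (cls x)" and z: "z \<in> carrier Q"
  shows "f z = g z"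
proof -
  have "carrier Q \<subseteq> {z \<in> carrier Q. f z = g z}"
    by (rule generated[OF linear_map.submodule_equalizer[OF f g]]) (use assms cls_closed in auto)
  then show ?thesis using z by auto
qed

lemma relation_minus:
  assumes "p \<ominus>\<^bsub>F\<^esub> q \<in> S" "p \<in> carrier F" "q \<in> carrier F"
  shows "K +>\<^bsub>F\<^esub> p = K +>\<^bsub>F\<^esub> q"
  using assms submodule_gen_superset[of S R F] by (auto simp: F.coset_eq_iff[OF submodule_K])

lemma relation_minus_add:
  assumes "p \<ominus>\<^bsub>F\<^esub> (q \<oplus>\<^bsub>F\<^esub> r) \<in> S" "p \<in> carrier F" "q \<in> carrier F" "r \<in> carrier F"
  shows "K +>\<^bsub>F\<^esub> p = (K +>\<^bsub>F\<^esub> q) \<oplus>\<^bsub>Q\<^esub> (K +>\<^bsub>F\<^esub> r)"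
  using relation_minus[OF assms(1)] assms by (simp add: quot.map_add)

lemma relation_minus_smult:
  assumes "p \<ominus>\<^bsub>F\<^esub> (a \<odot>\<^bsub>F\<^esub> q) \<in> S" "p \<in> carrier F" "a \<in> carrier R" "q \<in> carrier F"
  shows "K +>\<^bsub>F\<^esub> p = a \<odot>\<^bsub>Q\<^esub> (K +>\<^bsub>F\<^esub> q)"
  using relation_minus[OF assms(1)] assms by (simp add: quot.map_smult)

context
  fixes P :: "('r, 'p, 'e) module_scheme" and b
  assumes P: "Module.module R P" and b: "b \<in> X \<rightarrow> carrier P"
    and kills: "\<And>p. p \<in> S \<Longrightarrow> free_lift R P b p = \<zero>\<^bsub>P\<^esub>"
begin

interpretation P: Module.module R P by (rule P)
interpretation lift: linear_map R F P "free_lift R P b"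
  by (rule P.free_lift_linear_map[OF b])

text \<open>The linear extension of b kills S, hence the span K, hence is constant on cosets of K,
  so that \<open>the_elem\<close> is applied to a singleton.\<close>

lemma induced_map_coset:
  assumes p: "p \<in> carrier F"
  shows "induced_map R P b (K +>\<^bsub>F\<^esub> p) = free_lift R P b p"
  unfolding induced_map_def
proof (rule the_elem_image_eq)
  show "p \<in> K +>\<^bsub>F\<^esub> p" by (rule F.mem_coset_self[OF submodule_K p])
  fix q assume q: "q \<in> K +>\<^bsub>F\<^esub> p"
  note q' = F.mem_cosetD[OF submodule_K p q]
  have "free_lift R P b ` K \<subseteq> {\<zero>\<^bsub>P\<^esub>}"
    by (rule lift.image_submodule_gen_subset[OF _ relations])
       (use kills in \<open>auto intro!: P.submoduleI\<close>)
  then have "free_lift R P b (q \<ominus>\<^bsub>F\<^esub> p) = \<zero>\<^bsub>P\<^esub>" using q'(2) by auto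
  then show "free_lift R P b q = free_lift R P b p"
    using p q'(1) lift.map_closed by (simp add: lift.map_minus P.M.minus_eq_zero_iff)
qed

lemma induced_map_linear_map: "linear_map R Q P (induced_map R P b)"
  by (rule linear_map_factor[OF quot.linear_map_axioms lift.linear_map_axioms
        F.carrier_quotient_module[symmetric] induced_map_coset])

lemma induced_map_cls: "x \<in> X \<Longrightarrow> induced_map R P b (cls x) = b x"
  using induced_map_coset free_gen_closed[OF cring] P.free_lift_free_gen[OF b] by metis

end

end

section \<open>Tensor products\<close>

definition bilinear_map ::
    "('r, 'd) ring_scheme \<Rightarrow> ('r, 'm, 'c) module_scheme \<Rightarrow> ('r, 'n, 'e) module_scheme \<Rightarrow>
     ('r, 'p, 'f) module_scheme \<Rightarrow> ('m \<Rightarrow> 'n \<Rightarrow> 'p) \<Rightarrow> bool"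
  where "bilinear_map R M N P \<beta> \<longleftrightarrow>
    (\<forall>x\<in>carrier M. linear_map R N P (\<beta> x)) \<and> (\<forall>y\<in>carrier N. linear_map R M P (\<lambda>x. \<beta> x y))"

context
  fixes R :: "('r, 'd) ring_scheme" and M :: "('r, 'm, 'c) module_scheme"
    and N :: "('r, 'n, 'e) module_scheme"
  assumes M: "Module.module R M" and N: "Module.module R N"
begin

interpretation M: Module.module R M by (rule M)
interpretation N: Module.module R N by (rule N)

lemma tensor_presentation: "presentation R (carrier M \<times> carrier N) (tensor_relations R M N)"
proof -
  interpret F: Module.module R "free_module R (carrier M \<times> carrier N)"
    by (rule free_module_module[OF M.R.cring_axioms])
  have "free_gen R z \<in> carrier (free_module R (carrier M \<times> carrier N))"
    if "z \<in> carrier M \<times> carrier N" for z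
    by (rule free_gen_closed[OF M.R.cring_axioms that])
  then show ?thesis
    by unfold_locales (auto simp: tensor_relations_def Let_def)
qed

interpretation T: presentation R "carrier M \<times> carrier N" "tensor_relations R M N"
  by (rule tensor_presentation)

lemma tensor_module_eq: "tensor_module R M N = T.Q"
  by (simp add: tensor_module_def tensor_null_def)

lemma pure_tensor_eq: "pure_tensor R M N x y = T.cls (x, y)"
  by (simp add: pure_tensor_def tensor_null_def)

lemma tensor_module_module: "Module.module R (tensor_module R M N)"
  unfolding tensor_module_eq by (rule T.quot.cod.module_axioms)

lemma tensor_generated:
  assumes "submodule H R (tensor_module R M N)"
    and "\<And>x y. x \<in> carrier M \<Longrightarrow> y \<in> carrier N \<Longrightarrow> pure_tensor R M N x y \<in> H"
  shows "carrier (tensor_module R M N) \<subseteq> H"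
  unfolding tensor_module_eq
  by (rule T.generated) (use assms in \<open>auto simp: tensor_module_eq pure_tensor_eq\<close>)

lemma tensor_linear_map_eqI:
  assumes "linear_map R (tensor_module R M N) P f" "linear_map R (tensor_module R M N) P g"
    and "\<And>x y. x \<in> carrier M \<Longrightarrow> y \<in> carrier N \<Longrightarrow>
      f (pure_tensor R M N x y) = g (pure_tensor R M N x y)"
    and "z \<in> carrier (tensor_module R M N)"
  shows "f z = g z"
  by (rule T.linear_map_eqI) (use assms in \<open>auto simp: tensor_module_eq pure_tensor_eq\<close>)

lemma pure_tensor_bilinear:
  "bilinear_map R M N (tensor_module R M N) (pure_tensor R M N)"
proof -
  note gen = free_gen_closed[OF M.R.cring_axioms, of _ "carrier M \<times> carrier N"]
  have closed: "T.cls z \<in> carrier T.Q" if "z \<in> carrier M \<times> carrier N" for z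
    by (rule T.cls_closed[OF that])
  note rel = tensor_relations_def Let_def
  have l_add: "T.cls (x \<oplus>\<^bsub>M\<^esub> x', y) = T.cls (x, y) \<oplus>\<^bsub>T.Q\<^esub> T.cls (x', y)"
    if "x \<in> carrier M" "x' \<in> carrier M" "y \<in> carrier N" for x x' y
  proof (rule T.relation_minus_add)
    show "free_gen R (x \<oplus>\<^bsub>M\<^esub> x', y) \<ominus>\<^bsub>T.F\<^esub> (free_gen R (x, y) \<oplus>\<^bsub>T.F\<^esub> free_gen R (x', y))
        \<in> tensor_relations R M N"
      unfolding rel using that by blast
  qed (use that gen in auto)
  have r_add: "T.cls (x, y \<oplus>\<^bsub>N\<^esub> y') = T.cls (x, y) \<oplus>\<^bsub>T.Q\<^esub> T.cls (x, y')"
    if "x \<in> carrier M" "y \<in> carrier N" "y' \<in> carrier N" for x y y'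
  proof (rule T.relation_minus_add)
    show "free_gen R (x, y \<oplus>\<^bsub>N\<^esub> y') \<ominus>\<^bsub>T.F\<^esub> (free_gen R (x, y) \<oplus>\<^bsub>T.F\<^esub> free_gen R (x, y'))
        \<in> tensor_relations R M N"
      unfolding rel using that by blast
  qed (use that gen in auto)
  have l_smult: "T.cls (a \<odot>\<^bsub>M\<^esub> x, y) = a \<odot>\<^bsub>T.Q\<^esub> T.cls (x, y)"
    if "a \<in> carrier R" "x \<in> carrier M" "y \<in> carrier N" for a x y
  proof (rule T.relation_minus_smult)
    show "free_gen R (a \<odot>\<^bsub>M\<^esub> x, y) \<ominus>\<^bsub>T.F\<^esub> (a \<odot>\<^bsub>T.F\<^esub> free_gen R (x, y))
        \<in> tensor_relations R M N"
      unfolding rel using that by blast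
  qed (use that gen in auto)
  have r_smult: "T.cls (x, a \<odot>\<^bsub>N\<^esub> y) = a \<odot>\<^bsub>T.Q\<^esub> T.cls (x, y)"
    if "a \<in> carrier R" "x \<in> carrier M" "y \<in> carrier N" for a x y
  proof (rule T.relation_minus_smult)
    show "free_gen R (x, a \<odot>\<^bsub>N\<^esub> y) \<ominus>\<^bsub>T.F\<^esub> (a \<odot>\<^bsub>T.F\<^esub> free_gen R (x, y))
        \<in> tensor_relations R M N"
      unfolding rel using that by blast
  qed (use that gen in auto)
  show ?thesis
    unfolding bilinear_map_def tensor_module_eq pure_tensor_eq
    by (intro conjI ballI; unfold_locales) (auto simp: closed l_add r_add l_smult r_smult)
qed

text \<open>The four families of tensor relations are the four clauses of bilinearity, so the linear
  extension of \<beta> to the free module vanishes on each of them.\<close>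

lemma tensor_lift:
  assumes "Module.module R P" and \<beta>: "bilinear_map R M N P \<beta>"
  shows tensor_lift_linear_map:
      "linear_map R (tensor_module R M N) P (induced_map R P (\<lambda>(x, y). \<beta> x y))"
    and tensor_lift_pure: "x \<in> carrier M \<Longrightarrow> y \<in> carrier N \<Longrightarrow>
      induced_map R P (\<lambda>(x, y). \<beta> x y) (pure_tensor R M N x y) = \<beta> x y"
proof -
  interpret P: Module.module R P by fact
  let ?b = "\<lambda>(x, y). \<beta> x y"
  have l: "linear_map R N P (\<beta> x)" if "x \<in> carrier M" for x
    using \<beta> that by (simp add: bilinear_map_def)
  have r: "linear_map R M P (\<lambda>x. \<beta> x y)" if "y \<in> carrier N" for y
    using \<beta> that by (simp add: bilinear_map_def)
  have b: "?b \<in> carrier M \<times> carrier N \<rightarrow> carrier P"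
    using linear_map.map_closed[OF l] by auto
  interpret lift: linear_map R T.F P "free_lift R P ?b"
    by (rule P.free_lift_linear_map[OF b])
  have kills: "free_lift R P ?b p = \<zero>\<^bsub>P\<^esub>" if "p \<in> tensor_relations R M N" for p
    using that unfolding tensor_relations_def Let_def
    by (auto simp: lift.map_minus lift.map_add lift.map_smult P.free_lift_free_gen[OF b]
        free_gen_closed[OF M.R.cring_axioms] linear_map.map_add[OF l] linear_map.map_add[OF r]
        linear_map.map_smult[OF l] linear_map.map_smult[OF r] linear_map.map_closed[OF l]
        P.M.minus_eq_zero_iff)
  show "linear_map R (tensor_module R M N) P (induced_map R P ?b)"
    unfolding tensor_module_eq by (rule T.induced_map_linear_map[OF assms(1) b kills])
  show "induced_map R P ?b (pure_tensor R M N x y) = \<beta> x y"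
    if "x \<in> carrier M" "y \<in> carrier N"
    using T.induced_map_cls[OF assms(1) b kills, of "(x, y)"] that by (simp add: pure_tensor_eq)
qed

end


section \<open>Symmetric powers\<close>

text \<open>The symmetric multilinear maps on words of length n, clause by clause the counterpart of
  \<open>sym_relations\<close>. Exchanging neighbours is enough for symmetry, as adjacent
  transpositions generate all permutations.\<close>

definition sym_multilinear ::
    "('r, 'd) ring_scheme \<Rightarrow> ('r, 'v, 'c) module_scheme \<Rightarrow> ('r, 'p, 'e) module_scheme \<Rightarrow> nat \<Rightarrow>
     ('v list \<Rightarrow> 'p) \<Rightarrow> bool"
  where "sym_multilinear R V P n b \<longleftrightarrow>
    (\<forall>vs\<in>words V n. b vs \<in> carrier P) \<and>
    (\<forall>xs ys v w. set xs \<union> set ys \<union> {v, w} \<subseteq> carrier V \<and> length xs + 1 + length ys = n \<longrightarrow>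
       b (xs @ [v \<oplus>\<^bsub>V\<^esub> w] @ ys) = b (xs @ [v] @ ys) \<oplus>\<^bsub>P\<^esub> b (xs @ [w] @ ys)) \<and>
    (\<forall>a\<in>carrier R. \<forall>xs ys v. set xs \<union> set ys \<union> {v} \<subseteq> carrier V \<and> length xs + 1 + length ys = n \<longrightarrow>
       b (xs @ [a \<odot>\<^bsub>V\<^esub> v] @ ys) = a \<odot>\<^bsub>P\<^esub> b (xs @ [v] @ ys)) \<and>
    (\<forall>xs ys v w. set xs \<union> set ys \<union> {v, w} \<subseteq> carrier V \<and> length xs + 2 + length ys = n \<longrightarrow>
       b (xs @ [v, w] @ ys) = b (xs @ [w, v] @ ys))"

text \<open>A condition at the place after xs is the given one at the place after
  \<open>v # xs\<close>. Applied to \<open>sym_monomial\<close>, it makes multiplication by v well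
  defined on symmetric powers.\<close>

lemma sym_multilinear_Cons:
  assumes b: "sym_multilinear R V P (Suc n) b" and v: "v \<in> carrier V"
  shows "sym_multilinear R V P n (\<lambda>vs. b (v # vs))"
  unfolding sym_multilinear_def
proof (intro conjI ballI allI impI; (elim conjE)?)
  fix xs ys x w
  show "b (v # vs) \<in> carrier P" if "vs \<in> words V n" for vs
    using b v that by (simp add: sym_multilinear_def words_def)
  show "b (v # xs @ [x \<oplus>\<^bsub>V\<^esub> w] @ ys) = b (v # xs @ [x] @ ys) \<oplus>\<^bsub>P\<^esub> b (v # xs @ [w] @ ys)"
    if "set xs \<union> set ys \<union> {x, w} \<subseteq> carrier V" "length xs + 1 + length ys = n"
    using b[unfolded sym_multilinear_def, THEN conjunct2, THEN conjunct1, rule_format,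
        of "v # xs" ys x w] v that by simp
  show "b (v # xs @ [a \<odot>\<^bsub>V\<^esub> x] @ ys) = a \<odot>\<^bsub>P\<^esub> b (v # xs @ [x] @ ys)"
    if "a \<in> carrier R" "set xs \<union> set ys \<union> {x} \<subseteq> carrier V" "length xs + 1 + length ys = n" for a
    using b[unfolded sym_multilinear_def, THEN conjunct2, THEN conjunct2, THEN conjunct1,
        rule_format, of a "v # xs" ys x] v that by simp
  show "b (v # xs @ [x, w] @ ys) = b (v # xs @ [w, x] @ ys)"
    if "set xs \<union> set ys \<union> {x, w} \<subseteq> carrier V" "length xs + 2 + length ys = n"
    using b[unfolded sym_multilinear_def, THEN conjunct2, THEN conjunct2, THEN conjunct2,
        rule_format, of "v # xs" ys x w] v that by simp
qed

context
  fixes R :: "('r, 'd) ring_scheme" and V :: "('r, 'v, 'c) module_scheme"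
  assumes V: "Module.module R V"
begin

interpretation V: Module.module R V by (rule V)

lemma sym_presentation: "presentation R (words V n) (sym_relations R V n)"
proof -
  interpret F: Module.module R "free_module R (words V n)"
    by (rule free_module_module[OF V.R.cring_axioms])
  have "free_gen R z \<in> carrier (free_module R (words V n))"
    if "set z \<subseteq> carrier V" "length z = n" for z
    by (rule free_gen_closed[OF V.R.cring_axioms]) (use that in \<open>simp add: words_def\<close>)
  then have "sym_relations R V n \<subseteq> carrier (free_module R (words V n))"
    unfolding sym_relations_def Let_def
    by (intro subsetI; elim UnE CollectE exE conjE) simp_all
  then show ?thesis
    by unfold_locales
qed

interpretation S: presentation R "words V n" "sym_relations R V n" for n
  by (rule sym_presentation)

lemma sym_power_eq: "sym_power R V n = S.Q n"
  by (simp add: sym_power_def sym_null_def)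

lemma sym_monomial_eq: "length vs = n \<Longrightarrow> sym_monomial R V vs = S.cls n vs"
  by (auto simp: sym_monomial_def sym_null_def)

lemma sym_power_module: "Module.module R (sym_power R V n)"
  unfolding sym_power_eq by (rule S.quot.cod.module_axioms)

lemma sym_power_generated:
  assumes "submodule H R (sym_power R V n)"
    and "\<And>vs. vs \<in> words V n \<Longrightarrow> sym_monomial R V vs \<in> H"
  shows "carrier (sym_power R V n) \<subseteq> H"
  unfolding sym_power_eq
  by (rule S.generated) (use assms in \<open>auto simp: sym_power_eq sym_monomial_eq words_def\<close>)

lemma sym_power_linear_map_eqI:
  assumes "linear_map R (sym_power R V n) P f" "linear_map R (sym_power R V n) P g"
    and "\<And>vs. vs \<in> words V n \<Longrightarrow> f (sym_monomial R V vs) = g (sym_monomial R V vs)"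
    and "z \<in> carrier (sym_power R V n)"
  shows "f z = g z"
  by (rule S.linear_map_eqI)
     (use assms in \<open>auto simp: sym_power_eq sym_monomial_eq words_def\<close>)

lemma sym_monomial_multilinear: "sym_multilinear R V (sym_power R V n) n (sym_monomial R V)"
proof -
  have gen: "free_gen R z \<in> carrier (free_module R (words V n))"
    if "set z \<subseteq> carrier V" "length z = n" for z
    by (rule free_gen_closed[OF V.R.cring_axioms]) (use that in \<open>simp add: words_def\<close>)
  have closed: "S.cls n z \<in> carrier (S.Q n)" if "z \<in> words V n" for z
    by (rule S.cls_closed[OF that])
  note rel = sym_relations_def Let_def
  have add: "S.cls n (xs @ [v \<oplus>\<^bsub>V\<^esub> w] @ ys) = S.cls n (xs @ [v] @ ys) \<oplus>\<^bsub>S.Q n\<^esub> S.cls n (xs @ [w] @ ys)"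
    if "set xs \<union> set ys \<union> {v, w} \<subseteq> carrier V" "length xs + 1 + length ys = n" for xs ys v w
  proof (rule S.relation_minus_add)
    show "free_gen R (xs @ [v \<oplus>\<^bsub>V\<^esub> w] @ ys) \<ominus>\<^bsub>S.F n\<^esub>
        (free_gen R (xs @ [v] @ ys) \<oplus>\<^bsub>S.F n\<^esub> free_gen R (xs @ [w] @ ys)) \<in> sym_relations R V n"
      unfolding rel using that by blast
  qed (use that gen in auto)
  have smult: "S.cls n (xs @ [a \<odot>\<^bsub>V\<^esub> v] @ ys) = a \<odot>\<^bsub>S.Q n\<^esub> S.cls n (xs @ [v] @ ys)"
    if "a \<in> carrier R" "set xs \<union> set ys \<union> {v} \<subseteq> carrier V" "length xs + 1 + length ys = n"
    for a xs ys v
  proof (rule S.relation_minus_smult)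
    show "free_gen R (xs @ [a \<odot>\<^bsub>V\<^esub> v] @ ys) \<ominus>\<^bsub>S.F n\<^esub> (a \<odot>\<^bsub>S.F n\<^esub> free_gen R (xs @ [v] @ ys))
        \<in> sym_relations R V n"
      unfolding rel using that by blast
  qed (use that gen in auto)
  have swap: "S.cls n (xs @ [v, w] @ ys) = S.cls n (xs @ [w, v] @ ys)"
    if "set xs \<union> set ys \<union> {v, w} \<subseteq> carrier V" "length xs + 2 + length ys = n" for xs ys v w
  proof (rule S.relation_minus)
    show "free_gen R (xs @ [v, w] @ ys) \<ominus>\<^bsub>S.F n\<^esub> free_gen R (xs @ [w, v] @ ys)
        \<in> sym_relations R V n"
      unfolding rel using that by blast
  qed (use that gen in auto)
  show ?thesis
    unfolding sym_multilinear_def sym_power_eq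
    using closed add smult swap by (auto simp: sym_monomial_eq words_def)
qed

lemma sym_power_lift:
  assumes "Module.module R P" and b: "sym_multilinear R V P n b"
  shows sym_power_lift_linear_map: "linear_map R (sym_power R V n) P (induced_map R P b)"
    and sym_power_lift_monomial:
      "vs \<in> words V n \<Longrightarrow> induced_map R P b (sym_monomial R V vs) = b vs"
proof -
  interpret P: Module.module R P by fact
  have closed: "b \<in> words V n \<rightarrow> carrier P" using b by (simp add: sym_multilinear_def)
  then have closed': "b z \<in> carrier P" if "set z \<subseteq> carrier V" "length z = n" for z
    using that by (auto simp: words_def)
  interpret lift: linear_map R "S.F n" P "free_lift R P b"
    by (rule P.free_lift_linear_map[OF closed])
  have gen: "free_gen R z \<in> carrier (S.F n)" if "set z \<subseteq> carrier V" "length z = n" for z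
    by (rule free_gen_closed[OF V.R.cring_axioms]) (use that in \<open>simp add: words_def\<close>)
  have lift: "free_lift R P b (free_gen R z) = b z" if "set z \<subseteq> carrier V" "length z = n" for z
    by (rule P.free_lift_free_gen[OF closed]) (use that in \<open>simp add: words_def\<close>)
  have b_add: "b (xs @ (v \<oplus>\<^bsub>V\<^esub> w) # ys) = b (xs @ v # ys) \<oplus>\<^bsub>P\<^esub> b (xs @ w # ys)"
    if "set xs \<subseteq> carrier V" "set ys \<subseteq> carrier V" "v \<in> carrier V" "w \<in> carrier V"
      "Suc (length xs + length ys) = n" for xs ys v w
    using b[unfolded sym_multilinear_def, THEN conjunct2, THEN conjunct1, rule_format,
        of xs ys v w] that by simp
  have b_smult: "b (xs @ a \<odot>\<^bsub>V\<^esub> v # ys) = a \<odot>\<^bsub>P\<^esub> b (xs @ v # ys)"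
    if "a \<in> carrier R" "set xs \<subseteq> carrier V" "set ys \<subseteq> carrier V" "v \<in> carrier V"
      "Suc (length xs + length ys) = n" for a xs ys v
    using b[unfolded sym_multilinear_def, THEN conjunct2, THEN conjunct2, THEN conjunct1,
        rule_format, of a xs ys v] that by simp
  have b_swap: "b (xs @ v # w # ys) = b (xs @ w # v # ys)"
    if "set xs \<subseteq> carrier V" "set ys \<subseteq> carrier V" "v \<in> carrier V" "w \<in> carrier V"
      "Suc (Suc (length xs + length ys)) = n" for xs ys v w
    using b[unfolded sym_multilinear_def, THEN conjunct2, THEN conjunct2, THEN conjunct2,
        rule_format, of xs ys v w] that by simp
  have kills: "free_lift R P b p = \<zero>\<^bsub>P\<^esub>" if "p \<in> sym_relations R V n" for p
    using that unfolding sym_relations_def Let_def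
    by (elim UnE CollectE exE conjE)
       (simp_all add: lift.map_minus lift.map_add lift.map_smult lift gen closed' b_add b_smult
        b_swap P.M.minus_eq_zero_iff)
  show "linear_map R (sym_power R V n) P (induced_map R P b)"
    unfolding sym_power_eq by (rule S.induced_map_linear_map[OF assms(1) closed kills])
  show "induced_map R P b (sym_monomial R V vs) = b vs" if "vs \<in> words V n"
    using S.induced_map_cls[OF assms(1) closed kills that] that
    by (simp add: sym_monomial_eq words_def)
qed

lemma sym_smult:
  assumes "v \<in> carrier V"
  shows sym_smult_linear_map:
      "linear_map R (sym_power R V n) (sym_power R V (Suc n)) (sym_smult R V n v)"
    and sym_smult_monomial:
      "vs \<in> words V n \<Longrightarrow> sym_smult R V n v (sym_monomial R V vs) = sym_monomial R V (v # vs)"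
  unfolding sym_smult_def
  using sym_power_lift[OF sym_power_module sym_multilinear_Cons[OF sym_monomial_multilinear assms]]
  by auto

end

section \<open>Bilinear maps under composition with linear maps\<close>

lemma bilinear_mapD:
  assumes "bilinear_map R M N P \<beta>"
  shows "x \<in> carrier M \<Longrightarrow> linear_map R N P (\<beta> x)"
    and "y \<in> carrier N \<Longrightarrow> linear_map R M P (\<lambda>x. \<beta> x y)"
  using assms by (auto simp: bilinear_map_def)

lemma bilinear_map_closed:
  assumes "bilinear_map R M N P \<beta>" "x \<in> carrier M" "y \<in> carrier N"
  shows "\<beta> x y \<in> carrier P"
  by (rule linear_map.map_closed[OF bilinear_mapD(1)[OF assms(1,2)] assms(3)])

lemma bilinear_map_comp_left:
  assumes \<beta>: "bilinear_map R M N P \<beta>" and f: "linear_map R L M f"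
  shows "bilinear_map R L N P (\<lambda>x y. \<beta> (f x) y)"
  unfolding bilinear_map_def
  using linear_map.linear_map_comp[OF f bilinear_mapD(2)[OF \<beta>]]
    bilinear_mapD(1)[OF \<beta> linear_map.map_closed[OF f]] by auto

lemma bilinear_map_comp_right:
  assumes \<beta>: "bilinear_map R M N P \<beta>" and f: "linear_map R L N f"
  shows "bilinear_map R M L P (\<lambda>x y. \<beta> x (f y))"
  unfolding bilinear_map_def
  using linear_map.linear_map_comp[OF f bilinear_mapD(1)[OF \<beta>]]
    bilinear_mapD(2)[OF \<beta> linear_map.map_closed[OF f]] by auto

lemma (in linear_map) submodule_kernel: "submodule (a_kernel M N f) R M"
proof -
  have "submodule {\<zero>\<^bsub>N\<^esub>} R N" by (rule cod.submoduleI) auto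
  from submodule_vimage[OF this] show ?thesis by (simp add: a_kernel_def')
qed


section \<open>Standard modules\<close>

text \<open>A product of an element of degree 1 with one of degree n has degree
  \<open>1 + n\<close>, while the inductions speak of \<open>Suc n\<close>. The rules settle on
  \<open>Suc n\<close> and keep the index of \<open>gcomp U 1\<close> from becoming
  \<open>Suc 0\<close>.\<close>

declare One_nat_def [simp del] plus_1_eq_Suc [simp] Suc_eq_plus1 [symmetric, simp]

locale graded_commutative_algebra =
  fixes R :: "('r, 'd) ring_scheme" and U :: "('r, 'u) graded_algebra"
  assumes gcomp_module: "Module.module R (gcomp U n)"
    and gone_closed: "gone U \<in> carrier (gcomp U 0)"
    and gmult_bilinear: "bilinear_map R (gcomp U i) (gcomp U j) (gcomp U (i + j)) (gmult U i j)"
    and gmult_assoc: "u \<in> carrier (gcomp U i) \<Longrightarrow> v \<in> carrier (gcomp U j) \<Longrightarrow>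
      w \<in> carrier (gcomp U k) \<Longrightarrow>
      gmult U (i + j) k (gmult U i j u v) w = gmult U i (j + k) u (gmult U j k v w)"
    and gmult_comm: "u \<in> carrier (gcomp U i) \<Longrightarrow> v \<in> carrier (gcomp U j) \<Longrightarrow>
      gmult U i j u v = gmult U j i v u"
begin

abbreviation V where "V \<equiv> gcomp U 1"
abbreviation S where "S \<equiv> sym_power R V"

lemma gmult_linear_right:
  assumes "v \<in> carrier V"
  shows "linear_map R (gcomp U n) (gcomp U (Suc n)) (gmult U 1 n v)"
  using bilinear_mapD(1)[OF gmult_bilinear[of 1 n] assms] by simp

lemma gmult_linear_left:
  assumes "u \<in> carrier (gcomp U n)"
  shows "linear_map R V (gcomp U (Suc n)) (\<lambda>v. gmult U 1 n v u)"
  using bilinear_mapD(2)[OF gmult_bilinear[of 1 n] assms] by simp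

lemma gmult_left_comm:
  assumes "v \<in> carrier V" "w \<in> carrier V" "u \<in> carrier (gcomp U n)"
  shows "gmult U 1 (Suc n) v (gmult U 1 n w u) = gmult U 1 (Suc n) w (gmult U 1 n v u)"
  using gmult_assoc[OF assms] gmult_assoc[OF assms(2,1,3)] gmult_comm[OF assms(1,2)] by simp

lemma word_prod_closed: "set vs \<subseteq> carrier V \<Longrightarrow> word_prod U vs \<in> carrier (gcomp U (length vs))"
  by (induction vs) (simp_all add: gone_closed linear_map.map_closed[OF gmult_linear_right])

text \<open>At the letter in question the product is linear in its left factor; every letter before
  it acts linearly from the left, which carries the equation through the induction on xs.\<close>

lemma word_prod_add:
  assumes "set xs \<subseteq> carrier V" "set ys \<subseteq> carrier V" "v \<in> carrier V" "w \<in> carrier V"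
  shows "word_prod U (xs @ (v \<oplus>\<^bsub>V\<^esub> w) # ys) =
    word_prod U (xs @ v # ys) \<oplus>\<^bsub>gcomp U (Suc (length xs + length ys))\<^esub> word_prod U (xs @ w # ys)"
  using assms
proof (induction xs)
  case Nil
  then show ?case
    using linear_map.map_add[OF gmult_linear_left[OF word_prod_closed]] by simp
next
  case (Cons x xs)
  then show ?case
    using linear_map.map_add[OF gmult_linear_right, of x "word_prod U (xs @ v # ys)"
        "Suc (length xs + length ys)" "word_prod U (xs @ w # ys)"]
      word_prod_closed[of "xs @ v # ys"] word_prod_closed[of "xs @ w # ys"] by simp
qed

lemma word_prod_smult:
  assumes "set xs \<subseteq> carrier V" "set ys \<subseteq> carrier V" "v \<in> carrier V" "a \<in> carrier R"
  shows "word_prod U (xs @ (a \<odot>\<^bsub>V\<^esub> v) # ys) =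
    a \<odot>\<^bsub>gcomp U (Suc (length xs + length ys))\<^esub> word_prod U (xs @ v # ys)"
  using assms
proof (induction xs)
  case Nil
  then show ?case
    using linear_map.map_smult[OF gmult_linear_left[OF word_prod_closed]] by simp
next
  case (Cons x xs)
  then show ?case
    using linear_map.map_smult[OF gmult_linear_right, of x a "word_prod U (xs @ v # ys)"
        "Suc (length xs + length ys)"]
      word_prod_closed[of "xs @ v # ys"] by simp
qed

lemma word_prod_swap:
  assumes "set xs \<subseteq> carrier V" "set ys \<subseteq> carrier V" "v \<in> carrier V" "w \<in> carrier V"
  shows "word_prod U (xs @ v # w # ys) = word_prod U (xs @ w # v # ys)"
  using assms gmult_left_comm[OF _ _ word_prod_closed, of v w ys] by (induction xs) simp_all

lemma word_prod_multilinear: "sym_multilinear R V (gcomp U n) n (word_prod U)"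
  unfolding sym_multilinear_def
proof (intro conjI ballI allI impI; (elim conjE)?)
  fix vs assume "vs \<in> words V n"
  then show "word_prod U vs \<in> carrier (gcomp U n)"
    using word_prod_closed[of vs] by (auto simp: words_def)
qed (auto simp: word_prod_add word_prod_smult word_prod_swap)

lemma sym_eval_linear_map: "linear_map R (S n) (gcomp U n) (sym_eval R U n)"
  unfolding sym_eval_def
  by (rule sym_power_lift_linear_map[OF gcomp_module gcomp_module word_prod_multilinear])

lemma sym_eval_monomial:
  "vs \<in> words V n \<Longrightarrow> sym_eval R U n (sym_monomial R V vs) = word_prod U vs"
  unfolding sym_eval_def
  by (rule sym_power_lift_monomial[OF gcomp_module gcomp_module word_prod_multilinear])

text \<open>Both sides are linear in s, and on a monomial the equation is the recursion of
  \<open>word_prod\<close>.\<close>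

lemma sym_eval_smult:
  assumes v: "v \<in> carrier V" and s: "s \<in> carrier (S n)"
  shows "sym_eval R U (Suc n) (sym_smult R V n v s) = gmult U 1 n v (sym_eval R U n s)"
proof (rule sym_power_linear_map_eqI[OF gcomp_module _ _ _ s])
  show "linear_map R (S n) (gcomp U (Suc n)) (\<lambda>s. sym_eval R U (Suc n) (sym_smult R V n v s))"
    by (rule linear_map.linear_map_comp[OF sym_smult_linear_map[OF gcomp_module v]
          sym_eval_linear_map])
  show "linear_map R (S n) (gcomp U (Suc n)) (\<lambda>s. gmult U 1 n v (sym_eval R U n s))"
    by (rule linear_map.linear_map_comp[OF sym_eval_linear_map gmult_linear_right[OF v]])
  fix vs assume vs: "vs \<in> words V n"
  then have "v # vs \<in> words V (Suc n)" using v by (simp add: words_def)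
  then show "sym_eval R U (Suc n) (sym_smult R V n v (sym_monomial R V vs)) =
      gmult U 1 n v (sym_eval R U n (sym_monomial R V vs))"
    using vs by (simp add: sym_smult_monomial[OF gcomp_module v vs] sym_eval_monomial[of _ "Suc n"]
        sym_eval_monomial[of _ n]) (simp add: words_def)
qed

end

section \<open>Standard modules and their canonical map\<close>

text \<open>Generation is stated in the one-step form F_{n+1} = U_1 F_n, which for U generated by
  U_1 amounts to F_n = U_n F_0 and suits induction on the degree.\<close>

locale standard_module = graded_commutative_algebra R U
  for R :: "('r, 'd) ring_scheme" and U :: "('r, 'u) graded_algebra" +
  fixes F :: "('r, 'u, 'f) graded_module"
  assumes mcomp_module: "Module.module R (mcomp F n)"
    and gact_bilinear: "bilinear_map R (gcomp U i) (mcomp F j) (mcomp F (i + j)) (gact F i j)"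
    and gact_assoc: "u \<in> carrier (gcomp U i) \<Longrightarrow> v \<in> carrier (gcomp U j) \<Longrightarrow>
      x \<in> carrier (mcomp F k) \<Longrightarrow>
      gact F (i + j) k (gmult U i j u v) x = gact F i (j + k) u (gact F j k v x)"
    and gact_one: "x \<in> carrier (mcomp F n) \<Longrightarrow> gact F 0 n (gone U) x = x"
    and gact_generates: "carrier (mcomp F (Suc n)) \<subseteq> submodule_gen R (mcomp F (Suc n))
      {gact F 1 n v x | v x. v \<in> carrier (gcomp U 1) \<and> x \<in> carrier (mcomp F n)}"
begin

abbreviation T where "T \<equiv> sym_tensor R U F"
abbreviation \<gamma> where "\<gamma> \<equiv> canonical_map R U F"
abbreviation \<mu> where "\<mu> \<equiv> sym_tensor_act R U F"

sublocale T: Module.module R "T n" for n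
  unfolding sym_tensor_def
  by (rule tensor_module_module[OF sym_power_module[OF gcomp_module] mcomp_module])

lemma gact_linear:
  assumes "v \<in> carrier V"
  shows "linear_map R (mcomp F n) (mcomp F (Suc n)) (gact F 1 n v)"
  using bilinear_mapD(1)[OF gact_bilinear[of 1 n] assms] by simp

lemma sym_act_bilinear:
  "bilinear_map R (S n) (mcomp F 0) (mcomp F n) (\<lambda>s f. gact F n 0 (sym_eval R U n s) f)"
  using bilinear_map_comp_left[OF gact_bilinear[of n 0] sym_eval_linear_map] by simp

lemma sym_act_smult:
  assumes "v \<in> carrier V" "s \<in> carrier (S n)" "f \<in> carrier (mcomp F 0)"
  shows "gact F (Suc n) 0 (sym_eval R U (Suc n) (sym_smult R V n v s)) f =
    gact F 1 n v (gact F n 0 (sym_eval R U n s) f)"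
  using gact_assoc[OF assms(1) linear_map.map_closed[OF sym_eval_linear_map assms(2)] assms(3)]
  by (simp add: sym_eval_smult[OF assms(1,2)])

lemma canonical_map_linear_map: "linear_map R (T n) (mcomp F n) (\<gamma> n)"
  unfolding sym_tensor_def canonical_map_def
  by (rule tensor_lift_linear_map[OF sym_power_module[OF gcomp_module] mcomp_module mcomp_module
        sym_act_bilinear])

sublocale \<gamma>: linear_map R "T n" "mcomp F n" "\<gamma> n" for n
  by (rule canonical_map_linear_map)

lemma canonical_map_pure:
  assumes "s \<in> carrier (S n)" "f \<in> carrier (mcomp F 0)"
  shows "\<gamma> n (pure_tensor R (S n) (mcomp F 0) s f) = gact F n 0 (sym_eval R U n s) f"
  unfolding canonical_map_def
  by (rule tensor_lift_pure[OF sym_power_module[OF gcomp_module] mcomp_module mcomp_module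
        sym_act_bilinear assms])

lemma pure_tensor_T_bilinear:
  "bilinear_map R (S n) (mcomp F 0) (T n) (pure_tensor R (S n) (mcomp F 0))"
  unfolding sym_tensor_def
  by (rule pure_tensor_bilinear[OF sym_power_module[OF gcomp_module] mcomp_module])

lemma T_linear_map_eqI:
  assumes "linear_map R (T n) P f" "linear_map R (T n) P g"
    and "\<And>s x. s \<in> carrier (S n) \<Longrightarrow> x \<in> carrier (mcomp F 0) \<Longrightarrow>
      f (pure_tensor R (S n) (mcomp F 0) s x) = g (pure_tensor R (S n) (mcomp F 0) s x)"
    and "z \<in> carrier (T n)"
  shows "f z = g z"
  using tensor_linear_map_eqI[OF sym_power_module[OF gcomp_module] mcomp_module
      assms[unfolded sym_tensor_def]] .

lemma sym_smult_pure_bilinear: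
  assumes "v \<in> carrier V"
  shows "bilinear_map R (S n) (mcomp F 0) (T (Suc n))
    (\<lambda>s f. pure_tensor R (S (Suc n)) (mcomp F 0) (sym_smult R V n v s) f)"
  by (rule bilinear_map_comp_left[OF pure_tensor_T_bilinear
        sym_smult_linear_map[OF gcomp_module assms]])

lemma sym_tensor_act_linear_map:
  assumes "v \<in> carrier V"
  shows "linear_map R (T n) (T (Suc n)) (\<mu> n v)"
  using tensor_lift_linear_map[OF sym_power_module[OF gcomp_module] mcomp_module T.module_axioms
      sym_smult_pure_bilinear[OF assms]]
  by (simp add: sym_tensor_act_def sym_tensor_def)

lemma sym_tensor_act_pure:
  assumes "v \<in> carrier V" "s \<in> carrier (S n)" "f \<in> carrier (mcomp F 0)"
  shows "\<mu> n v (pure_tensor R (S n) (mcomp F 0) s f) =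
    pure_tensor R (S (Suc n)) (mcomp F 0) (sym_smult R V n v s) f"
  unfolding sym_tensor_act_def
  by (rule tensor_lift_pure[OF sym_power_module[OF gcomp_module] mcomp_module T.module_axioms
      sym_smult_pure_bilinear[OF assms(1)] assms(2,3)])

lemma sym_tensor_act_closed: "v \<in> carrier V \<Longrightarrow> z \<in> carrier (T n) \<Longrightarrow> \<mu> n v z \<in> carrier (T (Suc n))"
  using linear_map.map_closed[OF sym_tensor_act_linear_map] .

text \<open>On pure tensors this is associativity of the action, and both sides are linear in z. It
  expresses that \<gamma> is linear over the symmetric algebra, whose generators are the v.\<close>

lemma canonical_map_act:
  assumes v: "v \<in> carrier V" and z: "z \<in> carrier (T n)"
  shows "\<gamma> (Suc n) (\<mu> n v z) = gact F 1 n v (\<gamma> n z)"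
proof (rule T_linear_map_eqI[OF _ _ _ z])
  show "linear_map R (T n) (mcomp F (Suc n)) (\<lambda>z. \<gamma> (Suc n) (\<mu> n v z))"
    by (rule linear_map.linear_map_comp[OF sym_tensor_act_linear_map[OF v] canonical_map_linear_map])
  show "linear_map R (T n) (mcomp F (Suc n)) (\<lambda>z. gact F 1 n v (\<gamma> n z))"
    by (rule \<gamma>.linear_map_comp[OF gact_linear[OF v]])
  fix s f assume "s \<in> carrier (S n)" "f \<in> carrier (mcomp F 0)"
  then show "\<gamma> (Suc n) (\<mu> n v (pure_tensor R (S n) (mcomp F 0) s f)) =
      gact F 1 n v (\<gamma> n (pure_tensor R (S n) (mcomp F 0) s f))"
    by (simp add: sym_tensor_act_pure[OF v] canonical_map_pure sym_act_smult[OF v]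
        linear_map.map_closed[OF sym_smult_linear_map[OF gcomp_module v]])
qed

text \<open>The image of \<gamma> is a submodule. If it is everything in degree n, then in the next
  degree it contains U_1 F_n, which generates.\<close>

lemma canonical_map_surj: "\<gamma> n ` carrier (T n) = carrier (mcomp F n)"
proof
  show "\<gamma> n ` carrier (T n) \<subseteq> carrier (mcomp F n)" by (auto simp: \<gamma>.map_closed)
  show "carrier (mcomp F n) \<subseteq> \<gamma> n ` carrier (T n)"
  proof (induction n)
    case 0
    \<comment> \<open>The empty monomial is the unit of the symmetric algebra and evaluates to
      \<open>gone U\<close>; its tensor product with f is the preimage of f.\<close>
    have m: "sym_monomial R V [] \<in> carrier (S 0)" "sym_eval R U 0 (sym_monomial R V []) = gone U"
      using sym_monomial_multilinear[OF gcomp_module, of 1 0] sym_eval_monomial[of "[]" 0]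
      by (auto simp: sym_multilinear_def words_def)
    show ?case
    proof
      fix f assume f: "f \<in> carrier (mcomp F 0)"
      have "f = \<gamma> 0 (pure_tensor R (S 0) (mcomp F 0) (sym_monomial R V []) f)"
        using canonical_map_pure[OF m(1) f] gact_one[OF f] m(2) by simp
      then show "f \<in> \<gamma> 0 ` carrier (T 0)"
        using bilinear_map_closed[OF pure_tensor_T_bilinear m(1) f] by (rule image_eqI)
    qed
  next
    case (Suc n)
    have "gact F 1 n v x \<in> \<gamma> (Suc n) ` carrier (T (Suc n))"
      if v: "v \<in> carrier V" and x: "x \<in> carrier (mcomp F n)" for v x
    proof -
      from x Suc obtain z where z: "z \<in> carrier (T n)" "x = \<gamma> n z" by auto
      then have "gact F 1 n v x = \<gamma> (Suc n) (\<mu> n v z)" by (simp add: canonical_map_act[OF v])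
      then show ?thesis using sym_tensor_act_closed[OF v z(1)] by auto
    qed
    then have "submodule_gen R (mcomp F (Suc n))
      {gact F 1 n v x | v x. v \<in> carrier V \<and> x \<in> carrier (mcomp F n)}
      \<subseteq> \<gamma> (Suc n) ` carrier (T (Suc n))"
      by (intro submodule_gen_least \<gamma>.submodule_image T.carrier_is_submodule) auto
    then show ?case using gact_generates[of n] by blast
  qed
qed

lemma mem_canonical_kernel:
  "z \<in> canonical_kernel R U F n \<longleftrightarrow> z \<in> carrier (T n) \<and> \<gamma> n z = \<zero>\<^bsub>mcomp F n\<^esub>"
  by (simp add: canonical_kernel_def a_kernel_def')

abbreviation E_rel where
  "E_rel n \<equiv> {\<mu> n v z | v z. v \<in> carrier V \<and> z \<in> canonical_kernel R U F n}"

lemma E_rel_closed: "E_rel n \<subseteq> carrier (T (Suc n))"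
  by (auto simp: mem_canonical_kernel sym_tensor_act_closed)

lemma zero_effective_relations_iff:
  "zero_module (effective_relations R U F (Suc n)) \<longleftrightarrow>
    canonical_kernel R U F (Suc n) \<subseteq> submodule_gen R (T (Suc n)) (E_rel n)"
  unfolding effective_relations_def diff_Suc_1
proof (rule T.zero_module_subquotient_iff)
  show "submodule (canonical_kernel R U F (Suc n)) R (T (Suc n))"
    unfolding canonical_kernel_def by (rule \<gamma>.submodule_kernel)
  show "submodule (submodule_gen R (T (Suc n)) (E_rel n)) R (T (Suc n))"
    by (rule T.submodule_gen_submodule[OF E_rel_closed])
qed

end

section \<open>Effective relations and surjective morphisms\<close>

locale standard_module_epi = F: standard_module R U F + G: standard_module R U G
  for R :: "('r, 'd) ring_scheme" and U :: "('r, 'u) graded_algebra"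
    and F :: "('r, 'u, 'f) graded_module" and G :: "('r, 'u, 'g) graded_module" +
  fixes \<phi> :: "nat \<Rightarrow> 'f \<Rightarrow> 'g"
  assumes \<phi>_linear_map: "linear_map R (mcomp F n) (mcomp G n) (\<phi> n)"
    and \<phi>_gact: "u \<in> carrier (gcomp U i) \<Longrightarrow> x \<in> carrier (mcomp F j) \<Longrightarrow>
      \<phi> (i + j) (gact F i j u x) = gact G i j u (\<phi> j x)"
    and \<phi>_surj: "\<phi> n ` carrier (mcomp F n) = carrier (mcomp G n)"
begin

sublocale \<phi>: linear_map R "mcomp F n" "mcomp G n" "\<phi> n" for n
  by (rule \<phi>_linear_map)

abbreviation V where "V \<equiv> gcomp U 1"
abbreviation S where "S \<equiv> sym_power R V"

definition ker where "ker n = a_kernel (mcomp F n) (mcomp G n) (\<phi> n)"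

text \<open>This is U_1 H_n for H_n = \<open>ker n\<close>. The index is that of the source, the
  submodule itself lives in degree n + 1.\<close>

definition ker_shift where
  "ker_shift n = submodule_gen R (mcomp F (Suc n)) {gact F 1 n v h | v h. v \<in> carrier V \<and> h \<in> ker n}"

lemma mem_ker: "h \<in> ker n \<longleftrightarrow> h \<in> carrier (mcomp F n) \<and> \<phi> n h = \<zero>\<^bsub>mcomp G n\<^esub>"
  by (simp add: ker_def a_kernel_def')

lemma ker_shift_rel_closed:
  "{gact F 1 n v h | v h. v \<in> carrier V \<and> h \<in> ker n} \<subseteq> carrier (mcomp F (Suc n))"
  using linear_map.map_closed[OF F.gact_linear] by (auto simp: mem_ker)

lemma submodule_ker_shift: "submodule (ker_shift n) R (mcomp F (Suc n))"
  unfolding ker_shift_def by (rule F.\<gamma>.cod.submodule_gen_submodule[OF ker_shift_rel_closed])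

lemma gact_ker: "u \<in> carrier (gcomp U n) \<Longrightarrow> h \<in> ker 0 \<Longrightarrow> gact F n 0 u h \<in> ker n"
  using \<phi>_gact[of u n h 0] linear_map.map_zero[OF bilinear_mapD(1)[OF G.gact_bilinear], of u n 0]
    bilinear_map_closed[OF F.gact_bilinear[of n 0], of u h]
  by (simp add: mem_ker)

lemma gact_ker_shift: "v \<in> carrier V \<Longrightarrow> h \<in> ker n \<Longrightarrow> gact F 1 n v h \<in> ker_shift n"
  unfolding ker_shift_def by (rule subsetD[OF submodule_gen_superset]) blast

section \<open>The comparison map between the two tensor products\<close>

text \<open>The map id \<otimes> \<phi>_0 from S_n \<otimes> F_0 to S_n \<otimes> G_0.\<close>

definition \<pi> where
  "\<pi> n = induced_map R (G.T n) (\<lambda>(s, f). pure_tensor R (S n) (mcomp G 0) s (\<phi> 0 f))"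

lemma \<pi>_bilinear:
  "bilinear_map R (S n) (mcomp F 0) (G.T n) (\<lambda>s f. pure_tensor R (S n) (mcomp G 0) s (\<phi> 0 f))"
  by (rule bilinear_map_comp_right[OF G.pure_tensor_T_bilinear \<phi>_linear_map])

lemma \<pi>_linear_map: "linear_map R (F.T n) (G.T n) (\<pi> n)"
  unfolding \<pi>_def using tensor_lift_linear_map[OF sym_power_module[OF F.gcomp_module] F.mcomp_module
      G.T.module_axioms \<pi>_bilinear] by (simp add: sym_tensor_def)

sublocale \<pi>: linear_map R "F.T n" "G.T n" "\<pi> n" for n
  by (rule \<pi>_linear_map)

lemma \<pi>_pure:
  assumes "s \<in> carrier (S n)" "f \<in> carrier (mcomp F 0)"
  shows "\<pi> n (pure_tensor R (S n) (mcomp F 0) s f) = pure_tensor R (S n) (mcomp G 0) s (\<phi> 0 f)"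
  unfolding \<pi>_def
  by (rule tensor_lift_pure[OF sym_power_module[OF F.gcomp_module] F.mcomp_module
      G.T.module_axioms \<pi>_bilinear assms])

lemma \<pi>_surj: "carrier (G.T n) \<subseteq> \<pi> n ` carrier (F.T n)"
  unfolding sym_tensor_def[of R U G]
proof (rule tensor_generated[OF sym_power_module[OF F.gcomp_module] G.mcomp_module])
  show "submodule (\<pi> n ` carrier (F.T n)) R (tensor_module R (S n) (mcomp G 0))"
    using \<pi>.submodule_image[OF F.T.carrier_is_submodule, of n] by (simp add: sym_tensor_def)
  fix s g assume s: "s \<in> carrier (S n)" and "g \<in> carrier (mcomp G 0)"
  then obtain f where f: "f \<in> carrier (mcomp F 0)" "g = \<phi> 0 f" using \<phi>_surj[of 0] by blast
  show "pure_tensor R (S n) (mcomp G 0) s g \<in> \<pi> n ` carrier (F.T n)"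
    unfolding f(2) \<pi>_pure[OF s f(1), symmetric]
    by (rule imageI[OF bilinear_map_closed[OF F.pure_tensor_T_bilinear s f(1)]])
qed

lemma \<pi>_act:
  assumes v: "v \<in> carrier V" and z: "z \<in> carrier (F.T n)"
  shows "\<pi> (Suc n) (F.\<mu> n v z) = G.\<mu> n v (\<pi> n z)"
proof (rule F.T_linear_map_eqI[OF _ _ _ z])
  show "linear_map R (F.T n) (G.T (Suc n)) (\<lambda>z. \<pi> (Suc n) (F.\<mu> n v z))"
    by (rule linear_map.linear_map_comp[OF F.sym_tensor_act_linear_map[OF v] \<pi>_linear_map])
  show "linear_map R (F.T n) (G.T (Suc n)) (\<lambda>z. G.\<mu> n v (\<pi> n z))"
    by (rule \<pi>.linear_map_comp[OF G.sym_tensor_act_linear_map[OF v]])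
  fix s f assume "s \<in> carrier (S n)" "f \<in> carrier (mcomp F 0)"
  then show "\<pi> (Suc n) (F.\<mu> n v (pure_tensor R (S n) (mcomp F 0) s f)) =
      G.\<mu> n v (\<pi> n (pure_tensor R (S n) (mcomp F 0) s f))"
    by (simp add: F.sym_tensor_act_pure[OF v] G.sym_tensor_act_pure[OF v] \<pi>_pure \<phi>.map_closed
        linear_map.map_closed[OF sym_smult_linear_map[OF F.gcomp_module v]])
qed

text \<open>Naturality of the canonical map: on a pure tensor it is the compatibility of \<phi> with
  the action on degree 0. It matches relations of G with elements that \<gamma> sends into
  \<open>ker n\<close>.\<close>

lemma canonical_map_\<pi>:
  assumes z: "z \<in> carrier (F.T n)"
  shows "G.\<gamma> n (\<pi> n z) = \<phi> n (F.\<gamma> n z)"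
proof (rule F.T_linear_map_eqI[OF _ _ _ z])
  show "linear_map R (F.T n) (mcomp G n) (\<lambda>z. G.\<gamma> n (\<pi> n z))"
    by (rule \<pi>.linear_map_comp[OF G.canonical_map_linear_map])
  show "linear_map R (F.T n) (mcomp G n) (\<lambda>z. \<phi> n (F.\<gamma> n z))"
    by (rule F.\<gamma>.linear_map_comp[OF \<phi>_linear_map])
  fix s f assume "s \<in> carrier (S n)" "f \<in> carrier (mcomp F 0)"
  then show "G.\<gamma> n (\<pi> n (pure_tensor R (S n) (mcomp F 0) s f)) =
      \<phi> n (F.\<gamma> n (pure_tensor R (S n) (mcomp F 0) s f))"
    using \<phi>_gact[OF linear_map.map_closed[OF F.sym_eval_linear_map], of s n f 0]
    by (simp add: \<pi>_pure G.canonical_map_pure F.canonical_map_pure \<phi>.map_closed)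
qed

text \<open>The monomial \<open>v # ws\<close> acts as v after ws; the product of ws with h stays in
  the kernel, in degree n, and v then moves it into U_1 H_n. Linearity in s extends this from
  monomials to all s.\<close>

lemma sym_act_ker:
  assumes s: "s \<in> carrier (S (Suc n))" and h: "h \<in> ker 0"
  shows "gact F (Suc n) 0 (sym_eval R U (Suc n) s) h \<in> ker_shift n"
proof -
  let ?f = "\<lambda>s. gact F (Suc n) 0 (sym_eval R U (Suc n) s) h"
  have hc: "h \<in> carrier (mcomp F 0)" using h by (simp add: mem_ker)
  interpret f: linear_map R "S (Suc n)" "mcomp F (Suc n)" ?f
    by (rule bilinear_mapD(2)[OF F.sym_act_bilinear hc])
  have "?f (sym_monomial R V vs) \<in> ker_shift n" if vs: "vs \<in> words V (Suc n)" for vs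
  proof -
    obtain v ws where e: "vs = v # ws" "v \<in> carrier V" "set ws \<subseteq> carrier V" "length ws = n"
      using vs by (auto simp: words_def length_Suc_conv)
    have w: "word_prod U ws \<in> carrier (gcomp U n)" using F.word_prod_closed e by blast
    have "?f (sym_monomial R V vs) = gact F 1 n v (gact F n 0 (word_prod U ws) h)"
      using F.sym_eval_monomial[OF vs] F.gact_assoc[OF e(2) w hc] e by simp
    then show ?thesis using gact_ker_shift[OF e(2) gact_ker[OF w h]] by simp
  qed
  moreover have "sym_monomial R V vs \<in> carrier (S (Suc n))" if "vs \<in> words V (Suc n)" for vs
    using sym_monomial_multilinear[OF F.gcomp_module, of 1 "Suc n"] that
    by (simp add: sym_multilinear_def)
  ultimately have "carrier (S (Suc n)) \<subseteq> {s \<in> carrier (S (Suc n)). ?f s \<in> ker_shift n}"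
    by (intro sym_power_generated[OF F.gcomp_module f.submodule_vimage[OF submodule_ker_shift]])
       auto
  then show ?thesis using s by auto
qed

text \<open>Lifting \<open>g \<in> G\<^sub>0\<close> to \<open>F\<^sub>0\<close>, the assignment \<open>s \<otimes> g \<mapsto> s \<cdot> g\<close> is well defined modulo
  \<^term>\<open>ker_shift n\<close>; this gives a map on the tensor product with \<open>G\<^sub>0\<close> through which
  \<^term>\<open>F.\<gamma> (Suc n)\<close> modulo \<^term>\<open>ker_shift n\<close> factors.\<close>
lemma canonical_map_ker_\<pi>:
  assumes z: "z \<in> carrier (F.T (Suc n))" and "\<pi> (Suc n) z = \<zero>\<^bsub>G.T (Suc n)\<^esub>"
  shows "F.\<gamma> (Suc n) z \<in> ker_shift n"
proof -
  let ?Q = "quotient_module (mcomp F (Suc n)) (ker_shift n)"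
  let ?cls = "\<lambda>x. ker_shift n +>\<^bsub>mcomp F (Suc n)\<^esub> x"
  let ?act = "\<lambda>s f. gact F (Suc n) 0 (sym_eval R U (Suc n) s) f"
  note sub = submodule_ker_shift[of n]
  interpret cls: linear_map R "mcomp F (Suc n)" ?Q ?cls
    by (rule F.\<gamma>.cod.quotient_module_linear_map[OF sub])
  define lift where "lift g = (SOME f. f \<in> carrier (mcomp F 0) \<and> \<phi> 0 f = g)" for g
  define \<beta> where "\<beta> s g = ?cls (?act s (lift g))" for s g
  have lift: "lift g \<in> carrier (mcomp F 0)" "\<phi> 0 (lift g) = g" if "g \<in> carrier (mcomp G 0)" for g
  proof -
    have "\<exists>f. f \<in> carrier (mcomp F 0) \<and> \<phi> 0 f = g" using that unfolding \<phi>_surj[of 0, symmetric] by blast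
    from someI_ex[OF this] show "lift g \<in> carrier (mcomp F 0)" "\<phi> 0 (lift g) = g"
      unfolding lift_def by auto
  qed
  \<comment> \<open>The chosen preimage and f differ by an element of \<open>ker 0\<close>, so by
    \<open>sym_act_ker\<close> their products with s agree modulo
    \<open>ker_shift n\<close>.\<close>
  have \<beta>_\<phi>: "\<beta> s (\<phi> 0 f) = ?cls (?act s f)"
    if s: "s \<in> carrier (S (Suc n))" and f: "f \<in> carrier (mcomp F 0)" for s f
  proof -
    let ?f = "lift (\<phi> 0 f)"
    interpret act: linear_map R "mcomp F 0" "mcomp F (Suc n)" "?act s"
      by (rule bilinear_mapD(1)[OF F.sym_act_bilinear s])
    have f': "?f \<in> carrier (mcomp F 0)" "\<phi> 0 ?f = \<phi> 0 f" using lift \<phi>.map_closed[OF f] by auto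
    have "?f \<ominus>\<^bsub>mcomp F 0\<^esub> f \<in> ker 0"
      using f f' by (simp add: mem_ker \<phi>.map_minus G.\<gamma>.cod.M.minus_eq_zero_iff \<phi>.map_closed)
    from sym_act_ker[OF s this] show ?thesis
      using f f' by (simp add: \<beta>_def F.\<gamma>.cod.coset_eq_iff[OF sub] act.map_closed act.map_minus)
  qed
  have bil: "bilinear_map R (S (Suc n)) (mcomp F 0) ?Q (\<lambda>s f. ?cls (?act s f))"
    unfolding bilinear_map_def
    using linear_map.linear_map_comp[OF bilinear_mapD(1)[OF F.sym_act_bilinear] cls.linear_map_axioms]
      linear_map.linear_map_comp[OF bilinear_mapD(2)[OF F.sym_act_bilinear] cls.linear_map_axioms]
    by auto
  have \<beta>: "bilinear_map R (S (Suc n)) (mcomp G 0) ?Q \<beta>"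
    unfolding bilinear_map_def
  proof (intro conjI ballI)
    show "linear_map R (mcomp G 0) ?Q (\<beta> s)" if s: "s \<in> carrier (S (Suc n))" for s
      \<comment> \<open>The choice \<open>lift\<close> need not be additive. Linearity comes from
        factoring the linear map of f through the surjection \<phi>_0, which is what \<beta>_\<phi>
        states.\<close>
      by (rule linear_map_factor[OF \<phi>_linear_map bilinear_mapD(1)[OF bil s] \<phi>_surj \<beta>_\<phi>[OF s]])
    show "linear_map R (S (Suc n)) ?Q (\<lambda>s. \<beta> s g)" if "g \<in> carrier (mcomp G 0)" for g
      unfolding \<beta>_def by (rule bilinear_mapD(2)[OF bil lift(1)[OF that]])
  qed
  define \<delta> where "\<delta> = induced_map R ?Q (\<lambda>(s, g). \<beta> s g)"
  interpret \<delta>: linear_map R "G.T (Suc n)" ?Q \<delta>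
    unfolding \<delta>_def sym_tensor_def
    by (rule tensor_lift_linear_map[OF sym_power_module[OF F.gcomp_module] G.mcomp_module
          cls.cod.module_axioms \<beta>])
  \<comment> \<open>Since \<gamma> modulo \<open>ker_shift n\<close> factors as \<delta> after
    \<pi>, an element killed by \<pi> has trivial class.\<close>
  have "\<delta> (\<pi> (Suc n) z) = ?cls (F.\<gamma> (Suc n) z)"
  proof (rule F.T_linear_map_eqI[OF _ _ _ z])
    show "linear_map R (F.T (Suc n)) ?Q (\<lambda>z. \<delta> (\<pi> (Suc n) z))"
      by (rule \<pi>.linear_map_comp[OF \<delta>.linear_map_axioms])
    show "linear_map R (F.T (Suc n)) ?Q (\<lambda>z. ?cls (F.\<gamma> (Suc n) z))"
      by (rule F.\<gamma>.linear_map_comp[OF cls.linear_map_axioms])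
    fix s f assume s: "s \<in> carrier (S (Suc n))" and f: "f \<in> carrier (mcomp F 0)"
    have "\<delta> (pure_tensor R (S (Suc n)) (mcomp G 0) s (\<phi> 0 f)) = \<beta> s (\<phi> 0 f)"
      unfolding \<delta>_def
      by (rule tensor_lift_pure[OF sym_power_module[OF F.gcomp_module] G.mcomp_module
            cls.cod.module_axioms \<beta> s \<phi>.map_closed[OF f]])
    then show "\<delta> (\<pi> (Suc n) (pure_tensor R (S (Suc n)) (mcomp F 0) s f)) =
        ?cls (F.\<gamma> (Suc n) (pure_tensor R (S (Suc n)) (mcomp F 0) s f))"
      by (simp add: \<pi>_pure[OF s f] F.canonical_map_pure[OF s f] \<beta>_\<phi>[OF s f])
  qed
  then have "?cls (F.\<gamma> (Suc n) z) = ker_shift n"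
    using assms(2) by (simp add: \<delta>.map_zero F.\<gamma>.cod.zero_quotient_module)
  then show ?thesis
    using F.\<gamma>.cod.coset_eq_self_iff[OF sub F.\<gamma>.map_closed[OF z]] by simp
qed

section \<open>The chase between relations and kernels\<close>

abbreviation lift_rel where
  "lift_rel n \<equiv> {F.\<mu> n v w | v w. v \<in> carrier V \<and> w \<in> carrier (F.T n) \<and> F.\<gamma> n w \<in> ker n}"

text \<open>U_1 times the preimage of H_n under \<gamma>. The pivot of both chases: \<gamma> maps it
  onto U_1 H_n, while \<pi> maps it onto the denominator of E(G) in degree n + 1.\<close>

definition lifts where "lifts n = submodule_gen R (F.T (Suc n)) (lift_rel n)"

lemma lift_rel_closed: "lift_rel n \<subseteq> carrier (F.T (Suc n))"
  by (auto simp: F.sym_tensor_act_closed)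

lemma submodule_lifts: "submodule (lifts n) R (F.T (Suc n))"
  unfolding lifts_def by (rule F.T.submodule_gen_submodule[OF lift_rel_closed])

lemma lift_rel_lifts: "lift_rel n \<subseteq> lifts n"
  unfolding lifts_def by (rule submodule_gen_superset)

text \<open>The map \<gamma> commutes with the action of v and is surjective in degree n, so every
  generator of U_1 H_n comes from a generator of \<open>lifts n\<close>.\<close>

lemma canonical_map_lifts: "F.\<gamma> (Suc n) ` lifts n = ker_shift n"
proof -
  have "F.\<gamma> (Suc n) ` lift_rel n = {gact F 1 n v h | v h. v \<in> carrier V \<and> h \<in> ker n}"
  proof (intro equalityI subsetI)
    fix x assume "x \<in> {gact F 1 n v h | v h. v \<in> carrier V \<and> h \<in> ker n}"
    then obtain v h where x: "x = gact F 1 n v h" "v \<in> carrier V" "h \<in> ker n" by blast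
    then obtain w where w: "w \<in> carrier (F.T n)" "h = F.\<gamma> n w"
      using F.canonical_map_surj[of n] by (auto simp: mem_ker)
    then have "x = F.\<gamma> (Suc n) (F.\<mu> n v w)" using x by (simp add: F.canonical_map_act)
    then show "x \<in> F.\<gamma> (Suc n) ` lift_rel n" using x w by blast
  next
    fix x assume "x \<in> F.\<gamma> (Suc n) ` lift_rel n"
    then obtain v w where "x = gact F 1 n v (F.\<gamma> n w)" "v \<in> carrier V" "F.\<gamma> n w \<in> ker n"
      by (auto simp: F.canonical_map_act)
    then show "x \<in> {gact F 1 n v h | v h. v \<in> carrier V \<and> h \<in> ker n}" by blast
  qed
  then show ?thesis
    unfolding lifts_def ker_shift_def F.\<gamma>.image_submodule_gen[OF lift_rel_closed] by simp
qed

text \<open>By naturality, \<pi> w is a relation of G exactly when \<gamma> w lies in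
  \<open>ker n\<close>, and \<pi> is surjective. Hence generators correspond to generators.\<close>

lemma \<pi>_lifts: "\<pi> (Suc n) ` lifts n = submodule_gen R (G.T (Suc n)) (G.E_rel n)"
proof -
  have "\<pi> (Suc n) ` lift_rel n = G.E_rel n"
  proof (intro equalityI subsetI)
    fix x assume "x \<in> G.E_rel n"
    then obtain v z where x: "x = G.\<mu> n v z" "v \<in> carrier V" "z \<in> canonical_kernel R U G n"
      by blast
    then obtain w where w: "w \<in> carrier (F.T n)" "z = \<pi> n w"
      using \<pi>_surj[of n] by (auto simp: G.mem_canonical_kernel)
    then have "x = \<pi> (Suc n) (F.\<mu> n v w)" "F.\<gamma> n w \<in> ker n"
      using x by (simp_all add: \<pi>_act mem_ker F.\<gamma>.map_closed G.mem_canonical_kernel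
          flip: canonical_map_\<pi>)
    then show "x \<in> \<pi> (Suc n) ` lift_rel n" using x w by blast
  next
    fix x assume "x \<in> \<pi> (Suc n) ` lift_rel n"
    then obtain v w where "x = G.\<mu> n v (\<pi> n w)" "v \<in> carrier V" "w \<in> carrier (F.T n)"
      "F.\<gamma> n w \<in> ker n"
      by (auto simp: \<pi>_act)
    then have "\<pi> n w \<in> canonical_kernel R U G n"
      by (simp add: G.mem_canonical_kernel canonical_map_\<pi> mem_ker \<pi>.map_closed)
    then show "x \<in> G.E_rel n" using \<open>x = _\<close> \<open>v \<in> carrier V\<close> by blast
  qed
  then show ?thesis
    unfolding lifts_def \<pi>.image_submodule_gen[OF lift_rel_closed] by simp
qed

text \<open>Write h = \<gamma> w. Then \<pi> w is a relation of G, so the hypothesis gives w' in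
  \<open>lifts n\<close> with \<pi> w = \<pi> w'. In h = \<gamma>(w - w') + \<gamma> w' the first
  term lies in U_1 H_n because \<pi> kills w - w', the second because w' is in
  \<open>lifts n\<close>.\<close>

theorem ker_subset_if_effective_relations_zero:
  assumes "zero_module (effective_relations R U G (Suc n))"
  shows "ker (Suc n) \<subseteq> ker_shift n"
proof
  fix h assume h: "h \<in> ker (Suc n)"
  then obtain w where w: "w \<in> carrier (F.T (Suc n))" "h = F.\<gamma> (Suc n) w"
    using F.canonical_map_surj[of "Suc n"] by (auto simp: mem_ker)
  then have "\<pi> (Suc n) w \<in> canonical_kernel R U G (Suc n)"
    using h by (simp add: G.mem_canonical_kernel canonical_map_\<pi> mem_ker \<pi>.map_closed)
  then have "\<pi> (Suc n) w \<in> \<pi> (Suc n) ` lifts n"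
    using assms unfolding G.zero_effective_relations_iff \<pi>_lifts by blast
  then obtain w' where w': "w' \<in> lifts n" "\<pi> (Suc n) w = \<pi> (Suc n) w'" by blast
  have w'c: "w' \<in> carrier (F.T (Suc n))"
    using F.T.submoduleE(1)[OF submodule_lifts] w'(1) by blast
  have "F.\<gamma> (Suc n) (w \<ominus>\<^bsub>F.T (Suc n)\<^esub> w') \<in> ker_shift n"
    by (rule canonical_map_ker_\<pi>)
       (use w w'c w'(2) in \<open>simp_all add: \<pi>.map_minus G.T.M.minus_eq_zero_iff \<pi>.map_closed\<close>)
  moreover have "F.\<gamma> (Suc n) w' \<in> ker_shift n" using canonical_map_lifts w'(1) by blast
  ultimately have "F.\<gamma> (Suc n) (w \<ominus>\<^bsub>F.T (Suc n)\<^esub> w') \<oplus>\<^bsub>mcomp F (Suc n)\<^esub> F.\<gamma> (Suc n) w' \<in> ker_shift n"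
    using F.\<gamma>.cod.submoduleE(5)[OF submodule_ker_shift] by blast
  then show "h \<in> ker_shift n"
    using w w'c by (simp add: a_minus_def F.T.M.a_assoc F.T.M.l_neg flip: F.\<gamma>.map_add)
qed

text \<open>Lift a relation of G to w. Then \<gamma> w lies in H_{n+1}, hence by hypothesis in U_1
  H_n, and equals \<gamma> w' for some w' in \<open>lifts n\<close>. Now w - w' is a relation of F,
  generated in lower degree, so it lies in \<open>lifts n\<close> as well; apply \<pi>.\<close>

theorem effective_relations_zero_if_ker_subset:
  assumes "zero_module (effective_relations R U F (Suc n))" and "ker (Suc n) \<subseteq> ker_shift n"
  shows "zero_module (effective_relations R U G (Suc n))"
  unfolding G.zero_effective_relations_iff
proof
  let ?EG = "submodule_gen R (G.T (Suc n)) (G.E_rel n)"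
  have EG: "submodule ?EG R (G.T (Suc n))" by (rule G.T.submodule_gen_submodule[OF G.E_rel_closed])
  fix z assume z: "z \<in> canonical_kernel R U G (Suc n)"
  then obtain w where w: "w \<in> carrier (F.T (Suc n))" "z = \<pi> (Suc n) w"
    using \<pi>_surj[of "Suc n"] by (auto simp: G.mem_canonical_kernel)
  then have "F.\<gamma> (Suc n) w \<in> ker (Suc n)"
    using z by (simp add: G.mem_canonical_kernel mem_ker F.\<gamma>.map_closed canonical_map_\<pi>)
  then obtain w' where w': "w' \<in> lifts n" "F.\<gamma> (Suc n) w = F.\<gamma> (Suc n) w'"
    using assms(2) canonical_map_lifts by blast
  have w'c: "w' \<in> carrier (F.T (Suc n))"
    using F.T.submoduleE(1)[OF submodule_lifts] w'(1) by blast
  let ?d = "w \<ominus>\<^bsub>F.T (Suc n)\<^esub> w'"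
  have "?d \<in> canonical_kernel R U F (Suc n)"
    using w w'c w'(2)
    by (simp add: F.mem_canonical_kernel F.\<gamma>.map_minus F.\<gamma>.cod.M.minus_eq_zero_iff F.\<gamma>.map_closed)
  then have "?d \<in> submodule_gen R (F.T (Suc n)) (F.E_rel n)"
    using assms(1) unfolding F.zero_effective_relations_iff by blast
  \<comment> \<open>A relation of F has \<gamma>-value zero, and zero lies in
    \<open>ker n\<close>.\<close>
  moreover have "F.E_rel n \<subseteq> lift_rel n"
    using \<phi>.map_zero by (fastforce simp: F.mem_canonical_kernel mem_ker)
  ultimately have "?d \<in> lifts n"
    using submodule_gen_least[OF submodule_lifts subset_trans[OF _ lift_rel_lifts], of "F.E_rel n" n]
    by blast
  then have "\<pi> (Suc n) ?d \<in> ?EG" "\<pi> (Suc n) w' \<in> ?EG" using \<pi>_lifts w'(1) by blast+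
  then have "\<pi> (Suc n) ?d \<oplus>\<^bsub>G.T (Suc n)\<^esub> \<pi> (Suc n) w' \<in> ?EG"
    using G.T.submoduleE(5)[OF EG] by blast
  then show "z \<in> ?EG"
    using w w'c by (simp add: a_minus_def F.T.M.a_assoc F.T.M.l_neg flip: \<pi>.map_add)
qed

end

section \<open>Multiplication by ideals\<close>

context Module.module
begin

lemma smult_linear_map:
  assumes "a \<in> carrier R"
  shows "linear_map R M M (\<lambda>x. a \<odot>\<^bsub>M\<^esub> x)"
proof unfold_locales
  fix x y b assume x: "x \<in> carrier M"
  show "a \<odot>\<^bsub>M\<^esub> x \<in> carrier M" using assms x by simp
  show "a \<odot>\<^bsub>M\<^esub> (x \<oplus>\<^bsub>M\<^esub> y) = a \<odot>\<^bsub>M\<^esub> x \<oplus>\<^bsub>M\<^esub> a \<odot>\<^bsub>M\<^esub> y" if "y \<in> carrier M"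
    using assms x that by (simp add: smult_r_distr)
  show "a \<odot>\<^bsub>M\<^esub> (b \<odot>\<^bsub>M\<^esub> x) = b \<odot>\<^bsub>M\<^esub> (a \<odot>\<^bsub>M\<^esub> x)" if "b \<in> carrier R"
    using assms x that R.m_comm[of a b] by (simp flip: smult_assoc1)
qed

lemma ideal_smult_generators_closed:
  assumes "I \<subseteq> carrier R" "N \<subseteq> carrier M"
  shows "{a \<odot>\<^bsub>M\<^esub> x | a x. a \<in> I \<and> x \<in> N} \<subseteq> carrier M"
  using assms by auto

lemma ideal_smult_submodule:
  assumes "I \<subseteq> carrier R" "N \<subseteq> carrier M"
  shows "submodule (ideal_smult R M I N) R M"
  unfolding ideal_smult_def
  by (rule submodule_gen_submodule[OF ideal_smult_generators_closed[OF assms]])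

lemma ideal_smult_memI: "a \<in> I \<Longrightarrow> x \<in> N \<Longrightarrow> a \<odot>\<^bsub>M\<^esub> x \<in> ideal_smult R M I N"
  unfolding ideal_smult_def by (rule subsetD[OF submodule_gen_superset]) blast

lemma ideal_smult_least:
  assumes "submodule H R M" "\<And>a x. a \<in> I \<Longrightarrow> x \<in> N \<Longrightarrow> a \<odot>\<^bsub>M\<^esub> x \<in> H"
  shows "ideal_smult R M I N \<subseteq> H"
  unfolding ideal_smult_def by (rule submodule_gen_least[OF assms(1)]) (use assms(2) in blast)

lemma ideal_smult_subset:
  assumes "I \<subseteq> carrier R" "submodule N R M"
  shows "ideal_smult R M I N \<subseteq> N"
  by (rule ideal_smult_least[OF assms(2)]) (use assms(1) submoduleE(4)[OF assms(2)] in blast)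

text \<open>From left to right, induction over the sums of products that make up the ideal product.
  From right to left, multiplication by a fixed a in I is linear, so the preimage of the left side
  under it is a submodule, and it contains the generators of KN.\<close>

lemma ideal_smult_ideal_prod:
  assumes I: "ideal I R" and K: "ideal K R" and N: "N \<subseteq> carrier M"
  shows "ideal_smult R M (I \<cdot>\<^bsub>R\<^esub> K) N = ideal_smult R M I (ideal_smult R M K N)"
proof
  have sub: "I \<subseteq> carrier R" "K \<subseteq> carrier R" "I \<cdot>\<^bsub>R\<^esub> K \<subseteq> carrier R"
    using ideal.Icarr[OF I] ideal.Icarr[OF K] R.ideal_prod_in_carrier[OF I K] by auto
  have KN: "submodule (ideal_smult R M K N) R M" by (rule ideal_smult_submodule[OF sub(2) N])
  have r: "submodule (ideal_smult R M I (ideal_smult R M K N)) R M"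
    by (rule ideal_smult_submodule[OF sub(1) submoduleE(1)[OF KN]])
  have l: "submodule (ideal_smult R M (I \<cdot>\<^bsub>R\<^esub> K) N) R M" by (rule ideal_smult_submodule[OF sub(3) N])
  show "ideal_smult R M (I \<cdot>\<^bsub>R\<^esub> K) N \<subseteq> ideal_smult R M I (ideal_smult R M K N)"
  proof (rule ideal_smult_least[OF r])
    fix c x assume "c \<in> I \<cdot>\<^bsub>R\<^esub> K" and x: "x \<in> N"
    then show "c \<odot>\<^bsub>M\<^esub> x \<in> ideal_smult R M I (ideal_smult R M K N)"
    proof induction
      case (prod i k)
      then have "(i \<otimes> k) \<odot>\<^bsub>M\<^esub> x = i \<odot>\<^bsub>M\<^esub> (k \<odot>\<^bsub>M\<^esub> x)"
        using sub N by (auto simp: smult_assoc1 subset_iff)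
      then show ?case using ideal_smult_memI[OF prod(1) ideal_smult_memI[OF prod(2) x]] by simp
    next
      case (sum c d)
      then have "(c \<oplus> d) \<odot>\<^bsub>M\<^esub> x = c \<odot>\<^bsub>M\<^esub> x \<oplus>\<^bsub>M\<^esub> d \<odot>\<^bsub>M\<^esub> x"
        using sub N by (auto simp: smult_l_distr subset_iff)
      then show ?case using sum submoduleE(5)[OF r] by simp
    qed
  qed
  show "ideal_smult R M I (ideal_smult R M K N) \<subseteq> ideal_smult R M (I \<cdot>\<^bsub>R\<^esub> K) N"
  proof (rule ideal_smult_least[OF l])
    fix a y assume a: "a \<in> I" and y: "y \<in> ideal_smult R M K N"
    have ac: "a \<in> carrier R" using a sub by blast
    interpret linear_map R M M "\<lambda>x. a \<odot>\<^bsub>M\<^esub> x" by (rule smult_linear_map[OF ac])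
    have "ideal_smult R M K N \<subseteq> {y \<in> carrier M. a \<odot>\<^bsub>M\<^esub> y \<in> ideal_smult R M (I \<cdot>\<^bsub>R\<^esub> K) N}"
    proof (rule ideal_smult_least[OF submodule_vimage[OF l]])
      fix k x assume kx: "k \<in> K" "x \<in> N"
      then have c: "k \<in> carrier R" "x \<in> carrier M" using sub N by auto
      have "a \<odot>\<^bsub>M\<^esub> (k \<odot>\<^bsub>M\<^esub> x) \<in> ideal_smult R M (I \<cdot>\<^bsub>R\<^esub> K) N"
        using ideal_smult_memI[OF ideal_prod.prod[OF a kx(1), of R] kx(2)] c ac by (simp add: smult_assoc1)
      then show "k \<odot>\<^bsub>M\<^esub> x \<in> {y \<in> carrier M. a \<odot>\<^bsub>M\<^esub> y \<in> ideal_smult R M (I \<cdot>\<^bsub>R\<^esub> K) N}"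
        using c by simp
    qed
    then show "a \<odot>\<^bsub>M\<^esub> y \<in> ideal_smult R M (I \<cdot>\<^bsub>R\<^esub> K) N" using y by blast
  qed
qed

lemma submodule_restrict_carrier:
  assumes "submodule P R M"
  shows "submodule H R (M\<lparr>carrier := P\<rparr>) \<longleftrightarrow> submodule H R M \<and> H \<subseteq> P"
proof -
  interpret P: Module.module R "M\<lparr>carrier := P\<rparr>"
    by (rule submodule.submodule_is_module[OF assms module_axioms])
  interpret incl: linear_map R "M\<lparr>carrier := P\<rparr>" M "\<lambda>x. x"
    by (rule linear_map_inclusion[OF assms])
  show ?thesis
  proof
    assume "submodule H R (M\<lparr>carrier := P\<rparr>)"
    then show "submodule H R M \<and> H \<subseteq> P"
      using incl.submodule_image[of H] P.submoduleE(1)[of H] by simp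
  next
    assume H: "submodule H R M \<and> H \<subseteq> P"
    then have "{x \<in> carrier (M\<lparr>carrier := P\<rparr>). x \<in> H} = H" by auto
    then show "submodule H R (M\<lparr>carrier := P\<rparr>)" using incl.submodule_vimage[of H] H by simp
  qed
qed

text \<open>The submodules of P are the submodules of M contained in P. Needed because the
  projection onto P/Q has P as its domain, whereas ideals multiply inside M.\<close>

lemma submodule_gen_restrict_carrier:
  assumes "submodule P R M" "S \<subseteq> P"
  shows "submodule_gen R (M\<lparr>carrier := P\<rparr>) S = submodule_gen R M S"
proof
  have P: "P \<subseteq> carrier M" by (rule submoduleE(1)[OF assms(1)])
  show "submodule_gen R (M\<lparr>carrier := P\<rparr>) S \<subseteq> submodule_gen R M S"
    by (rule submodule_gen_least[OF _ submodule_gen_superset])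
       (use submodule_restrict_carrier[OF assms(1)] submodule_gen_submodule[of S]
         submodule_gen_least[OF assms] assms(2) P in blast)
  interpret P: Module.module R "M\<lparr>carrier := P\<rparr>"
    by (rule submodule.submodule_is_module[OF assms(1) module_axioms])
  show "submodule_gen R M S \<subseteq> submodule_gen R (M\<lparr>carrier := P\<rparr>) S"
    by (rule submodule_gen_least[OF _ submodule_gen_superset])
       (use submodule_restrict_carrier[OF assms(1)] P.submodule_gen_submodule[of S] assms(2)
         in simp)
qed

end

lemma (in linear_map) image_ideal_smult:
  assumes "I \<subseteq> carrier R" "P \<subseteq> carrier M"
  shows "f ` ideal_smult R M I P = ideal_smult R N I (f ` P)"
proof -
  have "f ` {a \<odot>\<^bsub>M\<^esub> x | a x. a \<in> I \<and> x \<in> P} = {a \<odot>\<^bsub>N\<^esub> y | a y. a \<in> I \<and> y \<in> f ` P}"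
  proof (intro equalityI subsetI)
    fix z assume "z \<in> f ` {a \<odot>\<^bsub>M\<^esub> x | a x. a \<in> I \<and> x \<in> P}"
    then obtain a x where "z = f (a \<odot>\<^bsub>M\<^esub> x)" "a \<in> I" "x \<in> P" by blast
    moreover from this have "z = a \<odot>\<^bsub>N\<^esub> f x" using assms map_smult by blast
    ultimately show "z \<in> {a \<odot>\<^bsub>N\<^esub> y | a y. a \<in> I \<and> y \<in> f ` P}" by blast
  next
    fix z assume "z \<in> {a \<odot>\<^bsub>N\<^esub> y | a y. a \<in> I \<and> y \<in> f ` P}"
    then obtain a x where "z = a \<odot>\<^bsub>N\<^esub> f x" "a \<in> I" "x \<in> P" by blast
    moreover from this have "z = f (a \<odot>\<^bsub>M\<^esub> x)" using assms map_smult[of a x] by (simp add: subset_iff)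
    ultimately show "z \<in> f ` {a \<odot>\<^bsub>M\<^esub> x | a x. a \<in> I \<and> x \<in> P}" by blast
  qed
  then show ?thesis
    unfolding ideal_smult_def
    using image_submodule_gen[OF dom.ideal_smult_generators_closed[OF assms]] by simp
qed

section \<open>Powers of ideals, and the ring as a module over itself\<close>

context cring
begin

text \<open>Ideals form a commutative monoid under multiplication, with the whole ring as unit;
  these are its laws of powers.\<close>

lemma ideal_power_simps:
  assumes "ideal I R"
  shows ideal_power_ideal: "ideal (ideal_power R I n) R"
    and ideal_power_0: "ideal_power R I 0 = carrier R"
    and ideal_power_1: "ideal_power R I 1 = I"
    and ideal_power_add: "ideal_power R I (i + j) = ideal_power R I i \<cdot> ideal_power R I j"
proof -
  interpret IS: comm_monoid "ideals_set R" by (rule ideals_set_is_comm_monoid)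
  have I: "I \<in> carrier (ideals_set R)" using assms by (simp add: ideals_set_def)
  show "ideal (ideal_power R I n) R"
    using IS.nat_pow_closed[OF I] by (simp add: ideal_power_def ideals_set_def)
  show "ideal_power R I 0 = carrier R" by (simp add: ideal_power_def ideals_set_def)
  show "ideal_power R I 1 = I" 
    using IS.l_one[OF I] by (simp add: ideal_power_def One_nat_def)
  show "ideal_power R I (i + j) = ideal_power R I i \<cdot> ideal_power R I j"
    using IS.nat_pow_mult[OF I, of i j] by (simp add: ideal_power_def ideals_set_def)
qed

lemma self_module_simps:
  "carrier (self_module R) = carrier R" "add (self_module R) = add R" "zero (self_module R) = \<zero>"
  "smult (self_module R) = mult R"
  by (simp_all add: self_module_def)

lemma self_module_module: "Module.module R (self_module R)"
proof (rule Module.moduleI[OF cring_axioms])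
  show "abelian_group (self_module R)"
    by (rule abelian_groupI) (auto simp: self_module_simps a_ac intro: l_neg)
qed (auto simp: self_module_simps l_distr r_distr m_assoc)

lemma a_r_coset_self_module: "a_r_coset (self_module R) = a_r_coset R"
  by (intro ext) (simp add: a_r_coset_def r_coset_def self_module_simps)

lemma a_inv_self_module:
  assumes "x \<in> carrier R"
  shows "\<ominus>\<^bsub>self_module R\<^esub> x = \<ominus> x"
proof -
  interpret self: Module.module R "self_module R" by (rule self_module_module)
  show ?thesis
    by (rule self.M.minus_equality) (use assms in \<open>auto simp: self_module_simps l_neg\<close>)
qed

lemma ideal_submodule_self_module:
  assumes "ideal K R"
  shows "submodule K R (self_module R)"
proof -
  interpret self: Module.module R "self_module R" by (rule self_module_module)
  interpret K: ideal K R by fact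
  show ?thesis
    by (rule self.submoduleI)
       (auto simp: self_module_simps a_inv_self_module K.I_l_closed)
qed

text \<open>Identifies the two products of ideals, so that results on modules apply to the
  components I^n/JI^n of the Rees algebra.\<close>

lemma ideal_smult_self_module:
  assumes "ideal K R" "ideal N R"
  shows "ideal_smult R (self_module R) K N = K \<cdot> N"
proof
  interpret self: Module.module R "self_module R" by (rule self_module_module)
  have c: "K \<subseteq> carrier R" "N \<subseteq> carrier (self_module R)"
    using ideal.Icarr[OF assms(1)] ideal.Icarr[OF assms(2)] by (auto simp: self_module_simps)
  show "ideal_smult R (self_module R) K N \<subseteq> K \<cdot> N"
    by (rule self.ideal_smult_least[OF ideal_submodule_self_module[OF ideal_prod_is_ideal[OF assms]]])
       (simp add: self_module_simps ideal_prod.prod)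
  show "K \<cdot> N \<subseteq> ideal_smult R (self_module R) K N"
  proof
    fix x assume "x \<in> K \<cdot> N"
    then show "x \<in> ideal_smult R (self_module R) K N"
    proof induction
      case (prod i j)
      then show ?case using self.ideal_smult_memI[of i K j N] by (simp add: self_module_simps)
    next
      case (sum a b)
      then show ?case
        using self.submoduleE(5)[OF self.ideal_smult_submodule[OF c], of a b]
        by (simp add: self_module_simps)
    qed
  qed
qed

end

section \<open>Modules modulo an ideal\<close>

lemma mod_ideal_simps:
  "carrier (mod_ideal R M J P) = (\<lambda>x. ideal_smult R M J P +>\<^bsub>M\<^esub> x) ` P"
  "add (mod_ideal R M J P) = set_add M"
  "zero (mod_ideal R M J P) = ideal_smult R M J P"
  by (simp_all add: mod_ideal_def subquotient_def Let_def)

lemma carrier_Quot: "carrier (R Quot J) = (\<lambda>a. J +>\<^bsub>R\<^esub> a) ` carrier R"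
  by (auto simp: FactRing_simps)

locale module_with_ideal = Module.module R M
  for R :: "('r, 'd) ring_scheme" (structure) and M :: "('r, 'm, 'c) module_scheme" +
  fixes J
  assumes J: "ideal J R"
begin

sublocale J: ideal J R by (rule J)

lemma J_subset: "J \<subseteq> carrier R"
  using J.Icarr by auto

lemma submodule_JP: "submodule P R M \<Longrightarrow> submodule (ideal_smult R M J P) R M"
  by (rule ideal_smult_submodule[OF J_subset submoduleE(1)])

lemma mod_ideal_coset_eq_iff:
  assumes "submodule P R M" "x \<in> P" "y \<in> P"
  shows "ideal_smult R M J P +>\<^bsub>M\<^esub> x = ideal_smult R M J P +>\<^bsub>M\<^esub> y \<longleftrightarrow>
    x \<ominus>\<^bsub>M\<^esub> y \<in> ideal_smult R M J P"
  using coset_eq_iff[OF submodule_JP] submoduleE(1) assms by blast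

text \<open>The value of the scalar multiplication of \<^const>\<open>mod_ideal\<close>, a union over the representatives of
  the scalar, does not depend on the representative.\<close>
lemma mod_ideal_smult_eq_subquotient:
  assumes P: "submodule P R M" and a: "a \<in> carrier R"
    and X: "X \<in> carrier (mod_ideal R M J P)"
  shows "(J +> a) \<odot>\<^bsub>mod_ideal R M J P\<^esub> X = a \<odot>\<^bsub>subquotient M P (ideal_smult R M J P)\<^esub> X"
proof -
  let ?Q = "ideal_smult R M J P"
  note Q = submodule_JP[OF P]
  interpret self: Module.module R "self_module R" by (rule self_module_module)
  obtain x where x: "x \<in> P" "X = ?Q +>\<^bsub>M\<^esub> x" using X by (auto simp: mod_ideal_simps)
  then have xc: "x \<in> carrier M" using submoduleE(1)[OF P] by blast
  have "(\<Union>b\<in>J +>\<^bsub>self_module R\<^esub> a. b \<odot>\<^bsub>subquotient M P ?Q\<^esub> X) = a \<odot>\<^bsub>subquotient M P ?Q\<^esub> X"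
  proof (rule self.UN_coset_eq[OF ideal_submodule_self_module[OF J]])
    show "a \<in> carrier (self_module R)" using a by (simp add: self_module_simps)
    fix b assume "b \<in> carrier (self_module R)" and d: "b \<ominus>\<^bsub>self_module R\<^esub> a \<in> J"
    then have b: "b \<in> carrier R" by (simp add: self_module_simps)
    have d': "b \<ominus> a \<in> J" using d a b by (simp add: a_minus_def self_module_simps a_inv_self_module)
    have "b \<odot>\<^bsub>M\<^esub> x \<ominus>\<^bsub>M\<^esub> a \<odot>\<^bsub>M\<^esub> x = (b \<ominus> a) \<odot>\<^bsub>M\<^esub> x"
      using a b xc by (simp add: a_minus_def smult_l_distr smult_l_minus)
    then have "b \<odot>\<^bsub>M\<^esub> x \<ominus>\<^bsub>M\<^esub> a \<odot>\<^bsub>M\<^esub> x \<in> ?Q" using ideal_smult_memI[OF d' x(1)] by simp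
    then show "b \<odot>\<^bsub>subquotient M P ?Q\<^esub> X = a \<odot>\<^bsub>subquotient M P ?Q\<^esub> X"
      using a b xc by (simp add: x(2) subquotient_smult_coset[OF Q] coset_eq_iff[OF Q])
  qed
  then show ?thesis by (simp add: mod_ideal_def Let_def a_r_coset_self_module)
qed

lemma mod_ideal_smult:
  assumes "submodule P R M" "a \<in> carrier R" "x \<in> P"
  shows "(J +> a) \<odot>\<^bsub>mod_ideal R M J P\<^esub> (ideal_smult R M J P +>\<^bsub>M\<^esub> x) =
    ideal_smult R M J P +>\<^bsub>M\<^esub> (a \<odot>\<^bsub>M\<^esub> x)"
proof -
  have "x \<in> carrier M" using assms submoduleE(1) by blast
  then show ?thesis
    using assms mod_ideal_smult_eq_subquotient[OF assms(1,2)]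
    by (simp add: mod_ideal_simps subquotient_smult_coset[OF submodule_JP])
qed

lemma mod_ideal_add:
  assumes "submodule P R M" "x \<in> P" "y \<in> P"
  shows "(ideal_smult R M J P +>\<^bsub>M\<^esub> x) \<oplus>\<^bsub>mod_ideal R M J P\<^esub> (ideal_smult R M J P +>\<^bsub>M\<^esub> y) =
    ideal_smult R M J P +>\<^bsub>M\<^esub> (x \<oplus>\<^bsub>M\<^esub> y)"
proof -
  have "x \<in> carrier M" "y \<in> carrier M" using assms submoduleE(1) by blast+
  then show ?thesis by (simp add: mod_ideal_simps coset_add[OF submodule_JP[OF assms(1)]])
qed

lemma mod_ideal_coset_zero:
  assumes "submodule P R M" "x \<in> P"
  shows "ideal_smult R M J P +>\<^bsub>M\<^esub> x = \<zero>\<^bsub>mod_ideal R M J P\<^esub> \<longleftrightarrow> x \<in> ideal_smult R M J P"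
  using coset_eq_self_iff[OF submodule_JP[OF assms(1)], of x] submoduleE(1)[OF assms(1)] assms(2)
  by (auto simp: mod_ideal_simps)

lemma mod_ideal_module:
  assumes P: "submodule P R M"
  shows "Module.module (R Quot J) (mod_ideal R M J P)"
proof -
  interpret P: Module.module R "M\<lparr>carrier := P\<rparr>"
    by (rule submodule.submodule_is_module[OF P module_axioms])
  have "ideal_smult R M J P +>\<^bsub>M\<^esub> \<zero>\<^bsub>M\<^esub> = \<zero>\<^bsub>mod_ideal R M J P\<^esub>"
    using mod_ideal_coset_zero[OF P zero_mem_submodule[OF P]]
      zero_mem_submodule[OF submodule_JP[OF P]] by simp
  then show ?thesis
    by (intro P.module_image[where h = "\<lambda>a. J +> a" and f = "\<lambda>x. ideal_smult R M J P +>\<^bsub>M\<^esub> x"]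
        J.quotient_is_cring[OF R.cring_axioms] J.rcos_ring_hom)
       (auto simp: carrier_Quot mod_ideal_simps(1) mod_ideal_add[OF P] mod_ideal_smult[OF P])
qed

text \<open>J annihilates P/JP, so R and R/J act through the same scalar multiplications. Spans over
  R/J can therefore be computed over R, where the projection from P is linear.\<close>

lemma submodule_mod_ideal_iff:
  assumes P: "submodule P R M"
  shows "submodule H (R Quot J) (mod_ideal R M J P) \<longleftrightarrow>
    submodule H R (subquotient M P (ideal_smult R M J P))"
proof -
  let ?Q = "subquotient M P (ideal_smult R M J P)"
  let ?MJ = "mod_ideal R M J P"
  interpret MJ: Module.module "R Quot J" ?MJ by (rule mod_ideal_module[OF P])
  interpret Q: linear_map R "M\<lparr>carrier := P\<rparr>" ?Q "\<lambda>x. ideal_smult R M J P +>\<^bsub>M\<^esub> x"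
    by (rule subquotient_linear_map[OF P submodule_JP[OF P]])
  have c: "carrier ?MJ = carrier ?Q" and z: "\<zero>\<^bsub>?MJ\<^esub> = \<zero>\<^bsub>?Q\<^esub>" and p: "add ?MJ = add ?Q"
    by (simp_all add: mod_ideal_def Let_def)
  have neg: "\<ominus>\<^bsub>?MJ\<^esub> x = \<ominus>\<^bsub>?Q\<^esub> x" if "x \<in> carrier ?Q" for x
    by (rule MJ.M.minus_equality) (use that in \<open>simp_all add: c z p Q.cod.M.l_neg\<close>)
  have s: "(J +> a) \<odot>\<^bsub>?MJ\<^esub> x = a \<odot>\<^bsub>?Q\<^esub> x" if "a \<in> carrier R" "x \<in> carrier ?Q" for a x
    using mod_ideal_smult_eq_subquotient[OF P] that by (simp add: c)
  show ?thesis
  proof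
    assume H: "submodule H (R Quot J) ?MJ"
    note Hs = MJ.submoduleE[OF H]
    have Hc: "\<And>x. x \<in> H \<Longrightarrow> x \<in> carrier ?Q" using Hs(1) c by auto
    show "submodule H R ?Q"
    proof (rule Q.cod.submoduleI)
      show "H \<subseteq> carrier ?Q" using Hs(1) c by simp
      show "\<zero>\<^bsub>?Q\<^esub> \<in> H" using MJ.zero_mem_submodule[OF H] z by simp
      show "\<ominus>\<^bsub>?Q\<^esub> x \<in> H" if "x \<in> H" for x using Hs(3)[OF that] neg[OF Hc[OF that]] by simp
      show "x \<oplus>\<^bsub>?Q\<^esub> y \<in> H" if "x \<in> H" "y \<in> H" for x y using Hs(5)[OF that] p by simp
      show "a \<odot>\<^bsub>?Q\<^esub> x \<in> H" if "a \<in> carrier R" "x \<in> H" for a x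
        using Hs(4)[of "J +> a" x] s[OF that(1) Hc[OF that(2)]] that by (simp add: carrier_Quot)
    qed
  next
    assume H: "submodule H R ?Q"
    note Hs = Q.cod.submoduleE[OF H]
    have Hc: "\<And>x. x \<in> H \<Longrightarrow> x \<in> carrier ?Q" using Hs(1) by auto
    show "submodule H (R Quot J) ?MJ"
    proof (rule MJ.submoduleI)
      show "H \<subseteq> carrier ?MJ" using Hs(1) c by simp
      show "\<zero>\<^bsub>?MJ\<^esub> \<in> H" using Q.cod.zero_mem_submodule[OF H] z by simp
      show "\<ominus>\<^bsub>?MJ\<^esub> x \<in> H" if "x \<in> H" for x using Hs(3)[OF that] neg[OF Hc[OF that]] by simp
      show "x \<oplus>\<^bsub>?MJ\<^esub> y \<in> H" if "x \<in> H" "y \<in> H" for x y using Hs(5)[OF that] p by simp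
      show "a \<odot>\<^bsub>?MJ\<^esub> x \<in> H" if a: "a \<in> carrier (R Quot J)" and x: "x \<in> H" for a x
      proof -
        obtain b where "b \<in> carrier R" "a = J +> b" using a by (auto simp: carrier_Quot)
        then show ?thesis using Hs(4)[of b x] s[of b x] x Hc[OF x] by simp
      qed
    qed
  qed
qed

lemma submodule_gen_mod_ideal:
  assumes P: "submodule P R M" and S: "S \<subseteq> P"
  shows "submodule_gen (R Quot J) (mod_ideal R M J P) ((\<lambda>x. ideal_smult R M J P +>\<^bsub>M\<^esub> x) ` S) =
    (\<lambda>x. ideal_smult R M J P +>\<^bsub>M\<^esub> x) ` submodule_gen R M S"
proof -
  interpret Q: linear_map R "M\<lparr>carrier := P\<rparr>" "subquotient M P (ideal_smult R M J P)"
    "\<lambda>x. ideal_smult R M J P +>\<^bsub>M\<^esub> x"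
    by (rule subquotient_linear_map[OF P submodule_JP[OF P]])
  have "submodule_gen (R Quot J) (mod_ideal R M J P) T =
      submodule_gen R (subquotient M P (ideal_smult R M J P)) T" for T
    unfolding submodule_gen_def submodule_mod_ideal_iff[OF P] ..
  then show ?thesis
    using Q.image_submodule_gen[of S] S by (simp add: submodule_gen_restrict_carrier[OF P S])
qed

lemma image_mod_ideal_smult:
  assumes P: "submodule P R M"
    and IX: "\<And>a x. a \<in> I \<Longrightarrow> x \<in> X \<Longrightarrow> a \<odot>\<^bsub>M\<^esub> x \<in> P"
  shows "submodule_gen (R Quot J) (mod_ideal R M J P)
      {ideal_smult R M J P +>\<^bsub>M\<^esub> (a \<odot>\<^bsub>M\<^esub> x) | a x. a \<in> I \<and> x \<in> X} =
    (\<lambda>x. ideal_smult R M J P +>\<^bsub>M\<^esub> x) ` ideal_smult R M I X"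
proof -
  have "{ideal_smult R M J P +>\<^bsub>M\<^esub> (a \<odot>\<^bsub>M\<^esub> x) | a x. a \<in> I \<and> x \<in> X} =
      (\<lambda>x. ideal_smult R M J P +>\<^bsub>M\<^esub> x) ` {a \<odot>\<^bsub>M\<^esub> x | a x. a \<in> I \<and> x \<in> X}"
    by blast
  moreover have "{a \<odot>\<^bsub>M\<^esub> x | a x. a \<in> I \<and> x \<in> X} \<subseteq> P" using IX by blast
  ultimately show ?thesis
    unfolding ideal_smult_def[of R M I] by (simp only: submodule_gen_mod_ideal[OF P])
qed

end

text \<open>A map f with f(P) \<subseteq> P' passes to P/JP \<rightarrow> P'/JP', given as g through
  its values on cosets. The actions of a fixed u and on a fixed x, and the projection onto the Rees
  module of M/N, are all of this kind.\<close>

lemma mod_ideal_linear_map: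
  assumes J: "ideal J R" and "linear_map R M N f"
    and P: "submodule P R M" and P': "submodule P' R N" and fP: "\<And>x. x \<in> P \<Longrightarrow> f x \<in> P'"
    and g: "\<And>x. x \<in> P \<Longrightarrow> g (ideal_smult R M J P +>\<^bsub>M\<^esub> x) = ideal_smult R N J P' +>\<^bsub>N\<^esub> f x"
  shows "linear_map (R Quot J) (mod_ideal R M J P) (mod_ideal R N J P') g"
proof -
  interpret f: linear_map R M N f by fact
  interpret M: module_with_ideal R M J
    by (rule module_with_ideal.intro[OF f.dom.module_axioms module_with_ideal_axioms.intro[OF J]])
  interpret N: module_with_ideal R N J
    by (rule module_with_ideal.intro[OF f.cod.module_axioms module_with_ideal_axioms.intro[OF J]])
  interpret MJ: Module.module "R Quot J" "mod_ideal R M J P" by (rule M.mod_ideal_module[OF P])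
  interpret NJ: Module.module "R Quot J" "mod_ideal R N J P'" by (rule N.mod_ideal_module[OF P'])
  have Pc: "\<And>x. x \<in> P \<Longrightarrow> x \<in> carrier M" using f.dom.submoduleE(1)[OF P] by auto
  note Ps = f.dom.submoduleE[OF P]
  show ?thesis
  proof unfold_locales
    fix X assume "X \<in> carrier (mod_ideal R M J P)"
    then obtain x where x: "x \<in> P" "X = ideal_smult R M J P +>\<^bsub>M\<^esub> x" by (auto simp: mod_ideal_simps)
    show "g X \<in> carrier (mod_ideal R N J P')"
      using x fP by (auto simp: g mod_ideal_simps(1))
    show "g (X \<oplus>\<^bsub>mod_ideal R M J P\<^esub> Y) = g X \<oplus>\<^bsub>mod_ideal R N J P'\<^esub> g Y"
      if Y: "Y \<in> carrier (mod_ideal R M J P)" for Y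
    proof -
      obtain y where y: "y \<in> P" "Y = ideal_smult R M J P +>\<^bsub>M\<^esub> y"
        using Y by (auto simp: mod_ideal_simps)
      then show ?thesis
        using x Ps(5)[OF x(1) y(1)] fP Pc
        by (simp add: M.mod_ideal_add[OF P] N.mod_ideal_add[OF P'] g f.map_add)
    qed
    show "g (a \<odot>\<^bsub>mod_ideal R M J P\<^esub> X) = a \<odot>\<^bsub>mod_ideal R N J P'\<^esub> g X"
      if a: "a \<in> carrier (R Quot J)" for a
    proof -
      obtain b where b: "b \<in> carrier R" "a = J +>\<^bsub>R\<^esub> b" using a by (auto simp: carrier_Quot)
      then show ?thesis
        using x Ps(4)[OF b(1) x(1)] fP Pc
        by (simp add: M.mod_ideal_smult[OF P] N.mod_ideal_smult[OF P'] g f.map_smult)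
    qed
  qed
qed

section \<open>Rees modules\<close>

lemma gact_rees_module:
  "gact (rees_module R J I M) i j X Y =
    (\<Union>u\<in>X. \<Union>x\<in>Y. ideal_smult R M J (ideal_smult R M (ideal_power R I (i + j)) (carrier M))
      +>\<^bsub>M\<^esub> (u \<odot>\<^bsub>M\<^esub> x))"
  by (simp add: rees_module_def Let_def)

locale rees_setting = module_with_ideal R M J
  for R :: "('r, 'd) ring_scheme" (structure) and M :: "('r, 'm, 'c) module_scheme" and J +
  fixes I
  assumes I: "ideal I R"
begin

definition filt where "filt n = ideal_smult R M (ideal_power R I n) (carrier M)"

definition cls where "cls n x = ideal_smult R M J (filt n) +>\<^bsub>M\<^esub> x"

definition acls where
  "acls n u = ideal_smult R (self_module R) J (ideal_power R I n) +>\<^bsub>self_module R\<^esub> u"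

lemma power_ideal: "ideal (ideal_power R I n) R"
  by (rule ideal_power_ideal[OF I])

lemma power_subset: "ideal_power R I n \<subseteq> carrier R"
  using ideal.Icarr[OF power_ideal] by auto

lemma filt_submodule: "submodule (filt n) R M"
  unfolding filt_def by (rule ideal_smult_submodule[OF power_subset subset_refl])

lemma filt_closed: "x \<in> filt n \<Longrightarrow> x \<in> carrier M"
  using submoduleE(1)[OF filt_submodule] by blast

lemma filt_add: "filt (i + j) = ideal_smult R M (ideal_power R I i) (filt j)"
  unfolding filt_def ideal_power_add[OF I]
  by (rule ideal_smult_ideal_prod[OF power_ideal power_ideal subset_refl])

lemma filt_Suc: "filt (Suc n) = ideal_smult R M I (filt n)"
  using filt_add[of 1 n] ideal_power_1[OF I] by simp

text \<open>The submodule J I^(i+j) M has two groupings, this one and the next: (J I^i)(I^j M)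
  absorbs a change of the representative in the algebra, I^i (J I^j M) a change of the
  representative in the module.\<close>

lemma J_filt_add:
  "ideal_smult R M J (filt (i + j)) = ideal_smult R M (J \<cdot> ideal_power R I i) (filt j)"
  unfolding filt_add
  by (rule ideal_smult_ideal_prod[symmetric, OF J power_ideal submoduleE(1)[OF filt_submodule]])

lemma J_filt_add':
  "ideal_smult R M J (filt (i + j)) =
    ideal_smult R M (ideal_power R I i) (ideal_smult R M J (filt j))"
  unfolding J_filt_add ideal_prod_commute[OF J power_ideal]
  by (rule ideal_smult_ideal_prod[OF power_ideal J submoduleE(1)[OF filt_submodule]])

lemma J_filt_submodule: "submodule (ideal_smult R M J (filt n)) R M"
  by (rule submodule_JP[OF filt_submodule])

lemma smult_filt: "u \<in> ideal_power R I i \<Longrightarrow> x \<in> filt j \<Longrightarrow> u \<odot>\<^bsub>M\<^esub> x \<in> filt (i + j)"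
  unfolding filt_add by (rule ideal_smult_memI)

lemma mcomp_rees_module: "mcomp (rees_module R J I M) n = mod_ideal R M J (filt n)"
  by (simp add: rees_module_def filt_def)

lemma gcomp_rees_algebra:
  "gcomp (rees_algebra R J I) n = mod_ideal R (self_module R) J (ideal_power R I n)"
  by (simp add: rees_algebra_def)

lemma carrier_mcomp: "carrier (mcomp (rees_module R J I M) n) = cls n ` filt n"
  unfolding mcomp_rees_module mod_ideal_simps cls_def ..

lemma carrier_gcomp: "carrier (gcomp (rees_algebra R J I) n) = acls n ` ideal_power R I n"
  unfolding gcomp_rees_algebra mod_ideal_simps acls_def ..

text \<open>The union over both representatives is collapsed from the inside: the choice of x is
  removed for every v in I^i, then the choice of u.\<close>

lemma gact_cls:
  assumes u: "u \<in> ideal_power R I i" and x: "x \<in> filt j"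
  shows "gact (rees_module R J I M) i j (acls i u) (cls j x) = cls (i + j) (u \<odot>\<^bsub>M\<^esub> x)"
proof -
  interpret self: Module.module R "self_module R" by (rule self_module_module)
  have JI: "ideal_smult R (self_module R) J (ideal_power R I i) = J \<cdot> ideal_power R I i"
    by (rule ideal_smult_self_module[OF J power_ideal])
  have uc: "u \<in> carrier R" using u power_subset by blast
  have xc: "x \<in> carrier M" by (rule filt_closed[OF x])
  have inner: "(\<Union>y\<in>cls j x. cls (i + j) (v \<odot>\<^bsub>M\<^esub> y)) = cls (i + j) (v \<odot>\<^bsub>M\<^esub> x)"
    if v: "v \<in> ideal_power R I i" for v
    unfolding cls_def
  proof (rule UN_coset_eq[OF J_filt_submodule xc])
    have vc: "v \<in> carrier R" using v power_subset by blast
    fix y assume y: "y \<in> carrier M" and d: "y \<ominus>\<^bsub>M\<^esub> x \<in> ideal_smult R M J (filt j)"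
    have "v \<odot>\<^bsub>M\<^esub> y \<ominus>\<^bsub>M\<^esub> v \<odot>\<^bsub>M\<^esub> x \<in> ideal_smult R M J (filt (i + j))"
      unfolding J_filt_add' smult_minus_distr[OF vc y xc] by (rule ideal_smult_memI[OF v d])
    then show "ideal_smult R M J (filt (i + j)) +>\<^bsub>M\<^esub> (v \<odot>\<^bsub>M\<^esub> y) =
        ideal_smult R M J (filt (i + j)) +>\<^bsub>M\<^esub> (v \<odot>\<^bsub>M\<^esub> x)"
      using vc y xc by (simp add: coset_eq_iff[OF J_filt_submodule])
  qed
  have "(\<Union>v\<in>acls i u. \<Union>y\<in>cls j x. cls (i + j) (v \<odot>\<^bsub>M\<^esub> y)) =
      (\<Union>y\<in>cls j x. cls (i + j) (u \<odot>\<^bsub>M\<^esub> y))"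
    unfolding acls_def JI
  proof (rule self.UN_coset_eq[OF ideal_submodule_self_module[OF ideal_prod_is_ideal[OF J power_ideal]]])
    show "u \<in> carrier (self_module R)" using uc by (simp add: self_module_simps)
    fix v assume "v \<in> carrier (self_module R)" and "v \<ominus>\<^bsub>self_module R\<^esub> u \<in> J \<cdot> ideal_power R I i"
    then have vc: "v \<in> carrier R" and d: "v \<ominus> u \<in> J \<cdot> ideal_power R I i"
      using uc by (simp_all add: self_module_simps a_minus_def a_inv_self_module)
    \<comment> \<open>Since J I^i \<subseteq> I^i, a representative v of the class of u lies in I^i
      again, as \<open>inner\<close> requires.\<close>
    have "v \<ominus> u \<in> ideal_power R I i" using d ideal_prod_inter[OF J power_ideal] by blast
    then have "(v \<ominus> u) \<oplus> u \<in> ideal_power R I i"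
      using u additive_subgroup.a_closed[OF ideal.axioms(1)[OF power_ideal]] by blast
    then have v: "v \<in> ideal_power R I i" using uc vc by (simp add: a_minus_def R.a_assoc R.l_neg)
    have "v \<odot>\<^bsub>M\<^esub> x \<ominus>\<^bsub>M\<^esub> u \<odot>\<^bsub>M\<^esub> x = (v \<ominus> u) \<odot>\<^bsub>M\<^esub> x"
      using uc vc xc by (simp add: a_minus_def smult_l_distr smult_l_minus)
    then have "v \<odot>\<^bsub>M\<^esub> x \<ominus>\<^bsub>M\<^esub> u \<odot>\<^bsub>M\<^esub> x \<in> ideal_smult R M J (filt (i + j))"
      unfolding J_filt_add using ideal_smult_memI[OF d x] by simp
    then show "(\<Union>y\<in>cls j x. cls (i + j) (v \<odot>\<^bsub>M\<^esub> y)) = (\<Union>y\<in>cls j x. cls (i + j) (u \<odot>\<^bsub>M\<^esub> y))"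
      unfolding inner[OF u] inner[OF v] using uc vc xc
      by (simp add: cls_def coset_eq_iff[OF J_filt_submodule])
  qed
  then show ?thesis
    unfolding inner[OF u] gact_rees_module by (simp add: cls_def filt_def)
qed

lemma mcomp_module: "Module.module (R Quot J) (mcomp (rees_module R J I M) n)"
  unfolding mcomp_rees_module by (rule mod_ideal_module[OF filt_submodule])

lemma gact_bilinear:
  "bilinear_map (R Quot J) (gcomp (rees_algebra R J I) i) (mcomp (rees_module R J I M) j)
    (mcomp (rees_module R J I M) (i + j)) (gact (rees_module R J I M) i j)"
  unfolding bilinear_map_def
proof (intro conjI ballI)
  fix U assume "U \<in> carrier (gcomp (rees_algebra R J I) i)"
  then obtain u where u: "u \<in> ideal_power R I i" "U = acls i u" by (auto simp: carrier_gcomp)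
  show "linear_map (R Quot J) (mcomp (rees_module R J I M) j) (mcomp (rees_module R J I M) (i + j))
      (gact (rees_module R J I M) i j U)"
    unfolding mcomp_rees_module u(2)
    by (rule mod_ideal_linear_map[OF J smult_linear_map[OF subsetD[OF power_subset u(1)]]
          filt_submodule filt_submodule])
       (use smult_filt[OF u(1)] gact_cls[OF u(1)] in \<open>auto simp: cls_def\<close>)
next
  fix X assume "X \<in> carrier (mcomp (rees_module R J I M) j)"
  then obtain x where x: "x \<in> filt j" "X = cls j x" by (auto simp: carrier_mcomp)
  interpret self: Module.module R "self_module R" by (rule self_module_module)
  have lin: "linear_map R (self_module R) M (\<lambda>u. u \<odot>\<^bsub>M\<^esub> x)"
    by unfold_locales
      (use filt_closed[OF x(1)] in
      \<open>auto simp: self_module_simps smult_l_distr smult_assoc1\<close>)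
  show "linear_map (R Quot J) (gcomp (rees_algebra R J I) i) (mcomp (rees_module R J I M) (i + j))
      (\<lambda>U. gact (rees_module R J I M) i j U X)"
    unfolding mcomp_rees_module gcomp_rees_algebra x(2)
    by (rule mod_ideal_linear_map[OF J lin ideal_submodule_self_module[OF power_ideal] filt_submodule])
       (use smult_filt[OF _ x(1)] gact_cls[OF _ x(1)] in \<open>auto simp: cls_def acls_def\<close>)
qed

end

section \<open>The Rees algebra and the standardness of Rees modules\<close>

text \<open>Because I^n A = I^n, the Rees algebra is the Rees module of the ring itself, and
  well-definedness and bilinearity of its product are cases of those of the action.\<close>

lemma (in cring) rees_algebra_eq_rees_module:
  assumes I: "ideal I R" and J: "ideal J R"
  shows gcomp_rees_eq_mcomp:
      "gcomp (rees_algebra R J I) n = mcomp (rees_module R J I (self_module R)) n"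
    and gmult_rees_eq_gact:
      "gmult (rees_algebra R J I) = gact (rees_module R J I (self_module R))"
proof -
  note p = ideal_power_ideal[OF I]
  have "ideal_smult R (self_module R) (ideal_power R I n) (carrier R) = ideal_power R I n" for n
    by (simp add: ideal_smult_self_module[OF p oneideal] ideal_prod_one[OF p])
  then show "gcomp (rees_algebra R J I) n = mcomp (rees_module R J I (self_module R)) n"
    "gmult (rees_algebra R J I) = gact (rees_module R J I (self_module R))"
    by (simp_all add: rees_algebra_def rees_module_def Let_def self_module_simps
        ideal_smult_self_module[OF J p] a_r_coset_self_module)
qed

context rees_setting
begin

lemma rees_setting_self: "rees_setting R (self_module R) J I"
  by (intro rees_setting.intro module_with_ideal.intro module_with_ideal_axioms.intro
      rees_setting_axioms.intro self_module_module I J)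

interpretation self: rees_setting R "self_module R" J I
  by (rule rees_setting_self)

lemma self_filt: "self.filt n = ideal_power R I n"
  by (simp add: self.filt_def self_module_simps ideal_smult_self_module[OF power_ideal oneideal]
      ideal_prod_one[OF power_ideal])

lemma self_cls: "self.cls n = acls n"
  by (intro ext) (simp add: self.cls_def acls_def self_filt)

lemma gmult_acls:
  "u \<in> ideal_power R I i \<Longrightarrow> v \<in> ideal_power R I j \<Longrightarrow>
    gmult (rees_algebra R J I) i j (acls i u) (acls j v) = acls (i + j) (u \<otimes> v)"
  using self.gact_cls[of u i v j]
  by (simp add: gmult_rees_eq_gact[OF I J] self_filt self_cls self_module_simps)

lemma mult_power:
  assumes "u \<in> ideal_power R I i" "v \<in> ideal_power R I j"
  shows "u \<otimes> v \<in> ideal_power R I (i + j)"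
  unfolding ideal_power_add[OF I] by (rule ideal_prod.prod[OF assms])

lemma gone_rees: "gone (rees_algebra R J I) = acls 0 \<one>"
  by (simp add: rees_algebra_def acls_def ideal_power_0[OF I] ideal_smult_self_module[OF J oneideal]
      ideal_prod_one[OF J] a_r_coset_self_module)

lemma rees_graded_commutative_algebra:
  "graded_commutative_algebra (R Quot J) (rees_algebra R J I)"
proof (rule graded_commutative_algebra.intro)
  let ?U = "rees_algebra R J I"
  have pc: "\<And>u n. u \<in> ideal_power R I n \<Longrightarrow> u \<in> carrier R" using power_subset by blast
  show "Module.module (R Quot J) (gcomp ?U n)" for n
    unfolding gcomp_rees_eq_mcomp[OF I J] by (rule self.mcomp_module)
  show "gone ?U \<in> carrier (gcomp ?U 0)"
    unfolding gone_rees carrier_gcomp by (rule imageI) (simp add: ideal_power_0[OF I])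
  show "bilinear_map (R Quot J) (gcomp ?U i) (gcomp ?U j) (gcomp ?U (i + j)) (gmult ?U i j)" for i j
    using self.gact_bilinear[of i j] unfolding gmult_rees_eq_gact[OF I J]
    by (simp add: gcomp_rees_eq_mcomp[OF I J])
  show "gmult ?U (i + j) k (gmult ?U i j u v) w = gmult ?U i (j + k) u (gmult ?U j k v w)"
    if "u \<in> carrier (gcomp ?U i)" "v \<in> carrier (gcomp ?U j)" "w \<in> carrier (gcomp ?U k)"
    for u v w i j k
    using that unfolding carrier_gcomp
    by (elim imageE) (simp add: gmult_acls mult_power m_assoc pc add.assoc)
  show "gmult ?U i j u v = gmult ?U j i v u"
    if "u \<in> carrier (gcomp ?U i)" "v \<in> carrier (gcomp ?U j)" for u v i j
    using that unfolding carrier_gcomp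
    by (elim imageE) (simp add: gmult_acls m_comm[OF pc pc] add.commute)
qed

text \<open>Generators correspond by \<open>gact_cls\<close>, and reduction modulo J commutes with
  spans. With X = I^n M it gives standardness of the Rees module, with X = I^n M \<inter> N the
  submodule U_1 H_n.\<close>

lemma gact_generators_eq:
  assumes "X \<subseteq> filt n"
  shows "submodule_gen (R Quot J) (mcomp (rees_module R J I M) (Suc n))
      {gact (rees_module R J I M) 1 n v h | v h.
        v \<in> carrier (gcomp (rees_algebra R J I) 1) \<and> h \<in> cls n ` X} =
    cls (Suc n) ` ideal_smult R M I X"
proof -
  have a: "gact (rees_module R J I M) 1 n (acls 1 a) (cls n x) = cls (Suc n) (a \<odot>\<^bsub>M\<^esub> x)"
    if "a \<in> I" "x \<in> X" for a x
    using gact_cls[of a 1 x n] that assms ideal_power_1[OF I] by auto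
  have "{gact (rees_module R J I M) 1 n v h | v h.
        v \<in> carrier (gcomp (rees_algebra R J I) 1) \<and> h \<in> cls n ` X} =
      {cls (Suc n) (a \<odot>\<^bsub>M\<^esub> x) | a x. a \<in> I \<and> x \<in> X}"
    unfolding carrier_gcomp ideal_power_1[OF I]
  proof (intro equalityI subsetI)
    fix z assume "z \<in> {gact (rees_module R J I M) 1 n v h | v h. v \<in> acls 1 ` I \<and> h \<in> cls n ` X}"
    then obtain b x where "z = gact (rees_module R J I M) 1 n (acls 1 b) (cls n x)" "b \<in> I" "x \<in> X"
      by blast
    then show "z \<in> {cls (Suc n) (a \<odot>\<^bsub>M\<^esub> x) | a x. a \<in> I \<and> x \<in> X}" using a by auto
  next
    fix z assume "z \<in> {cls (Suc n) (a \<odot>\<^bsub>M\<^esub> x) | a x. a \<in> I \<and> x \<in> X}"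
    then obtain b x where "z = cls (Suc n) (b \<odot>\<^bsub>M\<^esub> x)" "b \<in> I" "x \<in> X" by blast
    then have "z = gact (rees_module R J I M) 1 n (acls 1 b) (cls n x)" "b \<in> I" "x \<in> X"
      using a by simp_all
    then show "z \<in> {gact (rees_module R J I M) 1 n v h | v h. v \<in> acls 1 ` I \<and> h \<in> cls n ` X}"
      by blast
  qed
  moreover have "a \<odot>\<^bsub>M\<^esub> x \<in> filt (Suc n)" if "a \<in> I" "x \<in> X" for a x
    unfolding filt_Suc by (rule ideal_smult_memI) (use that assms in auto)
  ultimately show ?thesis
    using image_mod_ideal_smult[OF filt_submodule, of I X "Suc n"]
    unfolding mcomp_rees_module by (simp add: cls_def)
qed

lemma rees_standard_module: "standard_module (R Quot J) (rees_algebra R J I) (rees_module R J I M)"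
proof (intro standard_module.intro standard_module_axioms.intro rees_graded_commutative_algebra)
  let ?U = "rees_algebra R J I" and ?F = "rees_module R J I M"
  have pc: "\<And>u n. u \<in> ideal_power R I n \<Longrightarrow> u \<in> carrier R" using power_subset by blast
  show "Module.module (R Quot J) (mcomp ?F n)" for n by (rule mcomp_module)
  show "bilinear_map (R Quot J) (gcomp ?U i) (mcomp ?F j) (mcomp ?F (i + j)) (gact ?F i j)" for i j
    by (rule gact_bilinear)
  show "gact ?F (i + j) k (gmult ?U i j u v) x = gact ?F i (j + k) u (gact ?F j k v x)"
    if "u \<in> carrier (gcomp ?U i)" "v \<in> carrier (gcomp ?U j)" "x \<in> carrier (mcomp ?F k)"
    for u v x i j k
    using that unfolding carrier_gcomp carrier_mcomp
    by (elim imageE)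
       (simp add: gmult_acls gact_cls mult_power smult_filt smult_assoc1[OF pc pc filt_closed]
         add.assoc)
  show "gact ?F 0 n (gone ?U) x = x" if "x \<in> carrier (mcomp ?F n)" for x n
    using that unfolding carrier_mcomp gone_rees
    by (elim imageE) (simp add: gact_cls ideal_power_0[OF I] filt_closed)
  \<comment> \<open>This is I^(n+1) M = I (I^n M), reduced modulo J.\<close>
  show "carrier (mcomp ?F (Suc n)) \<subseteq> submodule_gen (R Quot J) (mcomp ?F (Suc n))
      {gact ?F 1 n v x | v x. v \<in> carrier (gcomp ?U 1) \<and> x \<in> carrier (mcomp ?F n)}" for n
    unfolding carrier_mcomp[of n] gact_generators_eq[OF subset_refl] carrier_mcomp filt_Suc ..
qed

end

section \<open>Rees modules of a quotient\<close>

locale rees_quotient = rees_setting R M J I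
  for R :: "('r, 'd) ring_scheme" (structure) and M :: "('r, 'm, 'c) module_scheme" and J I +
  fixes N
  assumes N: "submodule N R M"
begin

abbreviation L where "L \<equiv> quotient_module M N"
abbreviation q where "q x \<equiv> N +>\<^bsub>M\<^esub> x"

sublocale q: linear_map R M L q
  by (rule quotient_module_linear_map[OF N])

lemma rees_setting_quotient: "rees_setting R L J I"
  by (intro rees_setting.intro module_with_ideal.intro module_with_ideal_axioms.intro
      rees_setting_axioms.intro q.cod.module_axioms I J)

sublocale L: rees_setting R L J I
  by (rule rees_setting_quotient)

text \<open>Linear images commute with multiplication by an ideal, and the image of M is all of
  M/N.\<close>

lemma filt_quotient: "L.filt n = q ` filt n"
  unfolding L.filt_def filt_def q.image_ideal_smult[OF power_subset subset_refl]
    carrier_quotient_module ..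

lemma J_filt_quotient: "ideal_smult R L J (L.filt n) = q ` ideal_smult R M J (filt n)"
  unfolding filt_quotient q.image_ideal_smult[OF J_subset submoduleE(1)[OF filt_submodule]] ..

lemma J_filt_closed: "x \<in> ideal_smult R M J (filt n) \<Longrightarrow> x \<in> carrier M"
  using submoduleE(1)[OF J_filt_submodule] by blast

lemma cls_eq_iff:
  "x \<in> filt n \<Longrightarrow> y \<in> filt n \<Longrightarrow> cls n x = cls n y \<longleftrightarrow> x \<ominus>\<^bsub>M\<^esub> y \<in> ideal_smult R M J (filt n)"
  unfolding cls_def by (rule mod_ideal_coset_eq_iff[OF filt_submodule])

text \<open>The morphism of Rees modules induced by M \<rightarrow> M/N; the argument X is a class
  modulo J I^n M.\<close>

definition \<phi> where "\<phi> n X = the_elem ((\<lambda>x. L.cls n (q x)) ` X)"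

lemma \<phi>_cls:
  assumes x: "x \<in> filt n"
  shows "\<phi> n (cls n x) = L.cls n (q x)"
  unfolding \<phi>_def
proof (rule the_elem_image_eq)
  have xc: "x \<in> carrier M" by (rule filt_closed[OF x])
  show "x \<in> cls n x" unfolding cls_def by (rule mem_coset_self[OF J_filt_submodule xc])
  fix y assume "y \<in> cls n x"
  note y = mem_cosetD[OF J_filt_submodule xc this[unfolded cls_def]]
  have "q y \<ominus>\<^bsub>L\<^esub> q x \<in> ideal_smult R L J (L.filt n)"
    unfolding J_filt_quotient q.map_minus[OF y(1) xc, symmetric] by (rule imageI[OF y(2)])
  then show "L.cls n (q y) = L.cls n (q x)"
    unfolding L.cls_def q.cod.coset_eq_iff[OF L.J_filt_submodule q.map_closed[OF y(1)] q.map_closed[OF xc]] .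
qed

lemma rees_epi:
  "standard_module_epi (R Quot J) (rees_algebra R J I) (rees_module R J I M) (rees_module R J I L) \<phi>"
proof (intro standard_module_epi.intro standard_module_epi_axioms.intro rees_standard_module
    L.rees_standard_module)
  let ?U = "rees_algebra R J I" and ?F = "rees_module R J I M" and ?G = "rees_module R J I L"
  show "linear_map (R Quot J) (mcomp ?F n) (mcomp ?G n) (\<phi> n)" for n
    unfolding mcomp_rees_module L.mcomp_rees_module
    by (rule mod_ideal_linear_map[OF J q.linear_map_axioms filt_submodule L.filt_submodule])
       (use \<phi>_cls in \<open>auto simp: filt_quotient cls_def L.cls_def\<close>)
  show "\<phi> (i + j) (gact ?F i j u x) = gact ?G i j u (\<phi> j x)"
    if ux: "u \<in> carrier (gcomp ?U i)" "x \<in> carrier (mcomp ?F j)" for u x i j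
  proof -
    obtain a y where a: "a \<in> ideal_power R I i" "u = acls i a" and y: "y \<in> filt j" "x = cls j y"
      using ux unfolding carrier_gcomp carrier_mcomp by blast
    have "q (a \<odot>\<^bsub>M\<^esub> y) = a \<odot>\<^bsub>L\<^esub> q y"
      by (rule q.map_smult[OF subsetD[OF power_subset a(1)] filt_closed[OF y(1)]])
    then show ?thesis
      using L.gact_cls[OF a(1), of "q y" j] y
      by (simp add: gact_cls[OF a(1) y(1)] a(2) \<phi>_cls smult_filt[OF a(1) y(1)] filt_quotient)
  qed
  show "\<phi> n ` carrier (mcomp ?F n) = carrier (mcomp ?G n)" for n
    unfolding carrier_mcomp L.carrier_mcomp filt_quotient image_image
    by (rule image_cong[OF refl \<phi>_cls])
qed

sublocale epi: standard_module_epi "R Quot J" "rees_algebra R J I" "rees_module R J I M"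
    "rees_module R J I L" \<phi>
  by (rule rees_epi)

text \<open>The class vanishes when x + N lies in J I^n (M/N), which is the image of J I^n M; that
  is, when x lies in J I^n M + N.\<close>

lemma mem_ker_iff:
  assumes x: "x \<in> filt n"
  shows "cls n x \<in> epi.ker n \<longleftrightarrow> (\<exists>y\<in>ideal_smult R M J (filt n). x \<ominus>\<^bsub>M\<^esub> y \<in> N)"
proof -
  have "cls n x \<in> epi.ker n \<longleftrightarrow> L.cls n (q x) = \<zero>\<^bsub>mod_ideal R L J (L.filt n)\<^esub>"
    using x by (simp add: epi.mem_ker carrier_mcomp \<phi>_cls L.mcomp_rees_module)
  also have "\<dots> \<longleftrightarrow> q x \<in> ideal_smult R L J (L.filt n)"
    unfolding L.cls_def
    by (rule L.mod_ideal_coset_zero[OF L.filt_submodule]) (simp add: filt_quotient x)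
  also have "\<dots> \<longleftrightarrow> (\<exists>y\<in>ideal_smult R M J (filt n). q x = q y)"
    unfolding J_filt_quotient by blast
  also have "\<dots> \<longleftrightarrow> (\<exists>y\<in>ideal_smult R M J (filt n). x \<ominus>\<^bsub>M\<^esub> y \<in> N)"
    using coset_eq_iff[OF N filt_closed[OF x] J_filt_closed] by blast
  finally show ?thesis .
qed

text \<open>Subtracting the y of \<open>mem_ker_iff\<close> moves the representative into N without
  changing its class. So \<open>ker n\<close> is (I^n M \<inter> N + J I^n M) / J I^n M, isomorphic
  to (I^n M \<inter> N) / (J I^n M \<inter> N).\<close>

lemma ker_eq: "epi.ker n = cls n ` (filt n \<inter> N)"
proof (intro equalityI subsetI)
  have sub: "ideal_smult R M J (filt n) \<subseteq> filt n"
    by (rule ideal_smult_subset[OF J_subset filt_submodule])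
  fix h assume h: "h \<in> epi.ker n"
  then obtain x where x: "x \<in> filt n" "h = cls n x" by (auto simp: epi.mem_ker carrier_mcomp)
  then obtain y where y: "y \<in> ideal_smult R M J (filt n)" "x \<ominus>\<^bsub>M\<^esub> y \<in> N"
    using h mem_ker_iff by blast
  have xy: "x \<ominus>\<^bsub>M\<^esub> y \<in> filt n"
    using minus_mem_submodule[OF filt_submodule x(1)] y(1) sub by blast
  have "x \<ominus>\<^bsub>M\<^esub> (x \<ominus>\<^bsub>M\<^esub> y) = y"
    using filt_closed[OF x(1)] J_filt_closed[OF y(1)]
    by (simp add: a_minus_def M.minus_add M.r_neg flip: M.a_assoc)
  then have "h = cls n (x \<ominus>\<^bsub>M\<^esub> y)"
    using x(2) y(1) cls_eq_iff[OF x(1) xy] by simp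
  then show "h \<in> cls n ` (filt n \<inter> N)" using xy y(2) by blast
next
  fix h assume "h \<in> cls n ` (filt n \<inter> N)"
  then obtain x where x: "x \<in> filt n" "x \<in> N" "h = cls n x" by blast
  have "x \<ominus>\<^bsub>M\<^esub> \<zero>\<^bsub>M\<^esub> = x" using filt_closed[OF x(1)] by (simp add: a_minus_def)
  then show "h \<in> epi.ker n"
    unfolding x(3) mem_ker_iff[OF x(1)]
    by (intro bexI[OF _ zero_mem_submodule[OF J_filt_submodule]]) (simp add: x(2))
qed

lemma ker_shift_eq: "epi.ker_shift n = cls (Suc n) ` ideal_smult R M I (filt n \<inter> N)"
  unfolding epi.ker_shift_def ker_eq by (rule gact_generators_eq) simp

lemma I_subset: "I \<subseteq> carrier R"
  using ideal.Icarr[OF I] by auto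

lemma I_filt_Int_submodule: "submodule (ideal_smult R M I (filt n \<inter> N)) R M"
  by (rule ideal_smult_submodule[OF I_subset]) (use filt_closed in blast)

text \<open>Modulo J I^(n+1) M, the right-hand inclusion says that I^(n+1) M \<inter> N lies in I
  (I^n M \<inter> N) + J I^(n+1) M. By the modular law the last summand may be intersected with N,
  since I (I^n M \<inter> N) is contained in N.\<close>

lemma zero_artin_rees_iff:
  "zero_module (artin_rees_module R J N M I (Suc n)) \<longleftrightarrow> epi.ker (Suc n) \<subseteq> epi.ker_shift n"
proof -
  let ?Y = "ideal_smult R M I (filt n \<inter> N)" and ?Z = "ideal_smult R M J (filt (Suc n)) \<inter> N"
  note Y = I_filt_Int_submodule[of n]
  have Z: "submodule ?Z R M" by (rule submodule_Int[OF J_filt_submodule N])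
  have "?Y \<subseteq> filt (Suc n)"
    unfolding filt_Suc
    by (rule ideal_smult_least[OF ideal_smult_submodule[OF I_subset submoduleE(1)[OF filt_submodule]]])
       (auto intro: ideal_smult_memI)
  moreover have "?Y \<subseteq> N"
    by (rule ideal_smult_least[OF N]) (use submoduleE(4)[OF N] I_subset in auto)
  ultimately have YN: "?Y \<subseteq> filt (Suc n) \<inter> N" by blast
  have "zero_module (artin_rees_module R J N M I (Suc n)) \<longleftrightarrow>
      filt (Suc n) \<inter> N \<subseteq> ?Y <+>\<^bsub>M\<^esub> ?Z"
    unfolding artin_rees_module_def Let_def diff_Suc_1 filt_def[symmetric]
    by (rule zero_module_subquotient_iff[OF submodule_Int[OF filt_submodule N]
          submodule_set_add[OF Y Z]])
  also have "\<dots> \<longleftrightarrow> (\<forall>x\<in>filt (Suc n) \<inter> N. \<exists>y\<in>?Y. cls (Suc n) x = cls (Suc n) y)"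
    unfolding subset_iff Ball_def[symmetric]
  proof (rule ball_cong[OF refl])
    fix x assume x: "x \<in> filt (Suc n) \<inter> N"
    then have xc: "x \<in> carrier M" using filt_closed by blast
    have "x \<in> ?Y <+>\<^bsub>M\<^esub> ?Z \<longleftrightarrow> (\<exists>y\<in>?Y. x \<ominus>\<^bsub>M\<^esub> y \<in> ?Z)"
    proof
      assume "x \<in> ?Y <+>\<^bsub>M\<^esub> ?Z"
      then obtain y z where "y \<in> ?Y" "z \<in> ?Z" "x = y \<oplus>\<^bsub>M\<^esub> z" unfolding set_add_def' by blast
      moreover from this have "y \<in> carrier M" "z \<in> carrier M"
        using submoduleE(1)[OF Y] submoduleE(1)[OF Z] by blast+
      ultimately have "x \<ominus>\<^bsub>M\<^esub> y = z"
        by (simp add: a_minus_def M.a_comm[of y] M.a_assoc M.r_neg)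
      then show "\<exists>y\<in>?Y. x \<ominus>\<^bsub>M\<^esub> y \<in> ?Z" using \<open>y \<in> ?Y\<close> \<open>z \<in> ?Z\<close> by blast
    next
      assume "\<exists>y\<in>?Y. x \<ominus>\<^bsub>M\<^esub> y \<in> ?Z"
      then obtain y where y: "y \<in> ?Y" "x \<ominus>\<^bsub>M\<^esub> y \<in> ?Z" by blast
      then have "y \<in> carrier M" using submoduleE(1)[OF Y] by blast
      then have "x = y \<oplus>\<^bsub>M\<^esub> (x \<ominus>\<^bsub>M\<^esub> y)"
        using xc by (simp add: a_minus_def M.a_comm[of y] M.a_assoc M.l_neg)
      then show "x \<in> ?Y <+>\<^bsub>M\<^esub> ?Z" unfolding set_add_def' using y by blast
    qed
    also have "\<dots> \<longleftrightarrow> (\<exists>y\<in>?Y. cls (Suc n) x = cls (Suc n) y)"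
    proof (rule bex_cong[OF refl])
      fix y assume "y \<in> ?Y"
      then have y: "y \<in> filt (Suc n)" "y \<in> N" using YN by auto
      \<comment> \<open>The modular law at work: x and y both lie in N, so only membership of the
        difference in J I^(n+1) M remains, which is equality of classes.\<close>
      have "x \<ominus>\<^bsub>M\<^esub> y \<in> N" using minus_mem_submodule[OF N] x y(2) by blast
      then show "x \<ominus>\<^bsub>M\<^esub> y \<in> ?Z \<longleftrightarrow> cls (Suc n) x = cls (Suc n) y"
        using cls_eq_iff[of x "Suc n" y] x y(1) by simp
    qed
    finally show "x \<in> ?Y <+>\<^bsub>M\<^esub> ?Z \<longleftrightarrow> (\<exists>y\<in>?Y. cls (Suc n) x = cls (Suc n) y)" .
  qed
  also have "\<dots> \<longleftrightarrow> epi.ker (Suc n) \<subseteq> epi.ker_shift n"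
    unfolding ker_eq ker_shift_eq by blast
  finally show ?thesis .
qed

lemma artin_rees_zero_if_effective_relations_zero:
  assumes "n \<ge> 1"
    and "zero_module (effective_relations (R Quot J) (rees_algebra R J I) (rees_module R J I L) n)"
  shows "zero_module (artin_rees_module R J N M I n)"
  using assms epi.ker_subset_if_effective_relations_zero[of "n - 1"] zero_artin_rees_iff[of "n - 1"]
  by simp

lemma effective_relations_quotient_zero:
  assumes "n \<ge> 1"
    and "zero_module (effective_relations (R Quot J) (rees_algebra R J I) (rees_module R J I M) n)"
    and "zero_module (artin_rees_module R J N M I n)"
  shows "zero_module (effective_relations (R Quot J) (rees_algebra R J I) (rees_module R J I L) n)"
  using assms epi.effective_relations_zero_if_ker_subset[of "n - 1"] zero_artin_rees_iff[of "n - 1"]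
  by simp

end

section \<open>From vanishing in each degree to the two numbers\<close>

text \<open>If A or B is empty, the right side is \<infinity>; otherwise both infima are attained
  and their maximum belongs to C.\<close>

lemma enat_Inf_le_max_Inf:
  assumes "\<And>r s. r \<in> A \<Longrightarrow> s \<in> B \<Longrightarrow> max r s \<in> (C :: enat set)"
  shows "Inf C \<le> max (Inf A) (Inf B)"
proof (cases "A = {} \<or> B = {}")
  case True
  then show ?thesis by (auto simp: max_def top_enat_def)
next
  case False
  then have "Inf A \<in> A" "Inf B \<in> B" by (auto intro: wellorder_InfI)
  then show ?thesis using assms Inf_lower by blast
qed

theorem proposition3p3:
  fixes A :: "('a, 'd) ring_scheme" and M :: "('a, 'm, 'c) module_scheme"
    and I J :: "'a set" and N :: "'m set"
  assumes "cring A" and "ideal I A" and "ideal J A"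
    and "Module.module A M" and "submodule N A M"
  shows "artin_rees_number A J N M I \<le> rt A J I (quotient_module M N) \<and>
         rt A J I (quotient_module M N) \<le> max (rt A J I M) (artin_rees_number A J N M I)"
proof -
  interpret rees_quotient A M J I N
    by (intro rees_quotient.intro rees_setting.intro module_with_ideal.intro
        module_with_ideal_axioms.intro rees_setting_axioms.intro rees_quotient_axioms.intro assms)
  show ?thesis
  proof
    show "artin_rees_number A J N M I \<le> rt A J I (quotient_module M N)"
      unfolding artin_rees_number_def rt_def relation_type_def
      by (rule Inf_superset_mono) (use artin_rees_zero_if_effective_relations_zero in fastforce)
    show "rt A J I (quotient_module M N) \<le> max (rt A J I M) (artin_rees_number A J N M I)"
      unfolding artin_rees_number_def rt_def relation_type_def
    proof (rule enat_Inf_le_max_Inf)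
      let ?E = "\<lambda>L n. zero_module
        (effective_relations (A Quot J) (rees_algebra A J I) (rees_module A J I L) n)"
      let ?AR = "\<lambda>n. zero_module (artin_rees_module A J N M I n)"
      fix r s assume "r \<in> {enat r | r. r \<ge> 1 \<and> (\<forall>n\<ge>r + 1. ?E M n)}"
        and "s \<in> {enat s | s. \<forall>n\<ge>s + 1. ?AR n}"
      then obtain r' s' where r: "r = enat r'" "r' \<ge> 1" "\<And>n. n \<ge> r' + 1 \<Longrightarrow> ?E M n"
        and s: "s = enat s'" "\<And>n. n \<ge> s' + 1 \<Longrightarrow> ?AR n" by blast
      have "?E (quotient_module M N) n" if "n \<ge> max r' s' + 1" for n
        by (rule effective_relations_quotient_zero) (use that r s in auto)
      moreover have "max r s = enat (max r' s')" using r(1) s(1) by (simp add: max_def)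
      \<comment> \<open>While s' may be 0, the lower bound that a relation type requires is
        inherited from r'.\<close>
      moreover have "max r' s' \<ge> 1" using r(2) by simp
      ultimately show "max r s \<in> {enat r | r. r \<ge> 1 \<and> (\<forall>n\<ge>r + 1. ?E (quotient_module M N) n)}"
        by blast
    qed
  qed
qed

end
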